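(* Let $G$ be a locally compact Abelian group, let $(A_n)_{n\in\mathbb N}$ be a van Hove sequence in $G$, let $1\leqslant p<\infty$, and let $f\in L^p_{\mathrm{loc}}(G)$. Then the following statements are equivalent. (1) $f$ is Weyl $p$-almost periodic (with respect to $(A_n)_{n\in\mathbb N}$). (2) For every $\varepsilon>0$, there is a relatively dense set $R\subseteq G$ and a number $N\in\mathbb N$ such that $\|f-T_tf\|_{S^p_{A_n}}<\varepsilon$ for all $n\geqslant N$ and all $t\in R$.
   Context: $\theta_G$ is Haar measure. For a compact set $K$ and an open set $A$, $\partial^K A:=(\overline{A+K}\setminus A)\cup(((G\setminus A)-K)\cap\overline A)$. A van Hove sequence is a sequence $(A_n)_{n\in\mathbb N}$ of precompact open subsets of $G$ with $\lim_{n\to\infty}\theta_G(\partial^K A_n)/\theta_G(A_n)=0$ for every compact $K\subseteq G$. $$\|f\|_{S^p_{A_n}}:=\sup_{y\in G}\Big(\frac{1}{\theta_G(A_n)}\int_{y+A_n}|f(x)|^p\,d\theta_G(x)\Big)^{1/p}.$$ $f\in L^p_{\mathrm{loc}}(G)$ is Weyl $p$-almost periodic with respect to $(A_n)$ if there is a sequence $(p_m)_{m\in\mathbb N}$ of trigonometric polynomials (finite complex linear combinations of continuous characters of $G$) with $\lim_{m\to\infty}\limsup_{n\to\infty}\|f-p_m\|_{S^p_{A_n}}=0$. $T_tf(x):=f(x-t)$. A set $R\subseteq G$ is relatively dense if there is a compact set $K'$ with $R+K'=G$. *)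

theory Defs
  imports "HOL-Analysis.Analysis"
begin

text \<open>
  A locally compact Abelian group is a type \<open>'a :: {topological_ab_group_add, t2_space}\<close> (so
  Hausdorff is part of the convention) together with the assumption
  \<open>locally_compact_space (euclidean :: 'a topology)\<close>; the group is written additively.
\<close>

text \<open>A Haar measure is a nonzero translation-invariant Radon measure on the Borel sets.\<close>

definition haar_measure :: "'a::{topological_ab_group_add, t2_space} measure \<Rightarrow> bool" where
  "haar_measure \<theta> \<longleftrightarrow>
     sets \<theta> = sets borel \<and>
     emeasure \<theta> UNIV \<noteq> 0 \<and>
     (\<forall>K. compact K \<longrightarrow> emeasure \<theta> K < \<infinity>) \<and>
     (\<forall>B\<in>sets borel. emeasure \<theta> B = (INF U\<in>{U. open U \<and> B \<subseteq> U}. emeasure \<theta> U)) \<and>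
     (\<forall>U. open U \<longrightarrow> emeasure \<theta> U = (SUP K\<in>{K. compact K \<and> K \<subseteq> U}. emeasure \<theta> K)) \<and>
     (\<forall>B\<in>sets borel. \<forall>t. emeasure \<theta> ((+) t ` B) = emeasure \<theta> B)"

text \<open>
  On sets, binary minus denotes set difference, so the group-theoretic sum and difference of sets
  are spelled out as comprehensions.
\<close>

definition van_hove_boundary :: "'a::topological_ab_group_add set \<Rightarrow> 'a set \<Rightarrow> 'a set" where
  "van_hove_boundary K A =
     (closure {a + k | a k. a \<in> A \<and> k \<in> K} - A) \<union>
     ({b - k | b k. b \<in> UNIV - A \<and> k \<in> K} \<inter> closure A)"

text \<open>
  Nonemptiness of the sets \<open>A n\<close> is implicit in forming the quotient below: nonempty open sets
  have positive Haar measure, whereas \<open>0 / 0 = 0\<close> in \<^typ>\<open>ennreal\<close>.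
\<close>

definition van_hove_sequence ::
  "'a::{topological_ab_group_add, t2_space} measure \<Rightarrow> (nat \<Rightarrow> 'a set) \<Rightarrow> bool" where
  "van_hove_sequence \<theta> A \<longleftrightarrow>
     (\<forall>n. open (A n) \<and> compact (closure (A n)) \<and> A n \<noteq> {}) \<and>
     (\<forall>K. compact K \<longrightarrow>
        (\<lambda>n. emeasure \<theta> (van_hove_boundary K (A n)) / emeasure \<theta> (A n)) \<longlonglongrightarrow> 0)"

text \<open>The elements are Borel representatives rather than classes of functions.\<close>

definition Lp_loc ::
  "'a::{topological_ab_group_add, t2_space} measure \<Rightarrow> real \<Rightarrow> ('a \<Rightarrow> complex) set" where
  "Lp_loc \<theta> p =
     {f \<in> borel_measurable borel.
        \<forall>K. compact K \<longrightarrow> (\<integral>\<^sup>+x\<in>K. ennreal (norm (f x) powr p) \<partial>\<theta>) < \<infinity>}"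

definition ennreal_root :: "real \<Rightarrow> ennreal \<Rightarrow> ennreal" where
  "ennreal_root p x = (if x = \<infinity> then \<infinity> else ennreal (enn2real x powr (1 / p)))"

definition stepanov_norm ::
  "'a::{topological_ab_group_add, t2_space} measure \<Rightarrow> real \<Rightarrow> 'a set \<Rightarrow> ('a \<Rightarrow> complex) \<Rightarrow> ennreal" where
  "stepanov_norm \<theta> p A f =
     (SUP y. ennreal_root p
        ((1 / emeasure \<theta> A) * (\<integral>\<^sup>+x\<in>(+) y ` A. ennreal (norm (f x) powr p) \<partial>\<theta>)))"

definition continuous_character :: "('a::topological_ab_group_add \<Rightarrow> complex) \<Rightarrow> bool" where
  "continuous_character \<psi> \<longleftrightarrow>
     continuous_on UNIV \<psi> \<and> (\<forall>x. norm (\<psi> x) = 1) \<and> (\<forall>x y. \<psi> (x + y) = \<psi> x * \<psi> y)"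

definition trigonometric_polynomial :: "('a::topological_ab_group_add \<Rightarrow> complex) \<Rightarrow> bool" where
  "trigonometric_polynomial P \<longleftrightarrow>
     (\<exists>X c. finite X \<and> (\<forall>\<psi>\<in>X. continuous_character \<psi>) \<and> P = (\<lambda>x. \<Sum>\<psi>\<in>X. c \<psi> * \<psi> x))"

text \<open>Intended for \<open>f \<in> Lp_loc \<theta> p\<close>.\<close>

definition weyl_almost_periodic ::
  "'a::{topological_ab_group_add, t2_space} measure \<Rightarrow> real \<Rightarrow> (nat \<Rightarrow> 'a set) \<Rightarrow>
   ('a \<Rightarrow> complex) \<Rightarrow> bool" where
  "weyl_almost_periodic \<theta> p A f \<longleftrightarrow>
     (\<exists>P :: nat \<Rightarrow> 'a \<Rightarrow> complex.
        (\<forall>m. trigonometric_polynomial (P m)) \<and>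
        (\<lambda>m. limsup (\<lambda>n. stepanov_norm \<theta> p (A n) (\<lambda>x. f x - P m x))) \<longlonglongrightarrow> 0)"

definition translate :: "'a::ab_group_add \<Rightarrow> ('a \<Rightarrow> complex) \<Rightarrow> 'a \<Rightarrow> complex" where
  "translate t f = (\<lambda>x. f (x - t))"

definition relatively_dense :: "'a::topological_ab_group_add set \<Rightarrow> bool" where
  "relatively_dense R \<longleftrightarrow> (\<exists>K. compact K \<and> {r + k | r k. r \<in> R \<and> k \<in> K} = UNIV)"

end

theory Submission
  imports Defs
begin

text \<open>
  If \<open>P\<close> is a trigonometric polynomial close to \<open>f\<close>, then the almost periods of \<open>P\<close> are almost
  periods of \<open>f\<close>.

  For the converse, the hypothesis makes \<open>D t = limsup \<parallel>f - T\<^sub>t f\<parallel>\<close> a continuous and totally bounded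
  pseudonorm on the group, so that averaging along the van Hove sequence gives a
  translation-invariant mean \<open>M\<close> on the \<open>D\<close>-uniformly continuous functions.  Every such function
  that is nonzero has a nonzero Fourier coefficient at some \<open>D\<close>-uniformly continuous character;
  hence the autocorrelation \<open>\<kappa>\<close> of a bump function at \<open>0\<close> is a uniform limit of trigonometric polynomials
  \<open>w\<close>.  After normalisation, \<open>f\<close> is close to the mean of \<open>\<kappa> s * T\<^sub>s f\<close> over \<open>s\<close>, thus to that of
  \<open>w s * T\<^sub>s f\<close>.  For a character \<open>\<xi>\<close>, the mean of \<open>\<xi> s * T\<^sub>s f\<close>, divided by \<open>\<xi>\<close>, is nearly invariant
  under all translations and therefore nearly constant.  Means of \<open>L\<^sup>p\<close>-valued functions are
  replaced by finite sums over a partition of unity.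
\<close>

section \<open>Almost periodic functions and invariant means\<close>

text \<open>Two obstacles shape the argument. The Stepanov norm takes a supremum over the whole
  group, and the limsup runs through all scales \<open>A n\<close>. An almost period moves any
  translate of a set into a fixed compact region (\<open>local_bound\<close>), and a bound at one
  scale passes to all sufficiently late scales at the price of a factor 2
  (\<open>stepanov_le_domination\<close>); so estimates are made on one compact set at one scale,
  where local integrability suffices. Moreover, \<open>\<theta>\<close> need not be \<sigma>-finite
  and \<open>f\<close> is only locally in L^p, so neither product integrals nor a mean of
  \<open>s \<mapsto> f (x - s)\<close> at fixed \<open>x\<close> is at hand. Hence the mean acts on
  scalar \<open>D\<close>-uniformly continuous functions only, and Fubini rests on kernels that are
  finite sums of products. The compact group obtained by completion for \<open>D\<close> stays
  implicit; its characters come from an extremal problem instead of the Peter-Weyl theorem. An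
  autocorrelation replaces the bump function itself because its Fourier coefficients are squares,
  summable by Bessel's inequality, so that its Fourier series converges uniformly.\<close>

lemma pointwise_cluster_point:
  fixes X :: "nat \<Rightarrow> 'i \<Rightarrow> complex"
  assumes B: "\<And>n i. norm (X n i) \<le> B i"
  obtains L where
    "\<And>F e N. finite F \<Longrightarrow> e > 0 \<Longrightarrow> \<exists>n\<ge>N. \<forall>i\<in>F. norm (X n i - L i) < e"
proof -
  \<comment> \<open>Tychonoff: a product of closed discs is compact. The index set may be
    uncountable, so a convergent subsequence need not exist; a cluster point only gives agreement on
    finitely many coordinates at a time, for arbitrarily large \<open>n\<close>, and every later use
    involves just finitely many values.\<close>
  define S where "S = (\<Pi>\<^sub>E i\<in>UNIV. cball (0::complex) (B i))"
  have "compactin (product_topology (\<lambda>i. euclidean) UNIV) S"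
    unfolding S_def by (subst compactin_PiE) auto
  then have cS: "compact S"
    by (simp add: euclidean_product_topology)
  have "\<forall>\<^sub>F n in sequentially. X n \<in> S"
    using B by (auto simp: S_def PiE_UNIV_domain intro!: always_eventually)
  then have ev: "\<forall>\<^sub>F x in filtermap X sequentially. x \<in> S"
    by (simp add: eventually_filtermap)
  have "filtermap X sequentially \<noteq> bot"
    by (simp add: filtermap_bot_iff)
  with cS ev obtain L where L: "inf (nhds L) (filtermap X sequentially) \<noteq> bot"
    unfolding compact_filter by blast
  show ?thesis
  proof (rule that[of L])
    fix F :: "'i set" and e :: real and N :: nat
    assume F: "finite F" "e > 0"
    define W where "W = {g. \<forall>i\<in>F. norm (g i - L i) < e}"
    have "W = (\<Inter>i\<in>F. (\<lambda>g. g i) -` ball (L i) e)"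
      by (auto simp: W_def dist_norm norm_minus_commute)
    moreover have "open ((\<lambda>g::'i \<Rightarrow> complex. g i) -` ball (L i) e)" for i
      by (intro open_vimage open_ball continuous_on_product_coordinates)
    ultimately have "open W"
      using F by auto
    moreover have "L \<in> W" using F by (auto simp: W_def)
    ultimately have evW: "eventually (\<lambda>g. g \<in> W) (nhds L)"
      by (rule eventually_nhds_in_open)
    show "\<exists>n\<ge>N. \<forall>i\<in>F. norm (X n i - L i) < e"
    proof (rule ccontr)
      assume "\<not> ?thesis"
      then have "\<forall>\<^sub>F g in filtermap X sequentially. g \<notin> W"
        unfolding eventually_filtermap eventually_sequentially
        by (auto simp: W_def intro!: exI[of _ N])
      with evW have "eventually (\<lambda>g. False) (inf (nhds L) (filtermap X sequentially))"
        unfolding eventually_inf by (intro exI[of _ "\<lambda>g. g \<in> W"] exI[of _ "\<lambda>g. g \<notin> W"]) auto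
      then show False using L by (simp add: eventually_False)
    qed
  qed
qed

section \<open>Group pseudonorms and functions uniformly continuous for them\<close>

locale pseudonorm =
  fixes D :: "'a::ab_group_add \<Rightarrow> real"
  assumes D_0 [simp]: "D 0 = 0"
    and D_minus [simp]: "D (- t) = D t"
    and D_add: "D (s + t) \<le> D s + D t"
begin

lemma D_nonneg [simp]: "0 \<le> D t"
  using D_add[of t "- t"] by simp

lemma D_commute: "D (x - y) = D (y - x)"
  using D_minus[of "x - y"] by simp

lemma D_diff: "\<bar>D x - D y\<bar> \<le> D (x - y)"
  using D_add[of "x - y" y] D_add[of "y - x" x] D_commute[of x y] by auto

text \<open>In the totally bounded case these are the functions that extend continuously to the
  compact group obtained by dividing out the kernel of \<open>D\<close> and completing. That group
  is never formed; \<open>uc\<close> stands for continuity on it.\<close>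

definition uc :: "('a \<Rightarrow> complex) \<Rightarrow> bool" where
  "uc f \<longleftrightarrow> (\<forall>e>0. \<exists>d>0. \<forall>x y. D (x - y) < d \<longrightarrow> norm (f x - f y) < e)"

lemma ucE:
  assumes "uc f" "e > 0"
  obtains d where "d > 0" "\<And>x y. D (x - y) < d \<Longrightarrow> norm (f x - f y) < e"
  using assms unfolding uc_def by blast

text \<open>Since \<open>D ((x + s) - (y + s)) = D (x - y)\<close>, one radius serves all translates
  of \<open>f\<close>. Hence \<open>conv \<psi> a\<close>, and pointwise limits of such functions,
  inherit a modulus of continuity from \<open>\<psi>\<close> alone.\<close>

lemma uc_dominated:
  assumes "uc f" and "\<And>x y e. (\<And>s. norm (f (x + s) - f (y + s)) \<le> e) \<Longrightarrow> norm (g x - g y) \<le> C * e"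
    and "C \<ge> 0"
  shows "uc g"
  unfolding uc_def
proof (intro allI impI)
  fix e :: real assume "e > 0"
  then have "e / (C + 1) > 0" using assms by auto
  from ucE[OF assms(1) this] obtain d where d: "d > 0"
    "\<And>x y. D (x - y) < d \<Longrightarrow> norm (f x - f y) < e / (C + 1)" by blast
  have "norm (g x - g y) < e" if "D (x - y) < d" for x y
  proof -
    have "norm (g x - g y) \<le> C * (e / (C + 1))"
      by (rule assms(2)) (use d(2) that in \<open>auto intro!: less_imp_le\<close>)
    also have "\<dots> < e" using \<open>e > 0\<close> assms(3) by (simp add: field_simps)
    finally show ?thesis .
  qed
  with d(1) show "\<exists>d>0. \<forall>x y. D (x - y) < d \<longrightarrow> norm (g x - g y) < e" by blast
qed

lemma uc_const [simp, intro]: "uc (\<lambda>x. c)"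
  by (auto simp: uc_def intro: exI[of _ 1])

lemma uc_lipschitz:
  assumes "uc f" "\<And>x y. norm (g x - g y) \<le> norm (f x - f y)"
  shows "uc g"
  using assms unfolding uc_def by (meson le_less_trans)

lemma uc_cnj [intro]: "uc f \<Longrightarrow> uc (\<lambda>x. cnj (f x))"
  by (erule uc_lipschitz) (metis complex_cnj_diff complex_mod_cnj order_refl)

lemma uc_norm [intro]: "uc f \<Longrightarrow> uc (\<lambda>x. of_real (norm (f x)))"
  by (erule uc_lipschitz) (metis norm_of_real of_real_diff norm_triangle_ineq3)

lemma uc_add [intro]:
  assumes "uc f" "uc g" shows "uc (\<lambda>x. f x + g x)"
  unfolding uc_def
proof (intro allI impI)
  fix e :: real assume "e > 0"
  then have e: "e / 2 > 0" by simp
  from ucE[OF assms(1) e] obtain d1 where d1: "d1 > 0"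
    "\<And>x y. D (x - y) < d1 \<Longrightarrow> norm (f x - f y) < e / 2" by blast
  from ucE[OF assms(2) e] obtain d2 where d2: "d2 > 0"
    "\<And>x y. D (x - y) < d2 \<Longrightarrow> norm (g x - g y) < e / 2" by blast
  have "norm (f x + g x - (f y + g y)) < e" if "D (x - y) < min d1 d2" for x y
    using norm_triangle_ineq[of "f x - f y" "g x - g y"] d1(2)[of x y] d2(2)[of x y] that
    by (simp add: algebra_simps)
  then show "\<exists>d>0. \<forall>x y. D (x - y) < d \<longrightarrow> norm (f x + g x - (f y + g y)) < e"
    using d1 d2 by (intro exI[of _ "min d1 d2"]) auto
qed

lemma uc_shift: "uc f \<Longrightarrow> uc (\<lambda>x. f (x + t))"
  unfolding uc_def by (metis add_diff_cancel_right)

lemma uc_shift_minus: "uc f \<Longrightarrow> uc (\<lambda>x. f (x - t))"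
  using uc_shift[of f "-t"] by simp

lemma uc_shift': "uc f \<Longrightarrow> uc (\<lambda>x. f (t + x))"
  using uc_shift[of f t] by (simp add: add.commute)

lemma uc_D: "uc (\<lambda>x. of_real (D x))"
  unfolding uc_def by (metis D_diff le_less_trans norm_of_real of_real_diff)

end

locale totally_bounded_pseudonorm = pseudonorm +
  assumes totally_bounded: "e > 0 \<Longrightarrow> \<exists>F. finite F \<and> (\<forall>t. \<exists>s\<in>F. D (t - s) < e)"
begin

lemma uc_bounded:
  assumes "uc f" obtains B where "B > 0" "\<And>x. norm (f x) \<le> B"
proof -
  from ucE[OF assms, of 1] obtain d where d: "d > 0"
    "\<And>x y. D (x - y) < d \<Longrightarrow> norm (f x - f y) < 1" by auto
  from totally_bounded[OF d(1)] obtain F where F: "finite F" "\<And>t. \<exists>s\<in>F. D (t - s) < d" by blast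
  have "norm (f x) \<le> 1 + (\<Sum>s\<in>F. norm (f s))" for x
  proof -
    obtain s where s: "s \<in> F" "D (x - s) < d" using F by blast
    have "norm (f x) \<le> norm (f x - f s) + norm (f s)"
      by (metis norm_triangle_sub add.commute)
    also have "\<dots> \<le> 1 + norm (f s)" using d(2)[OF s(2)] by simp
    also have "norm (f s) \<le> (\<Sum>s\<in>F. norm (f s))"
      using s F by (intro member_le_sum) auto
    finally show ?thesis by simp
  qed
  then show ?thesis
    by (intro that[of "1 + (\<Sum>s\<in>F. norm (f s))"]) (auto intro!: add_pos_nonneg sum_nonneg)
qed

lemma uc_mult [intro]:
  assumes "uc f" "uc g" shows "uc (\<lambda>x. f x * g x)"
proof -
  obtain A where A: "A > 0" "\<And>x. norm (f x) \<le> A" using uc_bounded[OF assms(1)] by blast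
  obtain B where B: "B > 0" "\<And>x. norm (g x) \<le> B" using uc_bounded[OF assms(2)] by blast
  show ?thesis unfolding uc_def
  proof (intro allI impI)
    fix e :: real assume "e > 0"
    then have e: "e / (A + B) > 0" using A B by simp
    from ucE[OF assms(1) e] obtain d1 where d1: "d1 > 0"
      "\<And>x y. D (x - y) < d1 \<Longrightarrow> norm (f x - f y) < e / (A + B)" by blast
    from ucE[OF assms(2) e] obtain d2 where d2: "d2 > 0"
      "\<And>x y. D (x - y) < d2 \<Longrightarrow> norm (g x - g y) < e / (A + B)" by blast
    have "norm (f x * g x - f y * g y) < e" if "D (x - y) < min d1 d2" for x y
    proof -
      have "norm (f x * g x - f y * g y) = norm (f x * (g x - g y) + (f x - f y) * g y)"
        by (simp add: algebra_simps)
      also have "\<dots> \<le> norm (f x) * norm (g x - g y) + norm (f x - f y) * norm (g y)"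
        by (rule norm_triangle_le) (simp add: norm_mult)
      also have "\<dots> \<le> A * norm (g x - g y) + norm (f x - f y) * B"
        by (intro add_mono mult_right_mono mult_left_mono A B) auto
      also have "\<dots> < A * (e / (A + B)) + (e / (A + B)) * B"
        using d1 d2 that A B by (intro add_strict_mono mult_strict_left_mono mult_strict_right_mono) auto
      also have "\<dots> = (A + B) * (e / (A + B))" by (simp only: distrib_right mult.commute)
      also have "\<dots> = e" using A B by simp
      finally show ?thesis .
    qed
    then show "\<exists>d>0. \<forall>x y. D (x - y) < d \<longrightarrow> norm (f x * g x - f y * g y) < e"
      using d1 d2 by (intro exI[of _ "min d1 d2"]) auto
  qed
qed

lemma uc_minus [intro]: "uc f \<Longrightarrow> uc (\<lambda>x. - f x)"
  using uc_mult[of "\<lambda>x. -1" f] by simp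

lemma uc_diff [intro]: "uc f \<Longrightarrow> uc g \<Longrightarrow> uc (\<lambda>x. f x - g x)"
  using uc_add[of f "\<lambda>x. - g x"] by auto

lemma uc_sum [intro]: "(\<And>i. i \<in> I \<Longrightarrow> uc (f i)) \<Longrightarrow> uc (\<lambda>x. \<Sum>i\<in>I. f i x)"
  by (induction I rule: infinite_finite_induct) auto

lemma uc_limit:
  assumes "\<And>e. e > 0 \<Longrightarrow> \<exists>g. uc g \<and> (\<forall>x. norm (f x - g x) \<le> e)"
  shows "uc f"
  unfolding uc_def
proof (intro allI impI)
  fix e :: real assume "e > 0"
  then obtain g where g: "uc g" "\<And>x. norm (f x - g x) \<le> e / 3"
    using assms[of "e/3"] by auto
  from ucE[OF g(1), of "e/3"] \<open>e > 0\<close> obtain d where d: "d > 0"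
    "\<And>x y. D (x - y) < d \<Longrightarrow> norm (g x - g y) < e / 3" by auto
  have "norm (f x - f y) < e" if "D (x - y) < d" for x y
  proof -
    have "norm (f x - f y) \<le> norm (f x - g x) + norm (g x - g y) + norm (f y - g y)"
      using norm_triangle_ineq4[of "(f x - g x) + (g x - g y)" "f y - g y"]
        norm_triangle_ineq[of "f x - g x" "g x - g y"] by simp
    then show ?thesis using g(2)[of x] g(2)[of y] d(2)[OF that] by linarith
  qed
  with d(1) show "\<exists>d>0. \<forall>x y. D (x - y) < d \<longrightarrow> norm (f x - f y) < e" by blast
qed

lemma uc_inverse:
  assumes "uc f" "b > 0" "\<And>x. norm (f x) \<ge> b"
  shows "uc (\<lambda>x. inverse (f x))"
  unfolding uc_def
proof (intro allI impI)
  fix e :: real assume "e > 0"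
  then have "e * b * b > 0" using assms by auto
  from ucE[OF assms(1) this] obtain d where d: "d > 0"
    "\<And>x y. D (x - y) < d \<Longrightarrow> norm (f x - f y) < e * b * b" by blast
  have "norm (inverse (f x) - inverse (f y)) < e" if "D (x - y) < d" for x y
  proof -
    have nz: "f x \<noteq> 0" "f y \<noteq> 0" using assms(3)[of x] assms(3)[of y] assms(2) by auto
    then have "inverse (f x) - inverse (f y) = (f y - f x) / (f x * f y)"
      by (simp add: field_simps)
    then have "norm (inverse (f x) - inverse (f y)) = norm (f x - f y) / (norm (f x) * norm (f y))"
      by (simp add: norm_divide norm_mult norm_minus_commute)
    also have "\<dots> \<le> norm (f x - f y) / (b * b)"
      using assms by (intro divide_left_mono mult_mono mult_pos_pos) (auto simp: nz intro: order.trans[OF less_imp_le])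
    also have "\<dots> < e" using d(2)[OF that] assms(2) by (simp add: field_simps)
    finally show ?thesis .
  qed
  with d(1) show "\<exists>d>0. \<forall>x y. D (x - y) < d \<longrightarrow> norm (inverse (f x) - inverse (f y)) < e"
    by blast
qed

definition bump :: "real \<Rightarrow> 'a \<Rightarrow> real" where
  "bump e x = max 0 (e - D x)"

lemma uc_bump: "uc (\<lambda>x. of_real (bump e x))"
  by (rule uc_lipschitz[OF uc_D]) (auto simp: bump_def simp flip: of_real_diff)

lemma uc_partition_of_unity:
  assumes "e > 0"
  obtains F \<phi> where "finite F" "\<And>s. uc (\<lambda>x. of_real (\<phi> s x :: real))"
    "\<And>s x. 0 \<le> \<phi> s x" "\<And>x. (\<Sum>s\<in>F. \<phi> s x) = 1" "\<And>s x. \<phi> s x \<noteq> 0 \<Longrightarrow> D (x - s) < e"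
proof -
  \<comment> \<open>Bumps of radius \<open>e\<close> around a net of mesh \<open>e / 2\<close> have
    a sum of at least \<open>e / 2\<close> everywhere, which makes the reciprocal of the sum
    uniformly continuous.\<close>
  from totally_bounded[of "e/2"] assms obtain F
    where F: "finite F" "\<And>t. \<exists>s\<in>F. D (t - s) < e / 2" by auto
  define N where "N = (\<lambda>x. \<Sum>s\<in>F. bump e (x - s))"
  have N: "N x \<ge> e / 2" for x
  proof -
    obtain s where s: "s \<in> F" "D (x - s) < e / 2" using F by blast
    have "e / 2 \<le> bump e (x - s)" using s by (auto simp: bump_def le_max_iff_disj)
    also have "\<dots> \<le> N x" unfolding N_def
      using s F by (intro member_le_sum) (auto simp: bump_def)
    finally show ?thesis .
  qed
  have Npos: "N x > 0" for x using N[of x] assms by linarith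
  have ucN: "uc (\<lambda>x. of_real (N x))"
    unfolding N_def of_real_sum by (intro uc_sum uc_shift_minus[OF uc_bump])
  have ucI: "uc (\<lambda>x. inverse (of_real (N x)))"
    by (rule uc_inverse[OF ucN, of "e/2"]) (use assms N Npos in \<open>auto simp: less_imp_le\<close>)
  show ?thesis
  proof (rule that[of F "\<lambda>s x. bump e (x - s) * inverse (N x)"])
    show "uc (\<lambda>x. of_real (bump e (x - s) * inverse (N x)))" for s
      using uc_mult[OF uc_shift_minus[OF uc_bump, of e s] ucI] by simp
    show "(\<Sum>s\<in>F. bump e (x - s) * inverse (N x)) = 1" for x
      using Npos[of x] by (simp add: N_def flip: sum_distrib_right)
    show "0 \<le> bump e (x - s) * inverse (N x)" for s x
      using Npos[of x] by (auto simp: bump_def)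
    show "D (x - s) < e" if "bump e (x - s) * inverse (N x) \<noteq> 0" for s x
      using that by (auto simp: bump_def max_def split: if_splits)
  qed (use F in auto)
qed

end

section \<open>Invariant means, their Hilbert space norm and convolutions\<close>

locale invariant_mean = totally_bounded_pseudonorm +
  fixes M :: "('a \<Rightarrow> complex) \<Rightarrow> complex"
  assumes M_add: "uc f \<Longrightarrow> uc g \<Longrightarrow> M (\<lambda>x. f x + g x) = M f + M g"
    and M_cmult: "uc f \<Longrightarrow> M (\<lambda>x. c * f x) = c * M f"
    and M_one [simp]: "M (\<lambda>x. 1) = 1"
    and M_cnj: "uc f \<Longrightarrow> M (\<lambda>x. cnj (f x)) = cnj (M f)"
    and M_pos: "uc (\<lambda>x. of_real (h x)) \<Longrightarrow> (\<And>x. 0 \<le> h x) \<Longrightarrow> 0 \<le> Re (M (\<lambda>x. of_real (h x)))"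
    and M_norm_le: "uc f \<Longrightarrow> norm (M f) \<le> Re (M (\<lambda>x. of_real (norm (f x))))"
    and M_shift: "uc f \<Longrightarrow> M (\<lambda>x. f (x + t)) = M f"
begin

lemma M_const [simp]: "M (\<lambda>x. c) = c"
  using M_cmult[of "\<lambda>x. 1" c] by simp

lemma M_multc: "uc f \<Longrightarrow> M (\<lambda>x. f x * c) = M f * c"
  using M_cmult[of f c] by (simp add: mult.commute)

lemma M_minus: "uc f \<Longrightarrow> M (\<lambda>x. - f x) = - M f"
  using M_cmult[of f "-1"] by simp

lemma M_diff: "uc f \<Longrightarrow> uc g \<Longrightarrow> M (\<lambda>x. f x - g x) = M f - M g"
  using M_add[of f "\<lambda>x. - g x"] by (simp add: M_minus uc_minus)

lemma M_sum: "(\<And>i. i \<in> I \<Longrightarrow> uc (f i)) \<Longrightarrow> M (\<lambda>x. \<Sum>i\<in>I. f i x) = (\<Sum>i\<in>I. M (f i))"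
  by (induction I rule: infinite_finite_induct) (simp_all add: M_add uc_sum)

lemma M_mono:
  assumes "uc (\<lambda>x. of_real (g x))" "uc (\<lambda>x. of_real (h x))" "\<And>x. g x \<le> h x"
  shows "Re (M (\<lambda>x. of_real (g x))) \<le> Re (M (\<lambda>x. of_real (h x)))"
proof -
  have "uc (\<lambda>x. of_real (h x - g x))" using uc_diff[OF assms(2,1)] by simp
  from M_pos[OF this] assms M_diff[OF assms(2,1)] show ?thesis by simp
qed

lemma M_real: "uc (\<lambda>x. of_real (h x)) \<Longrightarrow> of_real (Re (M (\<lambda>x. of_real (h x)))) = M (\<lambda>x. of_real (h x))"
  using M_cnj[of "\<lambda>x. of_real (h x)"] by (simp add: complex_eq_iff)

lemma M_bound:
  assumes "uc f" "\<And>x. norm (f x) \<le> b"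
  shows "norm (M f) \<le> b"
proof -
  have "norm (M f) \<le> Re (M (\<lambda>x. of_real (norm (f x))))" by (rule M_norm_le[OF assms(1)])
  also have "\<dots> \<le> Re (M (\<lambda>x. of_real b))"
    by (rule M_mono) (use assms in auto)
  finally show ?thesis by simp
qed

lemma M_diff_bound:
  assumes "uc f" "uc g" "\<And>x. norm (f x - g x) \<le> b"
  shows "norm (M f - M g) \<le> b"
  using M_bound[of "\<lambda>x. f x - g x" b] assms M_diff[of f g] by auto

lemma M_shift': "uc f \<Longrightarrow> M (\<lambda>x. f (x - t)) = M f"
  using M_shift[of f "-t"] by simp

text \<open>The squared L^2 norm for the mean. \<open>M f\<close> makes sense for every
  \<open>f\<close> but obeys its laws only on \<open>uc\<close> functions, hence the
  \<open>uc\<close> premises below; by faithfulness of the mean, \<open>sq\<close> vanishes only at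
  zero (\<open>sq_eq_0\<close>).\<close>

definition sq :: "('a \<Rightarrow> complex) \<Rightarrow> real" where
  "sq f = Re (M (\<lambda>x. f x * cnj (f x)))"

lemma uc_sq [intro]: "uc f \<Longrightarrow> uc (\<lambda>x. of_real ((norm (f x))\<^sup>2))"
  using uc_mult[OF _ uc_cnj, of f f] by (simp add: complex_norm_square del: of_real_power)

lemma sq_alt: "sq f = Re (M (\<lambda>x. of_real ((norm (f x))\<^sup>2)))"
  by (simp add: sq_def complex_norm_square del: of_real_power)

lemma of_real_sq: "uc f \<Longrightarrow> of_real (sq f) = M (\<lambda>x. f x * cnj (f x))"
  using M_real[OF uc_sq, of f] by (simp add: sq_def complex_norm_square del: of_real_power)

lemma sq_nonneg: "uc f \<Longrightarrow> 0 \<le> sq f"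
  unfolding sq_alt by (rule M_pos[OF uc_sq]) auto

lemma sq_le: "uc f \<Longrightarrow> (\<And>x. norm (f x) \<le> b) \<Longrightarrow> sq f \<le> b\<^sup>2"
  unfolding sq_alt
  using M_mono[OF uc_sq uc_const, of f "b\<^sup>2"] by (simp add: power_mono del: of_real_power)

lemma sq_shift: "uc f \<Longrightarrow> sq (\<lambda>x. f (x + t)) = sq f"
  unfolding sq_alt using M_shift[OF uc_sq, of f t] by simp

text \<open>Faithfulness: finitely many translates of a neighbourhood on which \<open>f\<close> is large cover the group.\<close>

lemma positive_mean:
  assumes "uc (\<lambda>x. of_real (h x))" "\<And>x. 0 \<le> h x" "h z > 0"
  shows "Re (M (\<lambda>x. of_real (h x))) > 0"
proof -
  from ucE[OF assms(1), of "h z / 2"] assms(3) obtain d where d: "d > 0"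
    "\<And>x y. D (x - y) < d \<Longrightarrow> norm (of_real (h x) - of_real (h y) :: complex) < h z / 2" by auto
  from totally_bounded[OF d(1)] obtain F where F: "finite F" "\<And>t. \<exists>s\<in>F. D (t - s) < d" by blast
  have hz: "h x \<ge> h z / 2" if "D (x - z) < d" for x
    using d(2)[OF that] by (simp flip: of_real_diff add: abs_if split: if_splits)
  have ge: "h z / 2 \<le> (\<Sum>s\<in>F. h (x + (z - s)))" for x
  proof -
    obtain s where s: "s \<in> F" "D (x - s) < d" using F by blast
    have "h z / 2 \<le> h (x + (z - s))" by (rule hz) (use s in \<open>simp add: algebra_simps\<close>)
    also have "\<dots> \<le> (\<Sum>s\<in>F. h (x + (z - s)))"
      using s F assms by (intro member_le_sum) auto
    finally show ?thesis .
  qed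
  have us: "uc (\<lambda>x. of_real (\<Sum>s\<in>F. h (x + (z - s))))"
    unfolding of_real_sum by (intro uc_sum uc_shift[OF assms(1)])
  have "h z / 2 = Re (M (\<lambda>x. of_real (h z / 2)))" by simp
  also have "\<dots> \<le> Re (M (\<lambda>x. of_real (\<Sum>s\<in>F. h (x + (z - s)))))"
    by (rule M_mono[OF _ us ge]) auto
  also have "M (\<lambda>x. of_real (\<Sum>s\<in>F. h (x + (z - s)))) = of_nat (card F) * M (\<lambda>x. of_real (h x))"
    unfolding of_real_sum
    by (subst M_sum) (auto simp: M_shift[OF assms(1)] intro: uc_shift[OF assms(1)])
  finally have "0 < real (card F) * Re (M (\<lambda>x. of_real (h x)))" using assms(3) by simp
  then show ?thesis by (simp add: zero_less_mult_iff)
qed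

lemma sq_eq_0:
  assumes "uc f" "sq f \<le> 0" shows "f x = 0"
  using positive_mean[OF uc_sq[OF assms(1)], of x] assms(2) unfolding sq_alt by fastforce

text \<open>Formally the convolution of \<open>\<psi>\<close> with
  \<open>s \<mapsto> a (- s)\<close>. The plus sign makes the kernel \<open>\<psi> (x + s)\<close>
  symmetric in \<open>x\<close> and \<open>s\<close>, so the operator \<open>conv \<psi>\<close> is
  symmetric for the bilinear form given by the mean of a product; this is
  \<open>mean_fubini\<close>.\<close>

definition conv :: "('a \<Rightarrow> complex) \<Rightarrow> ('a \<Rightarrow> complex) \<Rightarrow> 'a \<Rightarrow> complex" where
  "conv \<psi> a x = M (\<lambda>s. \<psi> (x + s) * a s)"

lemma conv_diff_bound:
  assumes "uc \<psi>" "uc a" "\<And>s. norm (a s) \<le> A" "\<And>s. norm (\<psi> (x + s) - \<psi> (y + s)) \<le> e"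
  shows "norm (conv \<psi> a x - conv \<psi> a y) \<le> A * e"
  unfolding conv_def
proof (rule M_diff_bound)
  have "A \<ge> 0" using assms(3) norm_ge_zero order_trans by blast
  fix s show "norm (\<psi> (x + s) * a s - \<psi> (y + s) * a s) \<le> A * e"
    using mult_mono[OF assms(4)[of s] assms(3)[of s]] \<open>A \<ge> 0\<close>
    by (simp flip: left_diff_distrib add: norm_mult mult.commute[of A]
        order_trans[OF norm_ge_zero assms(4)])
qed (rule uc_mult assms uc_shift'[OF assms(1)])+

lemma conv_bound:
  assumes "uc \<psi>" "uc a" "\<And>s. norm (a s) \<le> A" "\<And>s. norm (\<psi> s) \<le> B"
  shows "norm (conv \<psi> a x) \<le> B * A"
  unfolding conv_def
proof (rule M_bound)
  show "norm (\<psi> (x + s) * a s) \<le> B * A" for s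
    unfolding norm_mult by (intro mult_mono assms norm_ge_zero order_trans[OF norm_ge_zero assms(4)])
qed (rule uc_mult assms uc_shift'[OF assms(1)])+

lemma uc_conv [intro]:
  assumes "uc \<psi>" "uc a" shows "uc (conv \<psi> a)"
proof -
  obtain A where A: "A > 0" "\<And>s. norm (a s) \<le> A" using uc_bounded[OF assms(2)] by blast
  show ?thesis
    by (rule uc_dominated[OF assms(1), of _ A]) (use conv_diff_bound[OF assms A(2)] A in auto)
qed

lemma norm_triangle_diff_halves:
  fixes u v w :: complex
  assumes "norm (u - w) \<le> e / 2" "norm (v - w) \<le> e / 2"
  shows "norm (u - v) \<le> e"
  using norm_triangle_ineq4[of "u - w" "v - w"] assms by simp

text \<open>Fubini for the mean: the kernel \<open>\<psi> (x + s)\<close> is a uniform limit of kernels of finite rank.\<close>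

lemma mean_fubini:
  assumes "uc \<psi>" "uc a" "uc b"
  shows "M (\<lambda>x. b x * conv \<psi> a x) = M (\<lambda>x. a x * conv \<psi> b x)"
proof -
  obtain A where A: "A > 0" "\<And>s. norm (a s) \<le> A" using uc_bounded[OF assms(2)] by blast
  obtain B where B: "B > 0" "\<And>s. norm (b s) \<le> B" using uc_bounded[OF assms(3)] by blast
  have "norm (M (\<lambda>x. b x * conv \<psi> a x) - M (\<lambda>x. a x * conv \<psi> b x)) \<le> e" if "e > 0" for e
  proof -
    \<comment> \<open>Each of the two replacements of the kernel by \<open>K\<close> costs
      \<open>A * B * e' = e / 2\<close>.\<close>
    define e' where "e' = e / (2 * A * B)"
    have e': "e' > 0" using that A B by (simp add: e'_def)
    from ucE[OF assms(1) e'] obtain d where d: "d > 0"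
      "\<And>x y. D (x - y) < d \<Longrightarrow> norm (\<psi> x - \<psi> y) < e'" by blast
    from uc_partition_of_unity[OF d(1)] obtain F \<phi> where P: "finite F" "\<And>s. uc (\<lambda>x. of_real (\<phi> s x :: real))"
      "\<And>s x. 0 \<le> \<phi> s x" "\<And>x. (\<Sum>s\<in>F. \<phi> s x) = 1" "\<And>s x. \<phi> s x \<noteq> 0 \<Longrightarrow> D (x - s) < d" by metis
    \<comment> \<open>Interpolation in the second variable at the nodes \<open>j\<close>: where
      \<open>\<phi> j s\<close> is nonzero, \<open>D (s - j) < d\<close>, and this is also the
      distance from \<open>x + s\<close> to \<open>x + j\<close>. As \<open>K\<close> is a finite
      sum of products, the two means can be exchanged by linearity alone.\<close>
    define K where "K = (\<lambda>x s. \<Sum>j\<in>F. of_real (\<phi> j s) * \<psi> (x + j))"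
    have K: "norm (\<psi> (x + s) - K x s) \<le> e'" for x s
    proof -
      have "\<psi> (x + s) - K x s = (\<Sum>j\<in>F. of_real (\<phi> j s) * (\<psi> (x + s) - \<psi> (x + j)))"
        unfolding K_def right_diff_distrib sum_subtractf
        by (simp flip: sum_distrib_right of_real_sum add: P(4))
      also have "norm \<dots> \<le> (\<Sum>j\<in>F. \<phi> j s * e')"
      proof (rule sum_norm_le)
        fix j assume "j \<in> F"
        show "norm (of_real (\<phi> j s) * (\<psi> (x + s) - \<psi> (x + j))) \<le> \<phi> j s * e'"
        proof (cases "\<phi> j s = 0")
          case False
          from d(2)[of "x + s" "x + j"] P(5)[OF False] show ?thesis
            by (auto simp: norm_mult P(3) intro!: mult_left_mono)
        qed simp
      qed
      also have "\<dots> = e'" by (simp flip: sum_distrib_right add: P(4))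
      finally show ?thesis .
    qed
    have uK1: "uc (K x)" for x unfolding K_def by (intro uc_sum uc_mult P uc_const)
    have uK2: "uc (\<lambda>x. K x s)" for s unfolding K_def by (intro uc_sum uc_mult uc_const assms uc_shift)
    define I where "I = (\<Sum>j\<in>F. M (\<lambda>x. b x * \<psi> (x + j)) * M (\<lambda>s. of_real (\<phi> j s) * a s))"
    have "M (\<lambda>s. K x s * a s) = (\<Sum>j\<in>F. \<psi> (x + j) * M (\<lambda>s. of_real (\<phi> j s) * a s))" for x
    proof -
      have "M (\<lambda>s. K x s * a s) = M (\<lambda>s. \<Sum>j\<in>F. \<psi> (x + j) * (of_real (\<phi> j s) * a s))"
        by (simp add: K_def sum_distrib_left mult_ac)
      also have "\<dots> = (\<Sum>j\<in>F. M (\<lambda>s. \<psi> (x + j) * (of_real (\<phi> j s) * a s)))"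
        by (rule M_sum) (intro uc_mult P assms uc_const)
      also have "\<dots> = (\<Sum>j\<in>F. \<psi> (x + j) * M (\<lambda>s. of_real (\<phi> j s) * a s))"
        by (intro sum.cong refl M_cmult uc_mult P assms)
      finally show ?thesis .
    qed
    then have MK1: "M (\<lambda>s. K x s * a s) = (\<Sum>j\<in>F. \<psi> (x + j) * M (\<lambda>s. of_real (\<phi> j s) * a s))" for x .
    have uMK1: "uc (\<lambda>x. M (\<lambda>s. K x s * a s))"
      unfolding MK1 by (intro uc_sum uc_mult uc_const assms uc_shift)
    have I1: "M (\<lambda>x. b x * M (\<lambda>s. K x s * a s)) = I"
    proof -
      have "M (\<lambda>x. b x * M (\<lambda>s. K x s * a s))
          = M (\<lambda>x. \<Sum>j\<in>F. (b x * \<psi> (x + j)) * M (\<lambda>s. of_real (\<phi> j s) * a s))"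
        unfolding MK1 by (simp add: sum_distrib_left mult_ac)
      also have "\<dots> = (\<Sum>j\<in>F. M (\<lambda>x. (b x * \<psi> (x + j)) * M (\<lambda>s. of_real (\<phi> j s) * a s)))"
        by (rule M_sum) (intro uc_mult uc_const assms uc_shift)
      also have "\<dots> = I" unfolding I_def
        by (intro sum.cong refl M_multc uc_mult uc_shift assms)
      finally show ?thesis .
    qed
    have MK2: "M (\<lambda>x. K x s * b x) = (\<Sum>j\<in>F. of_real (\<phi> j s) * M (\<lambda>x. b x * \<psi> (x + j)))" for s
    proof -
      have "M (\<lambda>x. K x s * b x) = M (\<lambda>x. \<Sum>j\<in>F. of_real (\<phi> j s) * (b x * \<psi> (x + j)))"
        by (simp add: K_def sum_distrib_left mult_ac)
      also have "\<dots> = (\<Sum>j\<in>F. M (\<lambda>x. of_real (\<phi> j s) * (b x * \<psi> (x + j))))"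
        by (rule M_sum) (intro uc_mult uc_const assms uc_shift)
      also have "\<dots> = (\<Sum>j\<in>F. of_real (\<phi> j s) * M (\<lambda>x. b x * \<psi> (x + j)))"
        by (intro sum.cong refl M_cmult uc_mult uc_shift assms)
      finally show ?thesis .
    qed
    have uMK2: "uc (\<lambda>s. M (\<lambda>x. K x s * b x))"
      unfolding MK2 by (intro uc_sum uc_mult uc_const P)
    have I2: "M (\<lambda>s. a s * M (\<lambda>x. K x s * b x)) = I"
    proof -
      have "M (\<lambda>s. a s * M (\<lambda>x. K x s * b x))
          = M (\<lambda>s. \<Sum>j\<in>F. M (\<lambda>x. b x * \<psi> (x + j)) * (of_real (\<phi> j s) * a s))"
        unfolding MK2 by (simp add: sum_distrib_left mult_ac)
      also have "\<dots> = (\<Sum>j\<in>F. M (\<lambda>s. M (\<lambda>x. b x * \<psi> (x + j)) * (of_real (\<phi> j s) * a s)))"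
        by (rule M_sum) (intro uc_mult P assms uc_const)
      also have "\<dots> = I" unfolding I_def
        by (intro sum.cong refl M_cmult uc_mult P assms)
      finally show ?thesis .
    qed
    have b1: "norm (conv \<psi> a x - M (\<lambda>s. K x s * a s)) \<le> e' * A" for x
      unfolding conv_def
    proof (rule M_diff_bound)
      show "norm (\<psi> (x + s) * a s - K x s * a s) \<le> e' * A" for s
        using mult_mono[OF K[of x s] A(2)[of s]] e' by (simp flip: left_diff_distrib add: norm_mult)
    qed (rule uc_mult assms uK1 uc_shift'[OF assms(1)])+
    have b2: "norm (conv \<psi> b s - M (\<lambda>x. K x s * b x)) \<le> e' * B" for s
      unfolding conv_def
    proof (rule M_diff_bound)
      show "norm (\<psi> (s + x) * b x - K x s * b x) \<le> e' * B" for x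
        using mult_mono[OF K[of x s] B(2)[of x]] e'
        by (simp flip: left_diff_distrib add: norm_mult add.commute)
    qed (rule uc_mult assms uK2 uc_shift'[OF assms(1)])+
    have "norm (M (\<lambda>x. b x * conv \<psi> a x) - I) \<le> B * (e' * A)"
      unfolding I1[symmetric]
    proof (rule M_diff_bound)
      show "norm (b x * conv \<psi> a x - b x * M (\<lambda>s. K x s * a s)) \<le> B * (e' * A)" for x
        using mult_mono[OF B(2)[of x] b1[of x]] B by (simp flip: right_diff_distrib add: norm_mult)
    qed (rule uc_mult uc_conv assms uMK1)+
    moreover have "norm (M (\<lambda>s. a s * conv \<psi> b s) - I) \<le> A * (e' * B)"
      unfolding I2[symmetric]
    proof (rule M_diff_bound)
      show "norm (a x * conv \<psi> b x - a x * M (\<lambda>s. K s x * b s)) \<le> A * (e' * B)" for x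
        using mult_mono[OF A(2)[of x] b2[of x]] A by (simp flip: right_diff_distrib add: norm_mult)
    qed (rule uc_mult uc_conv assms uMK2)+
    moreover have "B * (e' * A) = e / 2" "A * (e' * B) = e / 2"
      using A B by (auto simp: e'_def field_simps)
    ultimately have "norm (M (\<lambda>x. b x * conv \<psi> a x) - I) \<le> e / 2"
      "norm (M (\<lambda>s. a s * conv \<psi> b s) - I) \<le> e / 2" by metis+
    then show ?thesis
      by (rule norm_triangle_diff_halves)
  qed
  then have "norm (M (\<lambda>x. b x * conv \<psi> a x) - M (\<lambda>x. a x * conv \<psi> b x)) \<le> 0"
    by (rule dense_ge)
  then show ?thesis by simp
qed

end

lemma le_of_le_add_mult_eps:
  fixes a b C :: real
  assumes "\<And>e. e > 0 \<Longrightarrow> a \<le> b + C * e"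
  shows "a \<le> b"
proof (rule field_le_epsilon)
  fix e :: real assume "e > 0"
  have "C * (e / (\<bar>C\<bar> + 1)) \<le> \<bar>C\<bar> * (e / (\<bar>C\<bar> + 1))"
    using \<open>e > 0\<close> by (intro mult_right_mono) auto
  also have "\<dots> \<le> e" using \<open>e > 0\<close> by (simp add: field_simps)
  finally show "a \<le> b + e" using assms[of "e / (\<bar>C\<bar> + 1)"] \<open>e > 0\<close> by simp
qed

lemma norm_diff_add_le: "norm (a - b + c) \<le> norm a + norm b + norm (c :: complex)"
  using norm_triangle_ineq[of "a - b" c] norm_triangle_ineq4[of a b] by linarith

lemma norm_add_diff_le: "norm (a + b - c) \<le> norm a + norm b + norm (c :: complex)"
  using norm_triangle_ineq4[of "a + b" c] norm_triangle_ineq[of a b] by linarith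

section \<open>Positive definite functions and characters\<close>

context invariant_mean
begin

lemma sq_cmult: "uc f \<Longrightarrow> sq (\<lambda>x. c * f x) = (norm c)\<^sup>2 * sq f"
  unfolding sq_alt norm_mult power_mult_distrib of_real_mult
  by (subst M_cmult[OF uc_sq]) (auto simp del: of_real_power)

lemma sq_parallelogram:
  assumes "uc f" "uc g"
  shows "sq (\<lambda>x. f x + g x) + sq (\<lambda>x. f x - g x) = 2 * sq f + 2 * sq g"
proof -
  have "complex_of_real (sq (\<lambda>x. f x + g x) + sq (\<lambda>x. f x - g x))
      = M (\<lambda>x. (f x + g x) * cnj (f x + g x) + (f x - g x) * cnj (f x - g x))"
    unfolding of_real_add
    by (subst (1 2) of_real_sq, (rule uc_add uc_diff assms)+)
       (intro M_add[symmetric] uc_mult uc_cnj uc_add uc_diff assms)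
  also have "\<dots> = M (\<lambda>x. 2 * (f x * cnj (f x)) + 2 * (g x * cnj (g x)))"
    by (simp add: algebra_simps)
  also have "\<dots> = 2 * of_real (sq f) + 2 * of_real (sq g)"
    unfolding of_real_sq[OF assms(1)] of_real_sq[OF assms(2)]
    by (simp add: M_add M_cmult uc_mult uc_cnj assms)
  also have "\<dots> = of_real (2 * sq f + 2 * sq g)" by simp
  finally show ?thesis by (simp only: of_real_eq_iff)
qed

lemma sq_diff_le:
  assumes "uc f" "uc g" "\<And>x. norm (f x) \<le> B" "\<And>x. norm (g x) \<le> B" "\<And>x. norm (f x - g x) \<le> e"
  shows "\<bar>sq f - sq g\<bar> \<le> 2 * B * e"
proof -
  have "norm (M (\<lambda>x. of_real ((norm (f x))\<^sup>2)) - M (\<lambda>x. of_real ((norm (g x))\<^sup>2))) \<le> 2 * B * e"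
  proof (rule M_diff_bound)
    fix x
    have "\<bar>(norm (f x))\<^sup>2 - (norm (g x))\<^sup>2\<bar> = (norm (f x) + norm (g x)) * \<bar>norm (f x) - norm (g x)\<bar>"
      by (simp add: power2_eq_square square_diff_square_factored abs_mult)
    also have "\<dots> \<le> (B + B) * e"
      using norm_triangle_ineq3[of "f x" "g x"] assms(5)[of x] order_trans[OF norm_ge_zero assms(3)[of x]]
      by (intro mult_mono add_mono assms) auto
    finally show "norm (complex_of_real ((norm (f x))\<^sup>2) - complex_of_real ((norm (g x))\<^sup>2)) \<le> 2 * B * e"
      by (simp flip: of_real_diff of_real_power)
  qed (rule uc_sq assms)+
  then show ?thesis
    unfolding sq_alt by (metis abs_Re_le_cmod minus_complex.sel(1) order_trans)
qed

lemma conv_shift: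
  assumes "uc \<psi>" "uc a"
  shows "conv \<psi> (\<lambda>s. a (s + t)) x = conv \<psi> a (x - t)"
proof -
  have "uc (\<lambda>s. \<psi> (x - t + s) * a s)"
    by (intro uc_mult assms uc_shift'[OF assms(1)])
  from M_shift[OF this, of t] show ?thesis
    unfolding conv_def by (simp add: algebra_simps)
qed

lemma conv_add:
  assumes "uc \<psi>" "uc a" "uc b"
  shows "conv \<psi> (\<lambda>s. a s + b s) x = conv \<psi> a x + conv \<psi> b x"
  unfolding conv_def distrib_left
  by (intro M_add uc_mult assms uc_shift'[OF assms(1)])

lemma conv_cmult:
  assumes "uc \<psi>" "uc a"
  shows "conv \<psi> (\<lambda>s. c * a s) x = c * conv \<psi> a x"
  unfolding conv_def mult.left_commute[of _ c]
  by (intro M_cmult uc_mult assms uc_shift'[OF assms(1)])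

text \<open>Autocorrelations supply all the positive definite functions that the argument uses; the
  value at 0 is \<open>sq g\<close>, so normalisation means \<open>sq g = 1\<close>.\<close>

definition acorr :: "('a \<Rightarrow> complex) \<Rightarrow> 'a \<Rightarrow> complex" where
  "acorr g = conv g (\<lambda>s. cnj (g s))"

lemma uc_acorr [intro]: "uc g \<Longrightarrow> uc (acorr g)"
  unfolding acorr_def by auto

lemma acorr_0: "uc g \<Longrightarrow> acorr g 0 = of_real (sq g)"
  by (simp add: acorr_def conv_def of_real_sq)

lemma acorr_minus:
  assumes "uc g" shows "acorr g (- t) = cnj (acorr g t)"
proof -
  have u: "uc (\<lambda>s. g (t + s) * cnj (g s))" "uc (\<lambda>s. g (- t + s) * cnj (g s))"
    by (intro uc_mult uc_cnj assms uc_shift'[OF assms])+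
  have "cnj (acorr g t) = M (\<lambda>s. cnj (g (t + s) * cnj (g s)))"
    unfolding acorr_def conv_def by (rule M_cnj[OF u(1), symmetric])
  also have "\<dots> = M (\<lambda>s. g (- t + (s + t)) * cnj (g (s + t)))"
    by (simp add: algebra_simps)
  also have "\<dots> = acorr g (- t)"
    unfolding acorr_def conv_def by (rule M_shift[OF u(2)])
  finally show ?thesis by simp
qed

text \<open>Expansion of the product, with \<open>c * cnj c = 1\<close> and invariance of the mean.
  Replacing \<open>c\<close> by \<open>- c\<close> turns the bracket into its negative, which yields
  the two competitors in the extremal argument of \<open>exists_character\<close>; both are
  autocorrelations, hence again admissible.\<close>

lemma acorr_add_translate:
  assumes "uc g" "norm c = 1"
  shows "acorr (\<lambda>s. g s + c * g (s + t)) x = 2 * acorr g x + (c * acorr g (x + t) + cnj c * acorr g (x - t))"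
proof -
  have cc: "c * cnj c = 1" using assms(2) by (simp add: complex_norm_square[symmetric])
  have u0: "uc (\<lambda>s. g (y + s) * cnj (g s))" for y
    by (rule uc_mult[OF uc_shift'[OF assms(1), of y] uc_cnj[OF assms(1)]])
  have u: "uc (\<lambda>s. g (x + s) * cnj (g s))" "uc (\<lambda>s. g (x + t + s) * cnj (g s))"
    "uc (\<lambda>s. g (x - t + s) * cnj (g s))"
    "uc (\<lambda>s. g (x - t + (s + t)) * cnj (g (s + t)))"
    "uc (\<lambda>s. g (x + (s + t)) * cnj (g (s + t)))"
    by (rule u0 uc_shift[OF u0, of "x - t" t] uc_shift[OF u0, of x t])+
  have "acorr (\<lambda>s. g s + c * g (s + t)) x =
     M (\<lambda>s. ((g (x + s) * cnj (g s) + g (x + (s + t)) * cnj (g (s + t)))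
          + c * (g (x + t + s) * cnj (g s))) + cnj c * (g (x - t + (s + t)) * cnj (g (s + t))))"
    unfolding acorr_def conv_def
  proof (rule arg_cong[of _ _ M], rule ext)
    fix s
    have "(a + c * b) * cnj (a' + c * b') = ((a * cnj a' + b * cnj b') + c * (b * cnj a')) + cnj c * (a * cnj b')"
      for a b a' b'
    proof -
      have "(a + c * b) * cnj (a' + c * b') =
          ((a * cnj a' + (c * cnj c) * (b * cnj b')) + c * (b * cnj a')) + cnj c * (a * cnj b')"
        by (simp add: algebra_simps)
      then show ?thesis by (simp only: cc mult_1_left)
    qed
    then show "(g (x + s) + c * g (x + s + t)) * cnj (g s + c * g (s + t)) =
       ((g (x + s) * cnj (g s) + g (x + (s + t)) * cnj (g (s + t)))
          + c * (g (x + t + s) * cnj (g s))) + cnj c * (g (x - t + (s + t)) * cnj (g (s + t)))"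
      by (simp add: algebra_simps)
  qed
  also have "\<dots> = ((M (\<lambda>s. g (x + s) * cnj (g s)) + M (\<lambda>s. g (x + (s + t)) * cnj (g (s + t))))
          + c * M (\<lambda>s. g (x + t + s) * cnj (g s))) + cnj c * M (\<lambda>s. g (x - t + (s + t)) * cnj (g (s + t)))"
    using u by (simp add: M_add M_cmult uc_mult uc_add)
  also have "M (\<lambda>s. g (x + (s + t)) * cnj (g (s + t))) = acorr g x"
    unfolding acorr_def conv_def by (rule M_shift[OF u(1)])
  also have "M (\<lambda>s. g (x - t + (s + t)) * cnj (g (s + t))) = acorr g (x - t)"
    unfolding acorr_def conv_def by (rule M_shift[OF u(3)])
  finally show ?thesis by (simp add: acorr_def conv_def)
qed

lemma sq_add_translate:
  assumes "uc g" "norm c = 1"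
  shows "sq (\<lambda>s. g s + c * g (s + t)) = 2 * sq g + 2 * Re (c * acorr g t)"
proof -
  have u: "uc (\<lambda>s. g s + c * g (s + t))"
    by (intro uc_add uc_mult uc_const assms uc_shift[OF assms(1)])
  have "complex_of_real (sq (\<lambda>s. g s + c * g (s + t))) = 2 * acorr g 0 + (c * acorr g t + cnj (c * acorr g t))"
    using acorr_add_translate[OF assms, of t 0] acorr_minus[OF assms(1), of t]
    by (simp flip: acorr_0[OF u])
  also have "\<dots> = complex_of_real (2 * sq g + 2 * Re (c * acorr g t))"
    unfolding complex_add_cnj by (simp add: acorr_0 assms)
  finally show ?thesis by (simp only: of_real_eq_iff)
qed

text \<open>Positivity of \<open>sq\<close> for \<open>g\<close> plus a rotated translate, with the
  phase \<open>c\<close> chosen such that \<open>c * acorr g t\<close> equals minus the modulus of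
  \<open>acorr g t\<close>; then \<open>sq_add_translate\<close> gives
  \<open>0 \<le> 2 * sq g - 2 * norm (acorr g t)\<close>.\<close>

lemma acorr_bound:
  assumes "uc g" shows "norm (acorr g t) \<le> sq g"
proof (cases "acorr g t = 0")
  case False
  define c where "c = - cnj (acorr g t) / norm (acorr g t)"
  have c: "norm c = 1" using False by (simp add: c_def norm_divide)
  have "c * acorr g t = - norm (acorr g t)"
    using False complex_norm_square[of "acorr g t"]
    by (simp add: c_def field_simps power2_eq_square)
  moreover have "0 \<le> sq (\<lambda>s. g s + c * g (s + t))"
    by (intro sq_nonneg uc_add uc_mult uc_const assms uc_shift[OF assms(1)])
  ultimately show ?thesis using sq_add_translate[OF assms c, of t] by simp
qed (use sq_nonneg assms in auto)

text \<open>These are the characters of the compact completion. For \<open>weyl_dist\<close> they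
  are continuous for the group topology as well (\<open>ap_character_continuous\<close>).\<close>

definition ap_character :: "('a \<Rightarrow> complex) \<Rightarrow> bool" where
  "ap_character \<xi> \<longleftrightarrow> uc \<xi> \<and> (\<forall>x. norm (\<xi> x) = 1) \<and> (\<forall>x y. \<xi> (x + y) = \<xi> x * \<xi> y)"

lemma ap_characterD:
  assumes "ap_character \<xi>"
  shows "uc \<xi>" "norm (\<xi> x) = 1" "\<xi> (x + y) = \<xi> x * \<xi> y" "\<xi> x * cnj (\<xi> x) = 1"
  using assms by (auto simp: ap_character_def simp flip: complex_norm_square)

text \<open>Shifting the variable of the mean by \<open>x\<close> pulls out the factor
  \<open>\<xi> x\<close>. Thus \<open>conv \<psi>\<close> maps a conjugate character to a multiple
  of the character, the multiple being a Fourier coefficient of \<open>\<psi>\<close>.\<close>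

lemma conv_ap_character:
  assumes "uc \<psi>" "ap_character \<xi>"
  shows "conv \<psi> (\<lambda>s. cnj (\<xi> s)) x = \<xi> x * M (\<lambda>s. \<psi> s * cnj (\<xi> s))"
proof -
  note [simp] = ap_characterD[OF assms(2)]
  have u: "uc (\<lambda>s. \<psi> s * cnj (\<xi> s))" by (intro uc_mult assms uc_cnj) simp
  have "\<xi> x * M (\<lambda>s. \<psi> s * cnj (\<xi> s)) = \<xi> x * M (\<lambda>s. \<psi> (s + x) * cnj (\<xi> (s + x)))"
    using M_shift[OF u, of x] by simp
  also have "\<dots> = M (\<lambda>s. \<xi> x * (\<psi> (s + x) * cnj (\<xi> (s + x))))"
    by (rule M_cmult[OF uc_shift[OF u], symmetric])
  also have "(\<lambda>s. \<xi> x * (\<psi> (s + x) * cnj (\<xi> (s + x)))) = (\<lambda>s. \<psi> (x + s) * cnj (\<xi> s))"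
  proof
    fix s
    have "\<xi> x * (\<psi> (s + x) * cnj (\<xi> (s + x))) = (\<xi> x * cnj (\<xi> x)) * (\<psi> (s + x) * cnj (\<xi> s))"
      by (simp del: ap_characterD(4) add: mult_ac)
    then show "\<xi> x * (\<psi> (s + x) * cnj (\<xi> (s + x))) = \<psi> (x + s) * cnj (\<xi> s)"
      by (simp add: add.commute)
  qed
  finally show ?thesis by (simp add: conv_def)
qed

lemma acorr_cmult:
  assumes "uc g" shows "acorr (\<lambda>s. of_real r * g s) x = of_real (r\<^sup>2) * acorr g x"
proof -
  have "acorr (\<lambda>s. of_real r * g s) x = M (\<lambda>s. of_real (r\<^sup>2) * (g (x + s) * cnj (g s)))"
    unfolding acorr_def conv_def by (simp add: power2_eq_square algebra_simps)
  also have "\<dots> = of_real (r\<^sup>2) * acorr g x"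
    unfolding acorr_def conv_def by (intro M_cmult uc_mult uc_cnj assms uc_shift'[OF assms])
  finally show ?thesis .
qed

text \<open>
  A nonzero function has a nonzero Fourier coefficient.  Maximise the mean square of
  \<open>\<psi> * \<phi>\<close> over normalised positive definite functions \<open>\<phi>\<close>.  Since
  \<open>\<phi>\<close> is the average of the two (unnormalised) positive definite functions
  \<open>\<phi> x \<plusminus> (c \<phi> (x + t) + cnj c \<phi> (x - t)) / 2\<close>, an optimal \<open>\<phi>\<close> must be a character.
\<close>

lemma exists_character:
  assumes \<psi>: "uc \<psi>" and nz: "\<psi> z \<noteq> 0"
  obtains \<xi> where "ap_character \<xi>" "M (\<lambda>x. \<psi> x * cnj (\<xi> x)) \<noteq> 0"
proof -
  obtain B where B: "B > 0" "\<And>x. norm (\<psi> x) \<le> B" using uc_bounded[OF \<psi>] by blast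
  \<comment> \<open>Since \<open>acorr g (- s) = cnj (acorr g s)\<close>, this is the convolution of
    \<open>\<psi>\<close> with the positive definite function \<open>acorr g\<close>.\<close>
  define Th where "Th = (\<lambda>g. conv \<psi> (\<lambda>s. cnj (acorr g s)))"
  have ucT: "uc (Th g)" if "uc g" for g unfolding Th_def using that \<psi> by auto
  have ucA: "uc (\<lambda>s. cnj (acorr g s))" if "uc g" for g using that by auto
  have T_bound: "norm (Th g x) \<le> B" if "uc g" "sq g = 1" for g x
    using conv_bound[OF \<psi> ucA[OF that(1)], of 1 B x] acorr_bound[OF that(1)] B that(2)
    by (simp add: Th_def)
  define S where "S = {g. uc g \<and> sq g = 1}"
  define J where "J = (SUP g\<in>S. sq (Th g))"
  have bdd: "bdd_above ((\<lambda>g. sq (Th g)) ` S)"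
    by (rule bdd_aboveI2[of _ _ "B\<^sup>2"]) (auto simp: S_def intro!: sq_le ucT T_bound)
  have T_scale: "Th (\<lambda>s. of_real r * g s) x = of_real (r\<^sup>2) * Th g x" if "uc g" for g r x
    unfolding Th_def acorr_cmult[OF that] complex_cnj_mult complex_cnj_complex_of_real
    by (rule conv_cmult[OF \<psi> ucA[OF that]])
  \<comment> \<open>\<open>Th g\<close> is quadratic in \<open>g\<close>, so
    \<open>sq (Th g)\<close> has degree four, the same as \<open>(sq g)\<^sup>2\<close>; this
    removes the normalisation from the supremum.\<close>
  have J: "sq (Th g) \<le> J * (sq g)\<^sup>2" if g: "uc g" for g
  proof (cases "sq g = 0")
    case True
    then have g0: "g = (\<lambda>x. 0)" using sq_eq_0[OF g] by auto
    show ?thesis unfolding g0 by (simp add: sq_def Th_def acorr_def conv_def)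
  next
    case False
    then have pos: "sq g > 0" using sq_nonneg[OF g] by simp
    define r where "r = 1 / sqrt (sq g)"
    have r2: "r\<^sup>2 = 1 / sq g" using pos by (simp add: r_def power_divide)
    have "(\<lambda>s. of_real r * g s) \<in> S"
      using g pos by (auto simp: S_def sq_cmult r2 intro!: uc_mult)
    then have "sq (Th (\<lambda>s. of_real r * g s)) \<le> J"
      unfolding J_def by (rule cSUP_upper[OF _ bdd])
    also have "Th (\<lambda>s. of_real r * g s) = (\<lambda>x. of_real (r\<^sup>2) * Th g x)"
      using T_scale[OF g] by auto
    also have "sq \<dots> = (1 / sq g)\<^sup>2 * sq (Th g)"
      by (subst sq_cmult[OF ucT[OF g]]) (use pos in \<open>simp add: r2 norm_divide\<close>)
    finally show ?thesis using pos by (simp add: power_divide divide_le_eq)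
  qed
  \<comment> \<open>Positivity of \<open>J\<close>: the trial function \<open>g = \<psi>\<close>
    works, because \<open>mean_fubini\<close> turns the pairing of \<open>Th \<psi>\<close> with
    \<open>cnj \<psi>\<close> into \<open>sq (acorr \<psi>)\<close>, and
    \<open>acorr \<psi> 0 = sq \<psi>\<close> is nonzero.\<close>
  have "sq \<psi> > 0" using sq_eq_0[OF \<psi>, of z] nz by fastforce
  have "sq (acorr \<psi>) > 0"
    using sq_eq_0[OF uc_acorr[OF \<psi>], of 0] acorr_0[OF \<psi>] \<open>sq \<psi> > 0\<close> by fastforce
  moreover have "M (\<lambda>x. cnj (\<psi> x) * Th \<psi> x) = of_real (sq (acorr \<psi>))"
    unfolding Th_def mean_fubini[OF \<psi> ucA[OF \<psi>] uc_cnj[OF \<psi>]] of_real_sq[OF uc_acorr[OF \<psi>]]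
    by (simp add: acorr_def mult.commute)
  ultimately have "\<exists>x. Th \<psi> x \<noteq> 0"
    by (metis (no_types, lifting) M_const mult_zero_right of_real_eq_0_iff order_less_irrefl ext)
  then have "sq (Th \<psi>) > 0" using sq_eq_0[OF ucT[OF \<psi>]] by (metis not_le)
  with J[OF \<psi>] have Jpos: "J > 0" by (smt (verit) mult_nonpos_nonneg zero_le_power2)

  have "S \<noteq> {}"
  proof -
    have "(\<lambda>x. 1) \<in> S" by (auto simp: S_def sq_def)
    then show ?thesis by auto
  qed
  have "\<exists>g\<in>S. sq (Th g) > J - 1 / real (Suc n)" for n
  proof -
    have "J - 1 / real (Suc n) < J" by simp
    then show ?thesis unfolding J_def using less_cSUP_iff[OF \<open>S \<noteq> {}\<close> bdd] by blast
  qed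
  then obtain g where g: "\<And>n. g n \<in> S" "\<And>n. sq (Th (g n)) > J - 1 / real (Suc n)" by metis
  have ucg: "uc (g n)" and sqg: "sq (g n) = 1" for n using g(1)[of n] by (auto simp: S_def)
  have bA: "norm (acorr (g n) t) \<le> 1" for n t using acorr_bound[OF ucg] sqg by metis
  \<comment> \<open>The limit of \<open>acorr (g n)\<close> is only pointwise and not yet known to
    be \<open>uc\<close>, so the laws of \<open>conv\<close> do not apply to it. For this reason the
    functions \<open>Th (g n)\<close> are carried along as further coordinates and get their own
    limit \<open>\<theta>\<close> along the same indices.\<close>
  define X where "X = (\<lambda>n. case_sum (acorr (g n)) (Th (g n)))"
  have "norm (X n i) \<le> max 1 B" for n i
    using bA T_bound[OF ucg sqg] by (cases i) (auto simp: X_def le_max_iff_disj)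
  then obtain L where L: "\<And>F e N. finite F \<Longrightarrow> e > 0 \<Longrightarrow> \<exists>n\<ge>N. \<forall>i\<in>F. norm (X n i - L i) < e"
    using pointwise_cluster_point[of X "\<lambda>_. max 1 B"] by metis
  define \<phi> where "\<phi> = (\<lambda>t. L (Inl t))"
  define \<theta> where "\<theta> = (\<lambda>x. L (Inr x))"
  have L1: "\<exists>n\<ge>N. (\<forall>t\<in>P. norm (acorr (g n) t - \<phi> t) < e) \<and> (\<forall>x\<in>Q. norm (Th (g n) x - \<theta> x) < e)"
    if "finite P" "finite Q" "e > 0" for P Q e N
  proof -
    have "finite (Inl ` P \<union> Inr ` Q)" using that by simp
    from L[OF this that(3), of N]
    obtain n where n: "n \<ge> N" "\<forall>i\<in>Inl ` P \<union> Inr ` Q. norm (X n i - L i) < e" by blast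
    have "norm (acorr (g n) t - \<phi> t) < e" if "t \<in> P" for t
      using bspec[OF n(2), of "Inl t"] that by (simp add: X_def \<phi>_def)
    moreover have "norm (Th (g n) x - \<theta> x) < e" if "x \<in> Q" for x
      using bspec[OF n(2), of "Inr x"] that by (simp add: X_def \<theta>_def)
    ultimately show ?thesis using n(1) by blast
  qed
  have eq_n: "norm (Th (g n) x - Th (g n) y) \<le> e" if "\<And>s. norm (\<psi> (x + s) - \<psi> (y + s)) \<le> e" for n x y e
    using conv_diff_bound[OF \<psi> ucA[OF ucg], of _ 1 x y e] bA that by (simp add: Th_def)
  have eq_lim: "norm (\<theta> x - \<theta> y) \<le> e" if "\<And>s. norm (\<psi> (x + s) - \<psi> (y + s)) \<le> e" for x y e
  proof (rule le_of_le_add_mult_eps[where C = 2])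
    fix d :: real assume "d > 0"
    then obtain n where n: "norm (Th (g n) x - \<theta> x) < d" "norm (Th (g n) y - \<theta> y) < d"
      using L1[of "{}" "{x, y}" d 0] by auto
    have "\<theta> x - \<theta> y = (Th (g n) x - Th (g n) y) - (Th (g n) x - \<theta> x) + (Th (g n) y - \<theta> y)" by simp
    then have "norm (\<theta> x - \<theta> y) \<le> norm (Th (g n) x - Th (g n) y) + norm (Th (g n) x - \<theta> x) + norm (Th (g n) y - \<theta> y)"
      by (metis norm_diff_add_le)
    then show "norm (\<theta> x - \<theta> y) \<le> e + 2 * d" using eq_n[OF that, of n] n by linarith
  qed
  have uc\<theta>: "uc \<theta>"
    by (rule uc_dominated[OF \<psi>, of _ 1]) (auto intro!: eq_lim)
  \<comment> \<open>As in the Arzela-Ascoli theorem: the functions \<open>Th (g n)\<close> share the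
    modulus of continuity of \<open>\<psi>\<close>, so closeness on a finite net gives uniform
    closeness. For \<open>acorr (g n)\<close> closeness is available only on the finite set
    \<open>P\<close>.\<close>
  have approx: "\<exists>n\<ge>N. (\<forall>t\<in>P. norm (acorr (g n) t - \<phi> t) < e) \<and> (\<forall>x. norm (Th (g n) x - \<theta> x) \<le> e)"
    if P: "finite P" and e: "e > 0" for P e N
  proof -
    from ucE[OF \<psi>, of "e/3"] e obtain d where d: "d > 0"
      "\<And>x y. D (x - y) < d \<Longrightarrow> norm (\<psi> x - \<psi> y) < e / 3" by auto
    from totally_bounded[OF d(1)] obtain F where F: "finite F" "\<And>t. \<exists>s\<in>F. D (t - s) < d" by blast
    from L1[OF P F(1), of "e/3" N] e obtain n where n: "n \<ge> N" "\<And>t. t \<in> P \<Longrightarrow> norm (acorr (g n) t - \<phi> t) < e / 3"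
      "\<And>x. x \<in> F \<Longrightarrow> norm (Th (g n) x - \<theta> x) < e / 3" by auto
    have "norm (Th (g n) x - \<theta> x) \<le> e" for x
    proof -
      obtain s where s: "s \<in> F" "D (x - s) < d" using F by blast
      have *: "norm (\<psi> (x + r) - \<psi> (s + r)) \<le> e / 3" for r
        using d(2)[of "x + r" "s + r"] s by simp
      have "Th (g n) x - \<theta> x = (Th (g n) x - Th (g n) s) + (Th (g n) s - \<theta> s) - (\<theta> x - \<theta> s)" by simp
      then have "norm (Th (g n) x - \<theta> x) \<le> norm (Th (g n) x - Th (g n) s) + norm (Th (g n) s - \<theta> s) + norm (\<theta> x - \<theta> s)"
        by (metis norm_add_diff_le)
      then show ?thesis using eq_n[OF *, of n] eq_lim[OF *] n(3)[OF s(1)] by linarith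
    qed
    moreover have "\<forall>t\<in>P. norm (acorr (g n) t - \<phi> t) < e" using n(2) e by fastforce
    ultimately show ?thesis using n(1) by blast
  qed
  have \<phi>_le: "norm (\<phi> t) \<le> 1" for t
  proof (rule le_of_le_add_mult_eps[where C = 1])
    fix e :: real assume "e > 0"
    then obtain n where n: "norm (acorr (g n) t - \<phi> t) < e" using L1[of "{t}" "{}" e 0] by auto
    then show "norm (\<phi> t) \<le> 1 + 1 * e"
      using bA[of n t] norm_triangle_sub[of "\<phi> t" "acorr (g n) t"] by (simp add: norm_minus_commute)
  qed
  have \<theta>_le: "norm (\<theta> t) \<le> B" for t
  proof (rule le_of_le_add_mult_eps[where C = 1])
    fix e :: real assume "e > 0"
    then obtain n where n: "norm (Th (g n) t - \<theta> t) < e" using L1[of "{}" "{t}" e 0] by auto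
    then show "norm (\<theta> t) \<le> B + 1 * e"
      using T_bound[OF ucg sqg, of n t] norm_triangle_sub[of "\<theta> t" "Th (g n) t"] by (simp add: norm_minus_commute)
  qed
  have J\<theta>: "J \<le> sq \<theta>"
  proof (rule le_of_le_add_mult_eps[where C = "1 + 2 * B"])
    fix e :: real assume "e > 0"
    obtain N where N: "1 / real (Suc N) < e" using \<open>e > 0\<close> nat_approx_posE by blast
    obtain n where n: "n \<ge> N" "\<And>x. norm (Th (g n) x - \<theta> x) \<le> e"
      using approx[of "{}" e N] \<open>e > 0\<close> by auto
    have "1 / real (Suc n) \<le> 1 / real (Suc N)" using n by (simp add: frac_le)
    moreover have "\<bar>sq (Th (g n)) - sq \<theta>\<bar> \<le> 2 * B * e"
      by (rule sq_diff_le) (use n ucT ucg uc\<theta> T_bound sqg \<theta>_le in auto)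
    ultimately show "J \<le> sq \<theta> + (1 + 2 * B) * e"
      using g(2)[of n] N by (simp add: algebra_simps)
  qed
  define W where "W = (\<lambda>t c x. c * \<theta> (x + t) + cnj c * \<theta> (x - t))"
  have ucW: "uc (W t c)" for t c
    unfolding W_def by (intro uc_add uc_mult uc_const uc_shift[OF uc\<theta>] uc_shift_minus[OF uc\<theta>])
  have uc2: "uc (\<lambda>x. 2 * \<theta> x)" by (intro uc_mult uc_const uc\<theta>)
  \<comment> \<open>This is the inequality \<open>J\<close> for \<open>g n\<close> plus its rotated
    translate, in the limit. The error constants: all functions are at most \<open>4 * B\<close> and
    differ by at most \<open>4 * e\<close>, so \<open>sq_diff_le\<close> gives
    \<open>32 * B * e\<close>; the squared factor on the right changes by at most
    \<open>16 * e\<close> and is multiplied by \<open>J\<close>.\<close>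
  have main: "sq (\<lambda>x. 2 * \<theta> x + W t c x) \<le> J * (2 + 2 * Re (c * \<phi> t))\<^sup>2" if c: "norm c = 1" for c t
  proof (rule le_of_le_add_mult_eps[where C = "16 * J + 32 * B"])
    fix e :: real assume "e > 0"
    then obtain n where n: "norm (acorr (g n) t - \<phi> t) < e" "\<And>x. norm (Th (g n) x - \<theta> x) \<le> e"
      using approx[of "{t}" e 0] by auto
    define h where "h = (\<lambda>s. g n s + c * g n (s + t))"
    have uch: "uc h" unfolding h_def by (intro uc_add uc_mult uc_const ucg uc_shift[OF ucg])
    have Th: "Th h x = 2 * Th (g n) x + (c * Th (g n) (x + t) + cnj c * Th (g n) (x - t))" for x
    proof -
      define a where "a = (\<lambda>s. cnj (acorr (g n) s))"
      have uca: "uc a" unfolding a_def by (rule ucA[OF ucg])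
      have "Th h x = conv \<psi> (\<lambda>s. 2 * a s + (cnj c * a (s + t) + c * a (s + - t))) x"
        unfolding Th_def h_def acorr_add_translate[OF ucg c] a_def by simp
      also have "\<dots> = 2 * conv \<psi> a x + (cnj c * conv \<psi> a (x - t) + c * conv \<psi> a (x - - t))"
        unfolding conv_shift[OF \<psi> uca, symmetric]
        using \<psi> uca uc_shift[OF uca, of t] uc_shift[OF uca, of "- t"]
        by (simp add: conv_add conv_cmult uc_add uc_mult)
      finally show ?thesis by (simp add: Th_def a_def algebra_simps)
    qed
    have sqh: "sq h = 2 + 2 * Re (c * acorr (g n) t)"
      unfolding h_def using sq_add_translate[OF ucg c] sqg by simp
    have n3: "norm (u * a + (v * b + w * d)) \<le> 2 * p + (p + p)"
      if "norm u = 2" "norm v = 1" "norm w = 1" "norm a \<le> p" "norm b \<le> p" "norm d \<le> p" for a b d u v w :: complex and p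
    proof -
      have "norm (u * a + (v * b + w * d)) \<le> norm (u * a) + (norm (v * b) + norm (w * d))"
        by (meson add_left_mono norm_triangle_ineq order_trans)
      then show ?thesis using that by (simp add: norm_mult)
    qed
    have c': "norm (cnj c) = 1" using c by simp
    have "\<bar>sq (\<lambda>x. 2 * \<theta> x + W t c x) - sq (Th h)\<bar> \<le> 2 * (2 * B + (B + B)) * (2 * e + (e + e))"
    proof (rule sq_diff_le)
      fix x
      show "norm (2 * \<theta> x + W t c x) \<le> 2 * B + (B + B)"
        unfolding W_def by (rule n3[OF _ c c' \<theta>_le \<theta>_le \<theta>_le]) auto
      show "norm (Th h x) \<le> 2 * B + (B + B)"
        unfolding Th by (rule n3[OF _ c c']) (auto intro: T_bound[OF ucg sqg])
      have "2 * \<theta> x + W t c x - Th h x = 2 * (\<theta> x - Th (g n) x) +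
          (c * (\<theta> (x + t) - Th (g n) (x + t)) + cnj c * (\<theta> (x - t) - Th (g n) (x - t)))"
        unfolding W_def Th by (simp add: algebra_simps)
      also have "norm \<dots> \<le> 2 * e + (e + e)"
        by (rule n3[OF _ c c']) (use n(2) in \<open>auto simp: norm_minus_commute\<close>)
      finally show "norm (2 * \<theta> x + W t c x - Th h x) \<le> 2 * e + (e + e)" .
    qed (intro uc_add uc2 ucW ucT uch)+
    moreover have "sq (Th h) \<le> J * (2 + 2 * Re (c * acorr (g n) t))\<^sup>2"
      using J[OF uch] by (simp add: sqh)
    moreover have "(2 + 2 * Re (c * acorr (g n) t))\<^sup>2 \<le> (2 + 2 * Re (c * \<phi> t))\<^sup>2 + 16 * e"
    proof -
      define r where "r = Re (c * acorr (g n) t)"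
      define r' where "r' = Re (c * \<phi> t)"
      have "\<bar>r\<bar> \<le> 1" "\<bar>r'\<bar> \<le> 1"
        unfolding r_def r'_def
        using abs_Re_le_cmod[of "c * acorr (g n) t"] abs_Re_le_cmod[of "c * \<phi> t"] bA[of n t] \<phi>_le[of t]
        unfolding norm_mult c mult_1_left by linarith+
      moreover have "\<bar>r - r'\<bar> \<le> e"
      proof -
        have "r - r' = Re (c * (acorr (g n) t - \<phi> t))"
          unfolding r_def r'_def by (simp add: algebra_simps)
        also have "\<bar>\<dots>\<bar> \<le> norm (c * (acorr (g n) t - \<phi> t))" by (rule abs_Re_le_cmod)
        finally show ?thesis using n(1) c by (simp add: norm_mult)
      qed
      moreover have "(2 + 2 * r)\<^sup>2 - (2 + 2 * r')\<^sup>2 = 4 * (r - r') * (2 + r + r')"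
        by (simp add: power2_eq_square algebra_simps)
      moreover have "(r - r') * (2 + r + r') \<le> e * 4" if "\<bar>r\<bar> \<le> 1" "\<bar>r'\<bar> \<le> 1" "\<bar>r - r'\<bar> \<le> e"
      proof -
        have "(r - r') * (2 + r + r') \<le> e * (2 + r + r')"
          using that by (intro mult_right_mono) auto
        also have "\<dots> \<le> e * 4" using that by (intro mult_left_mono) auto
        finally show ?thesis .
      qed
      ultimately show ?thesis unfolding r_def[symmetric] r'_def[symmetric] by linarith
    qed
    ultimately show "sq (\<lambda>x. 2 * \<theta> x + W t c x) \<le> J * (2 + 2 * Re (c * \<phi> t))\<^sup>2 + (16 * J + 32 * B) * e"
      using mult_left_mono[of "(2 + 2 * Re (c * acorr (g n) t))\<^sup>2" "(2 + 2 * Re (c * \<phi> t))\<^sup>2 + 16 * e" J] Jpos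
      by (simp add: algebra_simps)
  qed
  have W_neg: "W t (- c) = (\<lambda>x. - W t c x)" for t c by (auto simp: W_def)
  \<comment> \<open>Parallelogram law for the competitors with \<open>c\<close> and
    \<open>- c\<close>: the right sides add up to
    \<open>8 * J + 8 * J * (Re (c * \<phi> t))\<^sup>2\<close>, and optimality
    \<open>J \<le> sq \<theta>\<close> cancels the term \<open>8 * J\<close>.\<close>
  have sqW: "sq (W t c) \<le> 4 * J * (Re (c * \<phi> t))\<^sup>2" if c: "norm c = 1" for c t
  proof -
    have "sq (\<lambda>x. 2 * \<theta> x + W t c x) + sq (\<lambda>x. 2 * \<theta> x - W t c x) = 2 * sq (\<lambda>x. 2 * \<theta> x) + 2 * sq (W t c)"
      by (rule sq_parallelogram[OF uc2 ucW])
    moreover have "sq (\<lambda>x. 2 * \<theta> x) = 4 * sq \<theta>" by (simp add: sq_cmult[OF uc\<theta>])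
    moreover have "sq (\<lambda>x. 2 * \<theta> x - W t c x) \<le> J * (2 - 2 * Re (c * \<phi> t))\<^sup>2"
      using main[of "- c" t] c by (simp add: W_neg del: times_complex.sel)
    ultimately have "8 * sq \<theta> + 2 * sq (W t c) \<le> J * (2 + 2 * Re (c * \<phi> t))\<^sup>2 + J * (2 - 2 * Re (c * \<phi> t))\<^sup>2"
      using main[OF c, of t] by linarith
    also have "\<dots> = 8 * J + 8 * (J * (Re (c * \<phi> t))\<^sup>2)"
      by (simp add: power2_eq_square algebra_simps)
    finally show ?thesis using J\<theta> by linarith
  qed
  have trans: "\<theta> (x + t) = \<phi> t * \<theta> x" for x t
  proof -
    define p where "p = (\<lambda>c x. c * \<theta> (x + t))"
    define q where "q = (\<lambda>c x. cnj c * \<theta> (x - t))"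
    have ucp: "uc (p c)" and ucq: "uc (q c)" for c
      unfolding p_def q_def by (intro uc_mult uc_const uc_shift[OF uc\<theta>] uc_shift_minus[OF uc\<theta>])+
    have Wi: "W t (\<i> * c) = (\<lambda>x. \<i> * (p c x - q c x))" for c
      by (auto simp: W_def p_def q_def algebra_simps)
    have sqi: "sq (W t (\<i> * c)) = sq (\<lambda>x. p c x - q c x)" for c
      unfolding Wi by (subst sq_cmult) (auto intro: ucp ucq)
    have sqp: "sq (p 1) = sq \<theta>" "sq (q 1) = sq \<theta>"
      using sq_shift[OF uc\<theta>, of t] sq_shift[OF uc\<theta>, of "-t"] by (auto simp: p_def q_def)
    \<comment> \<open>For \<open>c = 1\<close> and \<open>c = \<i>\<close> the function
      \<open>W t c\<close> is, up to a unimodular factor, the sum and the difference of the two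
      translates of \<open>\<theta>\<close>; their squares total \<open>4 * sq \<theta>\<close>,
      which forces \<open>norm (\<phi> t) \<ge> 1\<close>.\<close>
    have "sq (W t 1) + sq (W t (\<i> * 1)) = 2 * sq (p 1) + 2 * sq (q 1)"
      unfolding sqi using sq_parallelogram[OF ucp ucq, of 1 1] by (simp add: W_def p_def q_def)
    moreover have "sq (W t 1) \<le> 4 * J * (Re (\<phi> t))\<^sup>2" using sqW[of 1 t] by simp
    moreover have "sq (W t (\<i> * 1)) \<le> 4 * J * (Im (\<phi> t))\<^sup>2" using sqW[of "\<i> * 1" t] by simp
    ultimately have "4 * J \<le> 4 * J * (Re (\<phi> t))\<^sup>2 + 4 * J * (Im (\<phi> t))\<^sup>2"
      using J\<theta> sqp by linarith
    also have "\<dots> = 4 * J * (norm (\<phi> t))\<^sup>2" by (simp add: cmod_power2 algebra_simps)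
    finally have "1 \<le> (norm (\<phi> t))\<^sup>2" using Jpos by simp
    then have "1 \<le> norm (\<phi> t)" using power2_le_imp_le[of 1 "norm (\<phi> t)"] by simp
    with \<phi>_le[of t] have n1: "norm (\<phi> t) = 1" by simp
    \<comment> \<open>With this phase \<open>c * \<phi> t = 1\<close>. Then \<open>main\<close> for
      \<open>- c\<close> has right side 0, and so has \<open>sqW\<close> for
      \<open>\<i> * c\<close>, as \<open>Re \<i> = 0\<close>: the two translates of
      \<open>\<theta>\<close>, multiplied by \<open>c\<close> and \<open>cnj c\<close>, have the sum
      \<open>2 * \<theta> x\<close> and are equal.\<close>
    define c where "c = cnj (\<phi> t)"
    have c: "norm c = 1" "c * \<phi> t = 1" "\<phi> t * c = 1"
      using n1 complex_norm_square[of "\<phi> t"] by (auto simp: c_def mult.commute)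
    have "sq (\<lambda>x. 2 * \<theta> x + W t (- c) x) \<le> 0" using main[of "- c" t] c by simp
    then have "2 * \<theta> x + W t (- c) x = 0"
      by (rule sq_eq_0[OF uc_add[OF uc2 ucW]])
    then have "2 * \<theta> x - (c * \<theta> (x + t) + cnj c * \<theta> (x - t)) = 0"
      by (simp add: W_def algebra_simps)
    then have e1: "2 * \<theta> x = c * \<theta> (x + t) + cnj c * \<theta> (x - t)"
      by (simp only: eq_iff_diff_eq_0[symmetric])
    have "sq (W t (\<i> * c)) \<le> 0" using sqW[of "\<i> * c" t] c by (simp add: mult.assoc norm_mult)
    then have "W t (\<i> * c) x = 0" by (rule sq_eq_0[OF ucW])
    then have e2: "c * \<theta> (x + t) = cnj c * \<theta> (x - t)" unfolding Wi by (simp add: p_def q_def)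
    have "\<theta> x = c * \<theta> (x + t)" using e1 e2 by simp
    then have "\<phi> t * \<theta> x = (\<phi> t * c) * \<theta> (x + t)" by simp
    then show ?thesis using c by simp
  qed
  have \<theta>nz: "\<theta> 0 \<noteq> 0"
  proof
    assume "\<theta> 0 = 0"
    then have "\<theta> = (\<lambda>x. 0)" using trans[of 0] by auto
    then show False using J\<theta> Jpos by (simp add: sq_def)
  qed
  have n1: "norm (\<phi> t) = 1" for t
  proof -
    have "\<theta> 0 = \<phi> (- t) * (\<phi> t * \<theta> 0)" using trans[of 0 t] trans[of t "- t"] by simp
    then have "\<phi> (- t) * \<phi> t = 1" using \<theta>nz by simp
    then have "norm (\<phi> (- t)) * norm (\<phi> t) = 1" by (metis norm_mult norm_one)
    moreover have "norm (\<phi> (- t)) * norm (\<phi> t) \<le> 1 * norm (\<phi> t)" by (intro mult_right_mono \<phi>_le) auto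
    ultimately show ?thesis using \<phi>_le[of t] by simp
  qed
  have mult: "\<phi> (x + y) = \<phi> x * \<phi> y" for x y
  proof -
    have "\<phi> (x + y) * \<theta> 0 = \<phi> y * (\<phi> x * \<theta> 0)"
      using trans[of 0 "x + y"] trans[of x y] trans[of 0 x] by (metis add_0)
    also have "\<dots> = (\<phi> x * \<phi> y) * \<theta> 0" by (simp only: mult_ac)
    finally show ?thesis using \<theta>nz mult_right_cancel by blast
  qed
  have \<phi>_eq: "\<phi> x = \<theta> x * inverse (\<theta> 0)" for x
    using trans[of 0 x] by (simp only: add_0 mult.assoc right_inverse[OF \<theta>nz] mult_1_right)
  have uc\<phi>: "uc \<phi>"
    using uc_mult[OF uc\<theta> uc_const, of "inverse (\<theta> 0)"] by (simp only: \<phi>_eq[symmetric])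
  have "ap_character \<phi>" using uc\<phi> n1 mult by (auto simp: ap_character_def)
  moreover have "M (\<lambda>x. \<psi> x * cnj (\<phi> x)) \<noteq> 0"
  proof
    assume 0: "M (\<lambda>x. \<psi> x * cnj (\<phi> x)) = 0"
    have cp: "\<phi> x * cnj (\<phi> x) = 1" for x using n1[of x] by (simp flip: complex_norm_square)
    have "conv \<psi> (\<lambda>s. cnj (\<phi> s)) x = 0" for x
      unfolding conv_ap_character[OF \<psi> \<open>ap_character \<phi>\<close>] 0 by simp
    \<comment> \<open>By \<open>mean_fubini\<close> the vanishing of the convolution of
      \<open>\<psi>\<close> with \<open>\<phi>\<close> kills the pairing of every
      \<open>Th (g n)\<close> with \<open>cnj \<phi>\<close>. But these functions come uniformly
      close to \<open>\<theta>\<close>, which is \<open>\<theta> 0\<close> times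
      \<open>\<phi>\<close> and whose pairing is \<open>\<theta> 0\<close>.\<close>
    then have z: "M (\<lambda>x. cnj (\<phi> x) * Th (g n) x) = 0" for n
      unfolding Th_def using mean_fubini[OF \<psi> ucA[OF ucg] uc_cnj[OF uc\<phi>], of n] by simp
    have "norm (\<theta> 0) \<le> 0"
    proof (rule le_of_le_add_mult_eps[where C = 1])
      fix e :: real assume "e > 0"
      then obtain n where n: "\<And>x. norm (Th (g n) x - \<theta> x) \<le> e"
        using approx[of "{}" e 0] by auto
      have "M (\<lambda>x. cnj (\<phi> x) * \<theta> x) = M (\<lambda>x. \<theta> 0)"
      proof (rule arg_cong[of _ _ M], rule ext)
        fix x show "cnj (\<phi> x) * \<theta> x = \<theta> 0"
          using cp[of x] trans[of 0 x] by (simp add: mult.assoc[symmetric] mult.commute)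
      qed
      then have "M (\<lambda>x. cnj (\<phi> x) * \<theta> x) = \<theta> 0" by simp
      moreover have "norm (M (\<lambda>x. cnj (\<phi> x) * \<theta> x) - M (\<lambda>x. cnj (\<phi> x) * Th (g n) x)) \<le> e"
        by (rule M_diff_bound)
           (use n n1 in \<open>auto intro!: uc_mult uc_cnj uc\<phi> uc\<theta> ucT ucg simp: norm_mult norm_minus_commute
             simp flip: right_diff_distrib\<close>)
      ultimately show "norm (\<theta> 0) \<le> 0 + 1 * e" by (simp add: z)
    qed
    then show False using \<theta>nz by simp
  qed
  ultimately show ?thesis by (rule that)
qed

section \<open>Fourier series of autocorrelations\<close>

lemma ap_character_orthogonal:
  assumes \<xi>: "ap_character \<xi>" and \<eta>: "ap_character \<eta>" and ne: "\<xi> \<noteq> \<eta>"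
  shows "M (\<lambda>x. \<xi> x * cnj (\<eta> x)) = 0"
proof -
  obtain t where t: "\<xi> t \<noteq> \<eta> t" using ne by auto
  have u: "uc (\<lambda>x. \<xi> x * cnj (\<eta> x))"
    using ap_characterD(1)[OF \<xi>] ap_characterD(1)[OF \<eta>] by auto
  have "M (\<lambda>x. \<xi> x * cnj (\<eta> x)) = M (\<lambda>x. \<xi> (x + t) * cnj (\<eta> (x + t)))"
    by (rule M_shift[OF u, symmetric])
  also have "\<dots> = M (\<lambda>x. (\<xi> t * cnj (\<eta> t)) * (\<xi> x * cnj (\<eta> x)))"
    by (simp add: ap_characterD(3)[OF \<xi>] ap_characterD(3)[OF \<eta>] mult_ac)
  also have "\<dots> = (\<xi> t * cnj (\<eta> t)) * M (\<lambda>x. \<xi> x * cnj (\<eta> x))"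
    by (rule M_cmult[OF u])
  finally have "M (\<lambda>x. \<xi> x * cnj (\<eta> x)) = 0 \<or> \<xi> t * cnj (\<eta> t) = 1"
    by (metis mult_cancel_right1)
  moreover have "\<xi> t * cnj (\<eta> t) \<noteq> 1"
  proof
    assume "\<xi> t * cnj (\<eta> t) = 1"
    then have "\<eta> t = \<xi> t * (\<eta> t * cnj (\<eta> t))" by (simp add: mult_ac)
    then show False using t ap_characterD(4)[OF \<eta>] by simp
  qed
  ultimately show ?thesis by blast
qed

lemma coefficient_sum:
  assumes X: "finite X" "\<And>\<xi>. \<xi> \<in> X \<Longrightarrow> ap_character \<xi>" and \<eta>: "ap_character \<eta>"
  shows "M (\<lambda>x. (\<Sum>\<xi>\<in>X. c \<xi> * \<xi> x) * cnj (\<eta> x)) = (if \<eta> \<in> X then c \<eta> else 0)"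
proof -
  have u: "uc (\<lambda>x. \<xi> x * cnj (\<eta> x))" if "\<xi> \<in> X" for \<xi>
    using ap_characterD(1)[OF X(2)[OF that]] ap_characterD(1)[OF \<eta>] by auto
  have "M (\<lambda>x. (\<Sum>\<xi>\<in>X. c \<xi> * \<xi> x) * cnj (\<eta> x)) = M (\<lambda>x. \<Sum>\<xi>\<in>X. c \<xi> * (\<xi> x * cnj (\<eta> x)))"
    by (simp add: sum_distrib_right mult.assoc)
  also have "\<dots> = (\<Sum>\<xi>\<in>X. c \<xi> * M (\<lambda>x. \<xi> x * cnj (\<eta> x)))"
    using u by (simp add: M_sum M_cmult uc_mult)
  also have "\<dots> = (\<Sum>\<xi>\<in>X. if \<eta> = \<xi> then c \<xi> else 0)"
    by (intro sum.cong refl) (use ap_character_orthogonal[OF X(2) \<eta>] ap_characterD(4)[OF \<eta>] in auto)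
  also have "\<dots> = (if \<eta> \<in> X then c \<eta> else 0)" using X by simp
  finally show ?thesis .
qed

lemma uc_trig_sum:
  assumes "\<And>\<xi>. \<xi> \<in> X \<Longrightarrow> ap_character \<xi>"
  shows "uc (\<lambda>x. \<Sum>\<xi>\<in>X. c \<xi> * \<xi> x)"
  by (intro uc_sum uc_mult uc_const) (use ap_characterD assms in auto)

lemma sq_diff_character:
  assumes f: "uc f" and \<xi>: "ap_character \<xi>" and c: "c = M (\<lambda>x. f x * cnj (\<xi> x))"
  shows "sq (\<lambda>x. f x - c * \<xi> x) = sq f - (norm c)\<^sup>2"
proof -
  note [simp] = ap_characterD[OF \<xi>]
  have u: "uc (\<lambda>x. f x * cnj (\<xi> x))" "uc (\<lambda>x. cnj (f x * cnj (\<xi> x)))" "uc (\<lambda>x. f x * cnj (f x))"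
    by (intro uc_mult uc_cnj f ap_characterD[OF \<xi>])+
  have u2: "uc (\<lambda>x. f x - c * \<xi> x)" by (intro uc_diff uc_mult uc_const f ap_characterD[OF \<xi>])
  have "complex_of_real (sq (\<lambda>x. f x - c * \<xi> x)) = M (\<lambda>x. (f x - c * \<xi> x) * cnj (f x - c * \<xi> x))"
    by (rule of_real_sq[OF u2])
  also have "\<dots> = M (\<lambda>x. (f x * cnj (f x) + c * cnj c) - (cnj c * (f x * cnj (\<xi> x)) + c * cnj (f x * cnj (\<xi> x))))"
  proof (rule arg_cong[of _ _ M], rule ext)
    fix x
    have "(f x - c * \<xi> x) * cnj (f x - c * \<xi> x) =
      (f x * cnj (f x) + c * cnj c * (\<xi> x * cnj (\<xi> x))) - (cnj c * (f x * cnj (\<xi> x)) + c * cnj (f x * cnj (\<xi> x)))"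
      by (simp del: ap_characterD(4) add: algebra_simps)
    then show "(f x - c * \<xi> x) * cnj (f x - c * \<xi> x) =
      (f x * cnj (f x) + c * cnj c) - (cnj c * (f x * cnj (\<xi> x)) + c * cnj (f x * cnj (\<xi> x)))"
      by simp
  qed
  also have "\<dots> = (M (\<lambda>x. f x * cnj (f x)) + c * cnj c)
      - (cnj c * M (\<lambda>x. f x * cnj (\<xi> x)) + c * M (\<lambda>x. cnj (f x * cnj (\<xi> x))))"
    using u by (simp only: M_add M_diff M_cmult M_const uc_add uc_mult uc_const)
  also have "\<dots> = complex_of_real (sq f - (norm c)\<^sup>2)"
    unfolding M_cnj[OF u(1)] c[symmetric] of_real_diff of_real_sq[OF f] complex_norm_square
    by (simp add: mult.commute)
  finally show ?thesis by (simp only: of_real_eq_iff)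
qed

text \<open>Each projection that is subtracted lowers \<open>sq\<close> by the squared modulus of
  its coefficient, and by orthogonality the coefficient at a new character is not affected by the
  earlier subtractions.\<close>

lemma bessel:
  assumes k: "uc k" and X: "finite X" "\<And>\<xi>. \<xi> \<in> X \<Longrightarrow> ap_character \<xi>"
  shows "(\<Sum>\<xi>\<in>X. (norm (M (\<lambda>x. k x * cnj (\<xi> x))))\<^sup>2) \<le> sq k"
proof -
  define c where "c = (\<lambda>\<xi>. M (\<lambda>x. k x * cnj (\<xi> x)))"
  have "sq (\<lambda>x. k x - (\<Sum>\<xi>\<in>X. c \<xi> * \<xi> x)) = sq k - (\<Sum>\<xi>\<in>X. (norm (c \<xi>))\<^sup>2)"
    using X
  proof (induction X rule: finite_induct)
    case (insert \<eta> X)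
    have \<eta>: "ap_character \<eta>" using insert by auto
    define f where "f = (\<lambda>x. k x - (\<Sum>\<xi>\<in>X. c \<xi> * \<xi> x))"
    have uS: "uc (\<lambda>x. \<Sum>\<xi>\<in>X. c \<xi> * \<xi> x)" by (rule uc_trig_sum) (use insert in auto)
    have f: "uc f" unfolding f_def by (intro uc_diff k uS)
    have "M (\<lambda>x. f x * cnj (\<eta> x)) = M (\<lambda>x. k x * cnj (\<eta> x)) - M (\<lambda>x. (\<Sum>\<xi>\<in>X. c \<xi> * \<xi> x) * cnj (\<eta> x))"
      unfolding f_def left_diff_distrib
      by (intro M_diff uc_mult k uS uc_cnj ap_characterD[OF \<eta>])
    also have "\<dots> = c \<eta>"
      using coefficient_sum[of X \<eta> c] insert \<eta> by (simp add: c_def)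
    finally have "sq (\<lambda>x. f x - c \<eta> * \<eta> x) = sq f - (norm (c \<eta>))\<^sup>2"
      by (intro sq_diff_character f \<eta>) simp
    moreover have "(\<lambda>x. f x - c \<eta> * \<eta> x) = (\<lambda>x. k x - (\<Sum>\<xi>\<in>insert \<eta> X. c \<xi> * \<xi> x))"
      using insert by (auto simp: f_def)
    ultimately show ?case using insert by (simp add: f_def)
  qed simp
  moreover have "0 \<le> sq (\<lambda>x. k x - (\<Sum>\<xi>\<in>X. c \<xi> * \<xi> x))"
    by (intro sq_nonneg uc_diff k uc_trig_sum X)
  ultimately show ?thesis by (simp add: c_def)
qed

text \<open>\<open>mean_fubini\<close> moves the convolution onto the character, where
  \<open>conv_ap_character\<close> evaluates it. The coefficients are thus nonnegative, and
  \<open>bessel\<close> makes them summable; for \<open>k\<close> itself it gives only square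
  summability.\<close>

lemma acorr_coefficient:
  assumes k: "uc k" and \<xi>: "ap_character \<xi>"
  shows "M (\<lambda>x. acorr k x * cnj (\<xi> x)) = of_real ((norm (M (\<lambda>x. k x * cnj (\<xi> x))))\<^sup>2)"
proof -
  note u = ap_characterD(1)[OF \<xi>]
  have uk: "uc (\<lambda>x. k x * cnj (\<xi> x))" by (intro uc_mult k uc_cnj u)
  have "M (\<lambda>x. acorr k x * cnj (\<xi> x)) = M (\<lambda>x. cnj (\<xi> x) * conv k (\<lambda>s. cnj (k s)) x)"
    by (simp add: acorr_def mult.commute)
  also have "\<dots> = M (\<lambda>x. cnj (k x) * conv k (\<lambda>s. cnj (\<xi> s)) x)"
    by (rule mean_fubini) (intro k uc_cnj u)+
  also have "\<dots> = M (\<lambda>x. M (\<lambda>s. k s * cnj (\<xi> s)) * cnj (k x * cnj (\<xi> x)))"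
    by (simp add: conv_ap_character[OF k \<xi>] mult_ac)
  also have "\<dots> = M (\<lambda>s. k s * cnj (\<xi> s)) * cnj (M (\<lambda>x. k x * cnj (\<xi> x)))"
    unfolding M_cnj[OF uk, symmetric] by (rule M_cmult[OF uc_cnj[OF uk]])
  finally show ?thesis by (simp only: complex_norm_square)
qed

text \<open>The coefficients are absolutely summable, so the Fourier series converges uniformly to
  some \<open>w\<close>. The coefficients of \<open>w\<close> agree with those of
  \<open>acorr k\<close>, and by \<open>exists_character\<close> a \<open>uc\<close> function whose
  coefficients all vanish is zero; hence \<open>acorr k = w\<close>.\<close>

theorem acorr_approximation:
  assumes k: "uc k" and "e > 0"
  obtains X c where "finite X" "\<And>\<xi>. \<xi> \<in> X \<Longrightarrow> ap_character \<xi>"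
    "\<And>x. norm (acorr k x - (\<Sum>\<xi>\<in>X. c \<xi> * \<xi> x)) \<le> e"
proof -
  define C where "C = Collect ap_character"
  define d where "d = (\<lambda>\<xi>. (norm (M (\<lambda>x. k x * cnj (\<xi> x))))\<^sup>2)"
  have d: "d summable_on C"
  proof (rule nonneg_bdd_above_summable_on)
    show "bdd_above (sum d ` {F. F \<subseteq> C \<and> finite F})"
      by (rule bdd_aboveI2[of _ _ "sq k"]) (use bessel[OF k] in \<open>auto simp: C_def d_def\<close>)
  qed (auto simp: d_def)
  define w where "w = (\<lambda>x. infsum (\<lambda>\<xi>. of_real (d \<xi>) * \<xi> x) C)"
  define S where "S = (\<lambda>X x. \<Sum>\<xi>\<in>X. of_real (d \<xi>) * \<xi> x)"
  have tail: "norm (w x - S X x) \<le> e"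
    if X: "finite X" "X \<subseteq> C" "dist (sum d X) (infsum d C) \<le> e" for X e x
  proof -
    have nd: "norm (of_real (d \<xi>) * \<xi> x) = d \<xi>" if "\<xi> \<in> C" for \<xi>
      using that ap_characterD(2) by (simp add: norm_mult C_def d_def del: of_real_power)
    have as: "(\<lambda>\<xi>. norm (of_real (d \<xi>) * \<xi> x)) summable_on C"
      using d summable_on_cong[of C "\<lambda>\<xi>. norm (of_real (d \<xi>) * \<xi> x)" d] nd by simp
    have "w x - S X x = infsum (\<lambda>\<xi>. of_real (d \<xi>) * \<xi> x) (C - X)"
      unfolding w_def S_def infsum_finite[OF X(1), symmetric]
      by (rule infsum_Diff[symmetric]) (use X abs_summable_summable[OF as] in auto)
    also have "norm \<dots> \<le> infsum (\<lambda>\<xi>. norm (of_real (d \<xi>) * \<xi> x)) (C - X)"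
      by (rule norm_infsum_bound, rule summable_on_subset_banach[OF as]) auto
    also have "\<dots> = infsum d (C - X)" by (rule infsum_cong) (use nd in auto)
    also have "\<dots> = infsum d C - sum d X"
      using infsum_Diff[OF d summable_on_finite[OF X(1)] X(2)] X(1) by simp
    also have "\<dots> \<le> e" using X(3) by (simp add: dist_real_def)
    finally show ?thesis .
  qed
  \<comment> \<open>The freedom to enlarge the partial sum by \<open>Y\<close> is used to include a
    prescribed character, whose coefficient in the partial sum is then exact.\<close>
  have app: "\<exists>X. finite X \<and> Y \<subseteq> X \<and> X \<subseteq> C \<and> (\<forall>x. norm (w x - S X x) \<le> e)"
    if e: "e > 0" and Y: "finite Y" "Y \<subseteq> C" for e Y
  proof -
    obtain F where F: "finite F" "F \<subseteq> C" "dist (sum d F) (infsum d C) \<le> e"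
      using infsum_finite_approximation[OF d e] by blast
    have "sum d F \<le> sum d (F \<union> Y)" using F Y by (intro sum_mono2) (auto simp: d_def)
    moreover have "sum d (F \<union> Y) \<le> infsum d C"
      using F Y d by (intro finite_sum_le_infsum) (auto simp: d_def)
    ultimately have "dist (sum d (F \<union> Y)) (infsum d C) \<le> e"
      using F(3) by (simp add: dist_real_def)
    then show ?thesis using F Y tail[of "F \<union> Y" e] by (intro exI[of _ "F \<union> Y"]) auto
  qed
  have ucS: "uc (S X)" if "X \<subseteq> C" for X
    unfolding S_def by (rule uc_trig_sum) (use that C_def in auto)
  have ucw: "uc w"
  proof (rule uc_limit)
    fix e :: real assume "e > 0"
    then obtain X where "X \<subseteq> C" "\<forall>x. norm (w x - S X x) \<le> e" using app[of e "{}"] by auto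
    then show "\<exists>g. uc g \<and> (\<forall>x. norm (w x - g x) \<le> e)" using ucS by blast
  qed
  have coeff: "M (\<lambda>x. w x * cnj (\<xi> x)) = of_real (d \<xi>)" if \<xi>: "ap_character \<xi>" for \<xi>
  proof -
    note u = ap_characterD(1)[OF \<xi>]
    have "norm (M (\<lambda>x. w x * cnj (\<xi> x)) - of_real (d \<xi>)) \<le> e" if e: "e > 0" for e
    proof -
      obtain X where X: "finite X" "{\<xi>} \<subseteq> X" "X \<subseteq> C" "\<And>x. norm (w x - S X x) \<le> e"
        using app[OF e, of "{\<xi>}"] \<xi> by (auto simp: C_def)
      have "of_real (d \<xi>) = M (\<lambda>x. S X x * cnj (\<xi> x))"
        unfolding S_def by (subst coefficient_sum[OF X(1) _ \<xi>]) (use X C_def in auto)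
      also have "norm (M (\<lambda>x. w x * cnj (\<xi> x)) - \<dots>) \<le> e"
      proof (rule M_diff_bound)
        fix x show "norm (w x * cnj (\<xi> x) - S X x * cnj (\<xi> x)) \<le> e"
          using X(4)[of x] ap_characterD(2)[OF \<xi>, of x]
          by (simp add: norm_mult flip: left_diff_distrib)
      qed (intro uc_mult uc_cnj u ucw ucS X)+
      finally show ?thesis .
    qed
    then have "norm (M (\<lambda>x. w x * cnj (\<xi> x)) - of_real (d \<xi>)) \<le> 0" by (rule dense_ge)
    then show ?thesis by simp
  qed
  have "acorr k x = w x" for x
  proof (rule ccontr)
    assume "acorr k x \<noteq> w x"
    moreover have u: "uc (\<lambda>x. acorr k x - w x)" by (intro uc_diff ucw uc_acorr k)
    ultimately obtain \<xi> where \<xi>: "ap_character \<xi>" "M (\<lambda>x. (acorr k x - w x) * cnj (\<xi> x)) \<noteq> 0"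
      using exists_character[OF u, of x] by auto
    note u' = ap_characterD(1)[OF \<xi>(1)]
    have "M (\<lambda>x. (acorr k x - w x) * cnj (\<xi> x)) = M (\<lambda>x. acorr k x * cnj (\<xi> x)) - M (\<lambda>x. w x * cnj (\<xi> x))"
      unfolding left_diff_distrib by (intro M_diff uc_mult uc_cnj ucw uc_acorr k u')
    with \<xi>(2) show False using coeff[OF \<xi>(1)] acorr_coefficient[OF k \<xi>(1)] by (simp add: d_def)
  qed
  then show ?thesis
    using app[OF assms(2), of "{}"] that[of _ "\<lambda>\<xi>. of_real (d \<xi>)"] by (auto simp: S_def C_def)
qed

end

section \<open>Haar measure and local \<open>L\<^sup>p\<close> bounds\<close>

text \<open>Convexity on the open half-line settles positive \<open>u\<close> and \<open>v\<close>.
  When one of them is 0, the inequality reduces to \<open>r powr p \<le> r\<close> for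
  \<open>r\<close> in the unit interval.\<close>

lemma powr_convex_combination:
  fixes s u v p :: real
  assumes p: "1 \<le> p" and s: "0 \<le> s" "s \<le> 1" and u: "0 \<le> u" and v: "0 \<le> v"
  shows "(s * u + (1 - s) * v) powr p \<le> s * u powr p + (1 - s) * v powr p"
proof -
  have le: "r powr p \<le> r" if "0 \<le> r" "r \<le> 1" for r
    using powr_mono'[of 1 p r] that p by auto
  have 0: "(r * w) powr p \<le> r * w powr p" if "0 \<le> r" "r \<le> 1" "0 \<le> w" for r w
    using le[OF that(1,2)] that by (simp add: powr_mult mult_right_mono)
  show ?thesis
  proof (cases "u = 0 \<or> v = 0")
    case True
    then show ?thesis using 0[of s u] 0[of "1 - s" v] s u v p by auto
  next
    case False
    then have "u \<in> {0<..}" "v \<in> {0<..}" using u v by auto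
    from convex_onD[OF powr_convex[OF p], of "1 - s" u v] this s show ?thesis by simp
  qed
qed

text \<open>Convexity for \<open>x / a\<close> and \<open>y / b\<close> with weights
  \<open>a / (a + b)\<close> and \<open>b / (a + b)\<close>. If \<open>a\<close> and
  \<open>b\<close> bound the norms of two functions, integration of this estimate gives Minkowski's
  inequality directly, without Hoelder's.\<close>

lemma minkowski_pointwise:
  fixes x y a b p :: real
  assumes p: "1 \<le> p" and ab: "0 < a" "0 < b" and xy: "0 \<le> x" "0 \<le> y"
  shows "(x + y) powr p \<le> (a + b) powr p * (a / (a + b) * a powr (- p) * x powr p + b / (a + b) * b powr (- p) * y powr p)"
proof -
  define s where "s = a / (a + b)"
  have s: "0 \<le> s" "s \<le> 1" "1 - s = b / (a + b)" using ab by (auto simp: s_def field_simps)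
  have "x + y = (a + b) * (s * (x / a) + (1 - s) * (y / b))"
  proof -
    have "s * (x / a) = x / (a + b)" "(1 - s) * (y / b) = y / (a + b)"
      unfolding s(3) using ab by (simp_all add: s_def)
    moreover have "a + b \<noteq> 0" using ab by simp
    ultimately show ?thesis by (simp add: distrib_left)
  qed
  then have "(x + y) powr p = (a + b) powr p * (s * (x / a) + (1 - s) * (y / b)) powr p"
    using ab xy s by (metis powr_mult)
  also have "\<dots> \<le> (a + b) powr p * (s * (x / a) powr p + (1 - s) * (y / b) powr p)"
    using ab xy s p by (intro mult_left_mono powr_convex_combination) auto
  also have "\<dots> = (a + b) powr p * (a / (a + b) * a powr (- p) * x powr p + b / (a + b) * b powr (- p) * y powr p)"
    unfolding s(3) using ab xy by (simp add: s_def powr_divide powr_minus field_simps)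
  finally show ?thesis .
qed

lemma disjoint_refinement:
  assumes "finite T" "\<And>t. t \<in> T \<Longrightarrow> C t \<in> sets N"
  shows "\<exists>E. (\<forall>t\<in>T. E t \<in> sets N \<and> E t \<subseteq> C t) \<and> disjoint_family_on E T \<and> (\<Union>t\<in>T. E t) = (\<Union>t\<in>T. C t)"
  using assms
proof (induction T rule: finite_induct)
  case (insert t T)
  then obtain E where E: "\<And>t. t \<in> T \<Longrightarrow> E t \<in> sets N \<and> E t \<subseteq> C t" "disjoint_family_on E T"
    "(\<Union>t\<in>T. E t) = (\<Union>t\<in>T. C t)" by auto
  define E' where "E' = E(t := C t - (\<Union>s\<in>T. E s))"
  have *: "E' s = E s" if "s \<in> T" for s using that insert.hyps by (auto simp: E'_def)
  have t: "E' t = C t - (\<Union>s\<in>T. E s)" by (simp add: E'_def)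
  have "(\<Union>s\<in>T. E s) \<in> sets N" using E insert.hyps by (intro sets.finite_UN) auto
  then have "\<forall>s\<in>insert t T. E' s \<in> sets N \<and> E' s \<subseteq> C s"
    using E(1) * t insert.prems by (auto simp del: UN_simps)
  moreover have "disjoint_family_on E' (insert t T)"
    using E(2) * t insert.hyps unfolding disjoint_family_on_def by (auto simp del: UN_simps)
  moreover have "(\<Union>s\<in>insert t T. E' s) = (\<Union>s\<in>insert t T. C s)"
  proof -
    have "(\<Union>s\<in>T. E' s) = (\<Union>s\<in>T. C s)" using * E(3) by simp
    then show ?thesis using t E(3) by auto
  qed
  ultimately show ?case by blast
qed (auto simp: disjoint_family_on_def)

text \<open>The tube lemma for the preimage of \<open>W\<close> under addition, around
  \<open>{0} \<times> K\<close>: compactness provides one neighbourhood of 0 that serves all points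
  of \<open>K\<close>.\<close>

lemma compact_add_neighbourhood:
  fixes K :: "'a::topological_ab_group_add set"
  assumes "compact K" "open W" "K \<subseteq> W"
  obtains U where "open U" "0 \<in> U" "\<And>k u. k \<in> K \<Longrightarrow> u \<in> U \<Longrightarrow> k + u \<in> W"
proof -
  have o: "open ((\<lambda>z. snd z + fst z) -` W)"
    using assms(2) by (intro open_vimage continuous_intros) auto
  have i: "{0} \<times> K \<subseteq> (\<lambda>z. snd z + fst z) -` W" using assms(3) by auto
  obtain X0 where "0 \<in> X0" "open X0" "X0 \<times> K \<subseteq> (\<lambda>z. snd z + fst z) -` W"
    using Elementary_Topology.tube_lemma[OF assms(1) o i] by blast
  then show ?thesis by (intro that[of X0]) auto
qed

lemma continuous_on_add_const: "continuous_on UNIV ((+) (t::'a::topological_ab_group_add))"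
  by (rule continuous_on_add[OF continuous_on_const continuous_on_id])

lemma image_add_eq_vimage: "(+) t ` (B :: 'a::ab_group_add set) = (+) (- t) -` B"
  by (force simp: image_iff intro: bexI[of _ "- t + _"])

lemma open_image_add: "open B \<Longrightarrow> open ((+) (t::'a::topological_ab_group_add) ` B)"
  unfolding image_add_eq_vimage by (rule open_vimage[OF _ continuous_on_add_const])

lemma compact_image_add: "compact B \<Longrightarrow> compact ((+) (t::'a::topological_ab_group_add) ` B)"
  by (rule compact_continuous_image[OF continuous_on_subset[OF continuous_on_add_const]]) auto

lemma borel_image_add: "B \<in> sets borel \<Longrightarrow> (+) (t::'a::topological_ab_group_add) ` B \<in> sets borel"
  unfolding image_add_eq_vimage
  using measurable_sets[OF borel_measurable_continuous_onI[OF continuous_on_add_const], of B "- t"] by simp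

lemma measurable_shift:
  assumes "f \<in> borel_measurable borel"
  shows "(\<lambda>x. f (x + (t::'a::topological_ab_group_add))) \<in> borel_measurable borel"
  by (rule measurable_compose[OF borel_measurable_continuous_onI assms])
    (rule continuous_on_add[OF continuous_on_id continuous_on_const])

lemma measurable_shift_minus:
  assumes "f \<in> borel_measurable borel"
  shows "(\<lambda>x. f (x - (t::'a::topological_ab_group_add))) \<in> borel_measurable borel"
  using measurable_shift[OF assms, of "- t"] by simp

lemma compact_set_plus:
  fixes A B :: "'a::topological_ab_group_add set"
  assumes "compact A" "compact B"
  shows "compact {a + b | a b. a \<in> A \<and> b \<in> B}"
proof -
  have "{a + b | a b. a \<in> A \<and> b \<in> B} = (\<lambda>z. fst z + snd z) ` (A \<times> B)" by force
  then show ?thesis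
    by (simp only:) (intro compact_continuous_image compact_Times assms continuous_intros)
qed

lemma compact_set_minus:
  fixes A B :: "'a::topological_ab_group_add set"
  assumes "compact A" "compact B"
  shows "compact {a - b | a b. a \<in> A \<and> b \<in> B}"
proof -
  have "{a - b | a b. a \<in> A \<and> b \<in> B} = (\<lambda>z. fst z - snd z) ` (A \<times> B)" by force
  then show ?thesis
    by (simp only:) (intro compact_continuous_image compact_Times assms continuous_intros)
qed

section \<open>Haar measure on a locally compact Abelian group\<close>

locale haar_space =
  fixes \<theta> :: "'a::{topological_ab_group_add, t2_space} measure"
  assumes loc_compact: "locally_compact_space (euclidean :: 'a topology)"
    and haar: "haar_measure \<theta>"
begin

lemma sets_theta [simp, measurable_cong]: "sets \<theta> = sets borel"
  using haar by (simp add: haar_measure_def)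

lemma space_theta [simp]: "space \<theta> = UNIV"
  using sets_eq_imp_space_eq[OF sets_theta] by simp

lemma compact_sets: "compact K \<Longrightarrow> K \<in> sets \<theta>"
  by (simp add: compact_imp_closed)

lemma open_sets: "open K \<Longrightarrow> K \<in> sets \<theta>"
  by simp

lemma emeasure_compact: "compact K \<Longrightarrow> emeasure \<theta> K < \<infinity>"
  using haar by (simp add: haar_measure_def)

lemma emeasure_precompact:
  assumes "compact (closure V)" shows "emeasure \<theta> V < \<infinity>"
  using emeasure_mono[OF closure_subset compact_sets[OF assms]] emeasure_compact[OF assms]
  by (rule le_less_trans)

lemma emeasure_image_add: "B \<in> sets borel \<Longrightarrow> emeasure \<theta> ((+) t ` B) = emeasure \<theta> B"
  using haar by (simp add: haar_measure_def)

lemma outer_regular: "B \<in> sets borel \<Longrightarrow> emeasure \<theta> B = (INF U\<in>{U. open U \<and> B \<subseteq> U}. emeasure \<theta> U)"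
  using haar unfolding haar_measure_def by blast

lemma inner_regular: "open U \<Longrightarrow> emeasure \<theta> U = (SUP K\<in>{K. compact K \<and> K \<subseteq> U}. emeasure \<theta> K)"
  using haar unfolding haar_measure_def by blast

text \<open>If \<open>V\<close> were null, every compact set would be null as well, being covered by
  finitely many translates of \<open>V\<close>, and inner regularity of the whole group would make
  the measure zero.\<close>

lemma emeasure_open_pos:
  assumes "open V" "V \<noteq> {}" shows "0 < emeasure \<theta> V"
proof (rule ccontr)
  assume "\<not> ?thesis"
  then have V0: "emeasure \<theta> V = 0" by simp
  obtain v where v: "v \<in> V" using assms by auto
  have "emeasure \<theta> K = 0" if "compact K" for K
  proof -
    have "K \<subseteq> \<Union> ((\<lambda>t. (+) t ` V) ` UNIV)"
      using v by (auto simp: image_iff) (metis diff_add_cancel)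
    then obtain F where F: "finite F" "K \<subseteq> (\<Union>t\<in>F. (+) t ` V)"
      using compactE_image[OF \<open>compact K\<close>, of UNIV "\<lambda>t. (+) t ` V"] open_image_add[OF assms(1)] by auto
    have "emeasure \<theta> (\<Union>t\<in>F. (+) t ` V) \<le> (\<Sum>t\<in>F. emeasure \<theta> ((+) t ` V))"
      using F(1) open_image_add[OF assms(1)] by (intro emeasure_subadditive_finite) auto
    also have "\<dots> = 0" using assms(1) V0 by (simp add: emeasure_image_add)
    finally show ?thesis
      using emeasure_mono[OF F(2), of \<theta>] open_UN[of F "\<lambda>t. (+) t ` V"] open_image_add[OF assms(1)]
      by (metis le_zero_eq open_sets)
  qed
  then have "emeasure \<theta> UNIV \<le> 0" unfolding inner_regular[OF open_UNIV] by (intro SUP_least) simp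
  then show False using haar by (simp add: haar_measure_def)
qed

lemma measurable_add_const: "(+) t \<in> borel \<rightarrow>\<^sub>M (borel :: 'a measure)"
  by (rule borel_measurable_continuous_onI[OF continuous_on_add_const])

lemma distr_add: "distr \<theta> borel ((+) t) = \<theta>"
proof (rule measure_eqI)
  note [measurable] = measurable_add_const
  fix B assume "B \<in> sets (distr \<theta> borel ((+) t))"
  then have B [measurable]: "B \<in> sets borel" by simp
  have "emeasure (distr \<theta> borel ((+) t)) B = emeasure \<theta> ((+) t -` B)"
    by (subst emeasure_distr) auto
  also have "(+) t -` B = (+) (- t) ` B" unfolding image_add_eq_vimage by simp
  finally show "emeasure (distr \<theta> borel ((+) t)) B = emeasure \<theta> B"
    by (simp only: emeasure_image_add[OF B])
qed simp

lemma nn_integral_shift: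
  assumes [measurable]: "f \<in> borel_measurable borel"
  shows "(\<integral>\<^sup>+x. f (t + x) \<partial>\<theta>) = (\<integral>\<^sup>+x. f x \<partial>\<theta>)"
proof -
  note [measurable] = measurable_add_const
  have "(\<integral>\<^sup>+x. f x \<partial>\<theta>) = (\<integral>\<^sup>+x. f x \<partial>(distr \<theta> borel ((+) t)))" by (simp add: distr_add)
  also have "\<dots> = (\<integral>\<^sup>+x. f (t + x) \<partial>\<theta>)" by (rule nn_integral_distr) auto
  finally show ?thesis by simp
qed

lemma nn_set_integral_shift:
  assumes f: "f \<in> borel_measurable borel" and B: "B \<in> sets borel"
  shows "(\<integral>\<^sup>+x\<in>(+) t ` B. f x \<partial>\<theta>) = (\<integral>\<^sup>+x\<in>B. f (x + t) \<partial>\<theta>)"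
proof -
  have [measurable]: "(+) t ` B \<in> sets borel" by (rule borel_image_add[OF B])
  have "(\<integral>\<^sup>+x\<in>(+) t ` B. f x \<partial>\<theta>) = (\<integral>\<^sup>+x. f (t + x) * indicator ((+) t ` B) (t + x) \<partial>\<theta>)"
    by (subst nn_integral_shift[symmetric, where t = t]) (use f in auto)
  also have "\<dots> = (\<integral>\<^sup>+x\<in>B. f (x + t) \<partial>\<theta>)"
    by (intro nn_integral_cong) (auto simp: indicator_def add.commute)
  finally show ?thesis .
qed

lemma precompact_neighbourhood:
  obtains U :: "'a set" where "open U" "0 \<in> U" "compact (closure U)"
proof -
  have "\<exists>U. open U \<and> (\<exists>K. compact K \<and> (0::'a) \<in> U \<and> U \<subseteq> K)"
    using loc_compact by (simp add: locally_compact_space_def)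
  then obtain U K :: "'a set" where "open U" "compact K" "0 \<in> U" "U \<subseteq> K"
    by blast
  moreover from this have "K \<inter> closure U = closure U"
    using closure_minimal[OF \<open>U \<subseteq> K\<close>] compact_imp_closed by blast
  ultimately show ?thesis
    using compact_Int_closed[of K "closure U"] by (intro that[of U]) auto
qed

end

section \<open>Norm inequalities in L^p and Stepanov bounds\<close>

locale haar_Lp = haar_space +
  fixes p :: real
  assumes p_ge: "1 \<le> p"
begin

lemma p_pos: "p > 0" "p \<noteq> 0" using p_ge by auto

definition pint :: "'a set \<Rightarrow> ('a \<Rightarrow> complex) \<Rightarrow> ennreal" where
  "pint B g = (\<integral>\<^sup>+x\<in>B. ennreal (norm (g x) powr p) \<partial>\<theta>)"

text \<open>
  Norms are handled through the relation ``the norm is at most the real number \<open>c\<close>'', so that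
  no arithmetic with infinite norms occurs.
\<close>

definition Lp_le :: "'a set \<Rightarrow> ('a \<Rightarrow> complex) \<Rightarrow> real \<Rightarrow> bool" where
  "Lp_le B g c \<longleftrightarrow> 0 \<le> c \<and> pint B g \<le> ennreal (c powr p)"

lemma Lp_le_mono: "Lp_le B g c \<Longrightarrow> c \<le> d \<Longrightarrow> Lp_le B g d"
  unfolding Lp_le_def using powr_mono2[of p c d] p_pos by (meson ennreal_leI less_imp_le order_trans)

lemma Lp_le_nonneg: "Lp_le B g c \<Longrightarrow> 0 \<le> c"
  by (simp add: Lp_le_def)

lemma Lp_le_dominated:
  assumes "Lp_le C h c" "B \<subseteq> C" "\<And>x. x \<in> B \<Longrightarrow> norm (g x) \<le> norm (h x)"
  shows "Lp_le B g c"
proof -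
  have "pint B g \<le> pint C h"
    unfolding pint_def
    using assms(2,3) p_pos by (intro nn_integral_mono) (auto simp: indicator_def intro!: ennreal_leI powr_mono2)
  then show ?thesis using assms(1) by (auto simp: Lp_le_def)
qed

lemma Lp_le_subset: "Lp_le C g c \<Longrightarrow> B \<subseteq> C \<Longrightarrow> Lp_le B g c"
  by (erule Lp_le_dominated) auto

lemma Lp_le_limit:
  assumes "0 \<le> c" "\<And>e. e > 0 \<Longrightarrow> Lp_le B g (c + e)" shows "Lp_le B g c"
proof -
  have "((\<lambda>e. ennreal ((c + e) powr p)) \<longlongrightarrow> ennreal ((c + 0) powr p)) (at_right 0)"
    using p_pos assms(1)
    by (intro tendsto_ennrealI tendsto_powr2 tendsto_intros) (auto simp: eventually_at_right_less intro: eventually_mono[OF eventually_at_right_less])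
  moreover have "\<forall>\<^sub>F e in at_right 0. pint B g \<le> ennreal ((c + e) powr p)"
    using eventually_at_right_less[of "0::real"] by eventually_elim (use assms(2) in \<open>auto simp: Lp_le_def\<close>)
  ultimately have "pint B g \<le> ennreal ((c + 0) powr p)"
    by (intro tendsto_lowerbound) auto
  then show ?thesis using assms(1) by (simp add: Lp_le_def)
qed

lemma Lp_le_add:
  assumes [measurable]: "g \<in> borel_measurable borel" "h \<in> borel_measurable borel" "B \<in> sets borel"
    and a: "Lp_le B g a" and b: "Lp_le B h b"
  shows "Lp_le B (\<lambda>x. g x + h x) (a + b)"
proof (rule Lp_le_limit)
  fix e :: real assume "e > 0"
  \<comment> \<open>\<open>minkowski_pointwise\<close> divides by the bounds, so both are first made
    positive by half of the slack \<open>e\<close>; \<open>Lp_le_limit\<close> removes it.\<close>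
  define a' b' where "a' = a + e / 2" and "b' = b + e / 2"
  have pos: "a' > 0" "b' > 0" using Lp_le_nonneg[OF a] Lp_le_nonneg[OF b] \<open>e > 0\<close> by (auto simp: a'_def b'_def)
  have a': "pint B g \<le> ennreal (a' powr p)" and b': "pint B h \<le> ennreal (b' powr p)"
    using Lp_le_mono[OF a, of a'] Lp_le_mono[OF b, of b'] \<open>e > 0\<close> by (auto simp: Lp_le_def a'_def b'_def)
  define k where "k = (a' + b') powr p"
  define u where "u = a' / (a' + b') * a' powr (- p)"
  define v where "v = b' / (a' + b') * b' powr (- p)"
  have uv: "0 \<le> u" "0 \<le> v" "0 \<le> k" using pos by (auto simp: u_def v_def k_def)
  have "pint B (\<lambda>x. g x + h x) \<le> (\<integral>\<^sup>+x\<in>B. ennreal (k * (u * norm (g x) powr p + v * norm (h x) powr p)) \<partial>\<theta>)"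
    unfolding pint_def
  proof (intro nn_integral_mono mult_right_mono ennreal_leI)
    fix x
    have "norm (g x + h x) powr p \<le> (norm (g x) + norm (h x)) powr p"
      using p_pos by (intro powr_mono2) (auto intro: norm_triangle_ineq)
    also have "\<dots> \<le> k * (u * norm (g x) powr p + v * norm (h x) powr p)"
      unfolding k_def u_def v_def by (rule minkowski_pointwise[OF p_ge pos]) auto
    finally show "norm (g x + h x) powr p \<le> k * (u * norm (g x) powr p + v * norm (h x) powr p)" .
  qed auto
  also have "\<dots> = (\<integral>\<^sup>+x. ennreal k * (ennreal u * (ennreal (norm (g x) powr p) * indicator B x) +
      ennreal v * (ennreal (norm (h x) powr p) * indicator B x)) \<partial>\<theta>)"
    using uv by (intro nn_integral_cong) (auto simp: indicator_def ennreal_mult' distrib_left)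
  also have "\<dots> = ennreal k * (ennreal u * pint B g + ennreal v * pint B h)"
    unfolding pint_def by (simp add: nn_integral_cmult nn_integral_add)
  also have "\<dots> \<le> ennreal k * (ennreal u * ennreal (a' powr p) + ennreal v * ennreal (b' powr p))"
    by (intro mult_left_mono add_mono a' b') auto
  also have "\<dots> = ennreal (k * (u * a' powr p + v * b' powr p))"
    using uv by (simp add: ennreal_mult')
  also have "u * a' powr p + v * b' powr p = 1"
  proof -
    have "a' powr (- p) * a' powr p = 1" "b' powr (- p) * b' powr p = 1"
      using pos by (simp_all flip: powr_add)
    then show ?thesis unfolding u_def v_def mult.assoc using pos by (simp flip: add_divide_distrib)
  qed
  finally have "pint B (\<lambda>x. g x + h x) \<le> ennreal (k * 1)" .
  moreover have "a' + b' = a + b + e" by (simp add: a'_def b'_def)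
  ultimately show "Lp_le B (\<lambda>x. g x + h x) (a + b + e)"
    using pos by (simp add: Lp_le_def k_def)
qed (use a b Lp_le_nonneg in auto)

lemma Lp_le_cmult:
  assumes [measurable]: "g \<in> borel_measurable borel" "B \<in> sets borel" and "Lp_le B g c"
  shows "Lp_le B (\<lambda>x. k * g x) (norm k * c)"
proof -
  have "pint B (\<lambda>x. k * g x) = (\<integral>\<^sup>+x. ennreal (norm k powr p) * (ennreal (norm (g x) powr p) * indicator B x) \<partial>\<theta>)"
    unfolding pint_def by (intro nn_integral_cong) (simp add: norm_mult powr_mult ennreal_mult' mult.assoc)
  also have "\<dots> = ennreal (norm k powr p) * pint B g"
    unfolding pint_def by (rule nn_integral_cmult) auto
  also have "\<dots> \<le> ennreal (norm k powr p) * ennreal (c powr p)"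
    using assms(3) by (intro mult_left_mono) (auto simp: Lp_le_def)
  also have "\<dots> = ennreal ((norm k * c) powr p)"
    using assms(3) by (simp add: Lp_le_def powr_mult ennreal_mult')
  finally show ?thesis using assms(3) by (simp add: Lp_le_def)
qed

lemma Lp_le_sum:
  assumes "finite J" "\<And>j. j \<in> J \<Longrightarrow> g j \<in> borel_measurable borel" "B \<in> sets borel"
    and "\<And>j. j \<in> J \<Longrightarrow> Lp_le B (g j) (b j)"
  shows "Lp_le B (\<lambda>x. \<Sum>j\<in>J. k j * g j x) (\<Sum>j\<in>J. norm (k j) * b j)"
  using assms
proof (induction J rule: finite_induct)
  case empty
  then show ?case using p_pos by (simp add: Lp_le_def pint_def)
next
  case (insert i J)
  then show ?case
    by (auto intro!: Lp_le_add Lp_le_cmult borel_measurable_sum borel_measurable_times)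
qed

lemma Lp_le_minus: "Lp_le B (\<lambda>x. g x - h x) c \<Longrightarrow> Lp_le B (\<lambda>x. h x - g x) c"
  by (erule Lp_le_dominated) (auto simp: norm_minus_commute)

lemma Lp_le_triangle:
  assumes "f \<in> borel_measurable borel" "g \<in> borel_measurable borel" "h \<in> borel_measurable borel" "B \<in> sets borel"
    and "Lp_le B (\<lambda>x. f x - g x) a" "Lp_le B (\<lambda>x. g x - h x) b"
  shows "Lp_le B (\<lambda>x. f x - h x) (a + b)"
  using Lp_le_add[of "\<lambda>x. f x - g x" "\<lambda>x. g x - h x" B a b] assms by simp

lemma Lp_le_const:
  assumes "B \<in> sets borel" "emeasure \<theta> B \<le> ennreal m" "0 \<le> m" "0 \<le> c" "\<And>x. x \<in> B \<Longrightarrow> norm (g x) \<le> c"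
  shows "Lp_le B g (c * m powr (1 / p))"
proof -
  have "pint B g \<le> (\<integral>\<^sup>+x. ennreal (c powr p) * indicator B x \<partial>\<theta>)"
    unfolding pint_def using assms p_pos
    by (intro nn_integral_mono) (auto simp: indicator_def intro!: ennreal_leI powr_mono2)
  also have "\<dots> = ennreal (c powr p) * emeasure \<theta> B"
    using assms by (simp add: nn_integral_cmult_indicator)
  also have "\<dots> \<le> ennreal (c powr p) * ennreal m"
    using assms by (intro mult_left_mono) auto
  also have "\<dots> = ennreal ((c * m powr (1 / p)) powr p)"
    using assms p_pos by (simp add: powr_mult powr_powr ennreal_mult')
  finally show ?thesis using assms by (simp add: Lp_le_def)
qed

lemma Lp_le_shift:
  assumes "g \<in> borel_measurable borel" "B \<in> sets borel"
  shows "Lp_le ((+) t ` B) g c \<longleftrightarrow> Lp_le B (\<lambda>x. g (x + t)) c"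
  unfolding Lp_le_def pint_def
  by (subst nn_set_integral_shift) (use assms in auto)

lemma Lp_le_exists:
  assumes "g \<in> Lp_loc \<theta> p" "compact Q"
  obtains c where "Lp_le Q g c"
proof -
  have fin: "pint Q g < \<infinity>" using assms by (auto simp: Lp_loc_def pint_def)
  define c where "c = enn2real (pint Q g) powr (1 / p)"
  have "pint Q g = ennreal (c powr p)"
    using fin p_pos by (simp add: c_def powr_powr)
  then show ?thesis by (intro that[of c]) (simp add: Lp_le_def c_def)
qed

lemma Lp_loc_measurable: "g \<in> Lp_loc \<theta> p \<Longrightarrow> g \<in> borel_measurable borel"
  by (simp add: Lp_loc_def)

lemma Lp_locI:
  assumes "g \<in> borel_measurable borel" "\<And>Q. compact Q \<Longrightarrow> \<exists>c. Lp_le Q g c"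
  shows "g \<in> Lp_loc \<theta> p"
  using assms unfolding Lp_loc_def Lp_le_def pint_def
  by (auto simp: less_top[symmetric] top_unique) (metis ennreal_less_top le_less_trans top.not_eq_extremum)

text \<open>For nonempty precompact open \<open>A\<close> this is
  \<open>stepanov_norm \<theta> p A g \<le> ennreal c\<close>, as
  \<open>stepanov_norm_le_iff\<close> shows; the factor \<open>1 / emeasure \<theta> A\<close> is
  moved to the right side, where it becomes the real number
  \<open>measure \<theta> A powr (1 / p)\<close>.\<close>

definition stepanov_le :: "'a set \<Rightarrow> ('a \<Rightarrow> complex) \<Rightarrow> real \<Rightarrow> bool" where
  "stepanov_le A g c \<longleftrightarrow> 0 \<le> c \<and> (\<forall>y. Lp_le ((+) y ` A) g (c * measure \<theta> A powr (1 / p)))"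

lemma ennreal_root_le_iff:
  assumes "0 \<le> c" shows "ennreal_root p x \<le> ennreal c \<longleftrightarrow> x \<le> ennreal (c powr p)"
proof (cases x)
  case (real r)
  have "r powr (1 / p) \<le> c \<longleftrightarrow> r \<le> c powr p"
  proof
    assume "r powr (1 / p) \<le> c"
    then have "(r powr (1 / p)) powr p \<le> c powr p" using p_pos by (intro powr_mono2) auto
    then show "r \<le> c powr p" using real p_pos by (simp add: powr_powr)
  next
    assume "r \<le> c powr p"
    then have "r powr (1 / p) \<le> (c powr p) powr (1 / p)" using p_pos real by (intro powr_mono2) auto
    then show "r powr (1 / p) \<le> c" using assms p_pos by (simp add: powr_powr)
  qed
  then show ?thesis using real assms by (simp add: ennreal_root_def ennreal_le_iff)
qed (simp add: ennreal_root_def top_unique)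

lemma stepanov_norm_le_iff:
  assumes A: "open A" "A \<noteq> {}" "compact (closure A)" and c: "0 \<le> c"
  shows "stepanov_norm \<theta> p A g \<le> ennreal c \<longleftrightarrow> stepanov_le A g c"
proof -
  define m where "m = measure \<theta> A"
  have em: "emeasure \<theta> A = ennreal m"
    unfolding m_def using emeasure_precompact[OF A(3)] by (simp add: emeasure_eq_ennreal_measure less_top)
  have m: "m > 0" using emeasure_open_pos[OF A(1,2)] em by (simp add: ennreal_less_zero_iff)
  have "(1 / emeasure \<theta> A) * pint ((+) y ` A) g \<le> ennreal (c powr p)
      \<longleftrightarrow> pint ((+) y ` A) g \<le> ennreal ((c * m powr (1 / p)) powr p)" for y
  proof -
    have "(c * m powr (1 / p)) powr p = m * c powr p"
      using c m p_pos by (simp add: powr_mult powr_powr)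
    moreover have "1 / emeasure \<theta> A = ennreal (1 / m)"
      unfolding em using m by (metis divide_ennreal ennreal_1 zero_le_one)
    moreover have "ennreal (1 / m) * I \<le> ennreal r \<longleftrightarrow> I \<le> ennreal (m * r)" if "r \<ge> 0" for I r
    proof (cases I)
      case (real i)
      then show ?thesis using m that
        by (simp add: ennreal_mult'[symmetric] ennreal_le_iff field_simps)
    qed (use m in \<open>simp add: ennreal_mult_top top_unique\<close>)
    ultimately show ?thesis by simp
  qed
  then show ?thesis
    using c unfolding stepanov_norm_def SUP_le_iff ennreal_root_le_iff[OF c] stepanov_le_def Lp_le_def m_def pint_def
    by simp
qed

end

lemma open_uminus_image:
  fixes V :: "'a::topological_ab_group_add set"
  assumes "open V" shows "open (uminus ` V)"
proof -
  have "uminus ` V = uminus -` V"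
  proof (intro set_eqI iffI)
    fix x assume "x \<in> uminus -` V"
    then show "x \<in> uminus ` V" by (intro image_eqI[of _ _ "- x"]) auto
  qed auto
  then show ?thesis
    using open_vimage[OF assms continuous_on_minus[OF continuous_on_id]] by simp
qed

lemma compact_uminus_image:
  fixes V :: "'a::topological_ab_group_add set"
  assumes "compact V" shows "compact (uminus ` V)"
  by (rule compact_continuous_image[OF continuous_on_minus[OF continuous_on_id] assms])

context haar_Lp
begin

lemma stepanov_le_nonneg: "stepanov_le A g c \<Longrightarrow> 0 \<le> c"
  by (simp add: stepanov_le_def)

lemma stepanov_le_mono: "stepanov_le A g c \<Longrightarrow> c \<le> d \<Longrightarrow> stepanov_le A g d"
  unfolding stepanov_le_def
  by (meson Lp_le_mono mult_right_mono order_trans powr_ge_zero)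

lemma stepanov_le_dominated:
  assumes "stepanov_le A h c" "\<And>x. norm (g x) \<le> norm (h x)" shows "stepanov_le A g c"
  using assms Lp_le_dominated[OF _ order_refl] unfolding stepanov_le_def by blast

lemma stepanov_le_minus: "stepanov_le A (\<lambda>x. g x - h x) c \<Longrightarrow> stepanov_le A (\<lambda>x. h x - g x) c"
  by (erule stepanov_le_dominated) (auto simp: norm_minus_commute)

lemma stepanov_le_add:
  assumes "g \<in> borel_measurable borel" "h \<in> borel_measurable borel" "open A"
    and "stepanov_le A g a" "stepanov_le A h b"
  shows "stepanov_le A (\<lambda>x. g x + h x) (a + b)"
  using assms Lp_le_add[OF assms(1,2) borel_image_add[of A]]
  unfolding stepanov_le_def distrib_right by auto

lemma stepanov_le_triangle:
  assumes "f \<in> borel_measurable borel" "g \<in> borel_measurable borel" "h \<in> borel_measurable borel" "open A"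
    and "stepanov_le A (\<lambda>x. f x - g x) a" "stepanov_le A (\<lambda>x. g x - h x) b"
  shows "stepanov_le A (\<lambda>x. f x - h x) (a + b)"
  using stepanov_le_add[of "\<lambda>x. f x - g x" "\<lambda>x. g x - h x" A a b] assms by simp

lemma stepanov_le_sum:
  assumes "finite J" "\<And>j. j \<in> J \<Longrightarrow> g j \<in> borel_measurable borel" "open A"
    and "\<And>j. j \<in> J \<Longrightarrow> stepanov_le A (g j) (b j)"
  shows "stepanov_le A (\<lambda>x. \<Sum>j\<in>J. k j * g j x) (\<Sum>j\<in>J. norm (k j) * b j)"
proof -
  have "Lp_le ((+) y ` A) (\<lambda>x. \<Sum>j\<in>J. k j * g j x) (\<Sum>j\<in>J. norm (k j) * (b j * measure \<theta> A powr (1 / p)))" for y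
    using assms by (intro Lp_le_sum borel_image_add) (auto simp: stepanov_le_def)
  moreover have "0 \<le> (\<Sum>j\<in>J. norm (k j) * b j)"
    by (intro sum_nonneg mult_nonneg_nonneg norm_ge_zero) (use assms(4) stepanov_le_nonneg in auto)
  ultimately show ?thesis
    unfolding stepanov_le_def by (simp add: sum_distrib_right mult.assoc)
qed

lemma stepanov_le_translate:
  assumes "g \<in> borel_measurable borel" "open A" "stepanov_le A g c"
  shows "stepanov_le A (\<lambda>x. g (x + t)) c"
  unfolding stepanov_le_def
proof (intro conjI allI)
  show "0 \<le> c" using assms stepanov_le_nonneg by blast
  fix y
  have "Lp_le ((+) t ` (+) y ` A) g (c * measure \<theta> A powr (1 / p))"
    using assms(3) unfolding stepanov_le_def by (simp add: image_image flip: add.assoc)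
  then show "Lp_le ((+) y ` A) (\<lambda>x. g (x + t)) (c * measure \<theta> A powr (1 / p))"
    using Lp_le_shift[OF assms(1)] borel_image_add[of A y] assms(2) by auto
qed

lemma stepanov_le_translate_minus:
  assumes "g \<in> borel_measurable borel" "open A" "stepanov_le A g c"
  shows "stepanov_le A (\<lambda>x. g (x - t)) c"
  using stepanov_le_translate[OF assms, of "- t"] by simp

lemma emeasure_eq_measure_precompact:
  "compact (closure A) \<Longrightarrow> emeasure \<theta> A = ennreal (measure \<theta> A)"
  using emeasure_precompact[of A] by (simp add: emeasure_eq_ennreal_measure less_top)

lemma stepanov_le_const:
  assumes "open A" "compact (closure A)" "0 \<le> c" "\<And>x. norm (g x) \<le> c"
  shows "stepanov_le A g c"
  unfolding stepanov_le_def
  using assms by (auto intro!: Lp_le_const borel_image_add simp: emeasure_image_add emeasure_eq_measure_precompact)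

end

section \<open>Comparison of averages over different sets\<close>

context haar_space
begin

text \<open>
  Averaging \<open>h\<close> over translates of \<open>V\<close>.  A finite combination of the indicators of
  \<open>t + V\<close> with total weight \<open>\<theta> B\<close> replaces the convolution of \<open>V\<close> and \<open>B\<close>, so
  that no product measure is needed (\<open>\<theta>\<close> need not be \<open>\<sigma>\<close>-finite).
\<close>

lemma covering_integral_le:
  fixes h :: "'a \<Rightarrow> ennreal"
  assumes h [measurable]: "h \<in> borel_measurable borel"
    and V: "open V" and K: "compact K" "K \<subseteq> V" and B: "compact B" and A: "A \<in> sets borel"
    and AB: "\<And>x k. x \<in> A \<Longrightarrow> k \<in> K \<Longrightarrow> x - k \<in> B"
    and S: "\<And>t. (\<integral>\<^sup>+x\<in>(+) t ` V. h x \<partial>\<theta>) \<le> S"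
  shows "emeasure \<theta> (uminus ` K) * (\<integral>\<^sup>+x\<in>A. h x \<partial>\<theta>) \<le> emeasure \<theta> B * S"
proof -
  note [measurable] = A
  obtain U where U: "open U" "0 \<in> U" "\<And>k u. k \<in> K \<Longrightarrow> u \<in> U \<Longrightarrow> k + u \<in> V"
    using compact_add_neighbourhood[OF K(1) V K(2)] by blast
  have "B \<subseteq> (\<Union>t\<in>UNIV. (+) t ` U)" using U(2) by (force simp: image_iff)
  then obtain T where T: "finite T" "B \<subseteq> (\<Union>t\<in>T. (+) t ` U)"
    using compactE_image[OF B, of UNIV "\<lambda>t. (+) t ` U"] open_image_add[OF U(1)] by auto
  have Bs: "B \<in> sets borel" using compact_sets[OF B] by simp
  \<comment> \<open>The weights will be the measures of disjoint pieces \<open>E t\<close> of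
    \<open>B\<close>, each inside a small translate of \<open>U\<close>; their total is
    \<open>emeasure \<theta> B\<close>.\<close>
  have "\<exists>E. (\<forall>t\<in>T. E t \<in> sets borel \<and> E t \<subseteq> B \<inter> (+) t ` U) \<and> disjoint_family_on E T \<and>
      (\<Union>t\<in>T. E t) = (\<Union>t\<in>T. B \<inter> (+) t ` U)"
    by (rule disjoint_refinement[OF T(1)]) (use Bs open_image_add[OF U(1)] in auto)
  then obtain E where E: "\<And>t. t \<in> T \<Longrightarrow> E t \<in> sets borel" "\<And>t. t \<in> T \<Longrightarrow> E t \<subseteq> B \<inter> (+) t ` U"
    "disjoint_family_on E T" "(\<Union>t\<in>T. E t) = (\<Union>t\<in>T. B \<inter> (+) t ` U)" by metis
  have EB: "(\<Union>t\<in>T. E t) = B" using E(4) T(2) by auto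
  have Vt [measurable]: "(+) t ` V \<in> sets borel" for t using borel_image_add[of V] V by auto
  have uK: "compact (uminus ` K)"
    by (rule compact_continuous_image[OF _ K(1)]) (rule continuous_on_minus[OF continuous_on_id])
  \<comment> \<open>The reflection of \<open>K\<close> translated by \<open>x\<close> lies in
    \<open>B\<close>. A point \<open>x - k\<close> in \<open>E t\<close> has the form
    \<open>t + u\<close> with \<open>u\<close> in \<open>U\<close>, so
    \<open>x = t + (k + u)\<close> belongs to the translate of \<open>V\<close> by \<open>t\<close>.
    Hence the pieces whose translate of \<open>V\<close> contains \<open>x\<close> cover this set,
    and their weights sum to at least its measure.\<close>
  have key: "emeasure \<theta> (uminus ` K) * h x \<le> (\<Sum>t\<in>T. emeasure \<theta> (E t) * (h x * indicator ((+) t ` V) x))"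
    if x: "x \<in> A" for x
  proof -
    define T' where "T' = {t\<in>T. x \<in> (+) t ` V}"
    have T': "finite T'" "T' \<subseteq> T" using T(1) by (auto simp: T'_def)
    have "(+) x ` uminus ` K \<subseteq> (\<Union>t\<in>T'. E t)"
    proof
      fix z assume "z \<in> (+) x ` uminus ` K"
      then obtain k where k: "k \<in> K" "z = x - k" by auto
      then have "z \<in> (\<Union>t\<in>T. E t)" using AB[OF x] EB by auto
      then obtain t where t: "t \<in> T" "z \<in> E t" by auto
      then obtain u where u: "u \<in> U" "z = t + u" using E(2) by blast
      have "x = t + (k + u)" using k u by (simp add: algebra_simps)
      then have "x \<in> (+) t ` V" using U(3)[OF k(1) u(1)] by blast
      then show "z \<in> (\<Union>t\<in>T'. E t)" using t by (auto simp: T'_def)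
    qed
    then have "emeasure \<theta> ((+) x ` uminus ` K) \<le> emeasure \<theta> (\<Union>t\<in>T'. E t)"
      by (rule emeasure_mono) (use T' E(1) in \<open>auto intro!: sets.finite_UN\<close>)
    also have "\<dots> = (\<Sum>t\<in>T'. emeasure \<theta> (E t))"
      using T' E(1,3) by (intro sum_emeasure[symmetric]) (auto intro: disjoint_family_on_mono)
    finally have "emeasure \<theta> (uminus ` K) \<le> (\<Sum>t\<in>T'. emeasure \<theta> (E t))"
      using emeasure_image_add[of "uminus ` K" x] compact_sets[OF uK] by simp
    then have "emeasure \<theta> (uminus ` K) * h x \<le> (\<Sum>t\<in>T'. emeasure \<theta> (E t)) * h x"
      by (rule mult_right_mono) simp
    also have "\<dots> = (\<Sum>t\<in>T'. emeasure \<theta> (E t) * (h x * indicator ((+) t ` V) x))"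
      unfolding sum_distrib_right by (intro sum.cong) (auto simp: T'_def)
    also have "\<dots> \<le> (\<Sum>t\<in>T. emeasure \<theta> (E t) * (h x * indicator ((+) t ` V) x))"
      using T(1) T'(2) by (intro sum_mono2) auto
    finally show ?thesis .
  qed
  have "emeasure \<theta> (uminus ` K) * (\<integral>\<^sup>+x\<in>A. h x \<partial>\<theta>) = (\<integral>\<^sup>+x. emeasure \<theta> (uminus ` K) * (h x * indicator A x) \<partial>\<theta>)"
    by (rule nn_integral_cmult[symmetric]) auto
  also have "\<dots> \<le> (\<integral>\<^sup>+x. (\<Sum>t\<in>T. emeasure \<theta> (E t) * (h x * indicator ((+) t ` V) x)) \<partial>\<theta>)"
    by (intro nn_integral_mono) (use key in \<open>auto simp: indicator_def[of A]\<close>)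
  also have "\<dots> = (\<Sum>t\<in>T. emeasure \<theta> (E t) * (\<integral>\<^sup>+x\<in>(+) t ` V. h x \<partial>\<theta>))"
    by (simp add: nn_integral_sum nn_integral_cmult)
  also have "\<dots> \<le> (\<Sum>t\<in>T. emeasure \<theta> (E t) * S)"
    by (intro sum_mono mult_left_mono S) auto
  also have "\<dots> = emeasure \<theta> (\<Union>t\<in>T. E t) * S"
    unfolding sum_distrib_right[symmetric]
    by (subst sum_emeasure) (use T(1) E in auto)
  also have "(\<Union>t\<in>T. E t) = B" by (rule EB)
  finally show ?thesis .
qed

end

locale van_hove = haar_space \<theta> for \<theta> :: "'a::{topological_ab_group_add, t2_space} measure" +
  fixes A :: "nat \<Rightarrow> 'a set"
  assumes van_hove: "van_hove_sequence \<theta> A"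
begin

lemma A_open [simp]: "open (A n)" and A_precompact: "compact (closure (A n))" and A_nonempty: "A n \<noteq> {}"
  using van_hove by (auto simp: van_hove_sequence_def)

lemma A_pos: "0 < measure \<theta> (A n)"
  and A_emeasure: "emeasure \<theta> (A n) = ennreal (measure \<theta> (A n))"
proof -
  show "emeasure \<theta> (A n) = ennreal (measure \<theta> (A n))"
    using emeasure_precompact[OF A_precompact] by (simp add: emeasure_eq_ennreal_measure less_top)
  then show "0 < measure \<theta> (A n)"
    using emeasure_open_pos[OF A_open A_nonempty, of n] by (simp add: ennreal_less_zero_iff)
qed

lemma boundary_small:
  assumes "compact K" "0 < e"
  shows "\<forall>\<^sub>F n in sequentially. emeasure \<theta> (van_hove_boundary K (A n)) \<le> ennreal (e * measure \<theta> (A n))"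
proof -
  have "(\<lambda>n. emeasure \<theta> (van_hove_boundary K (A n)) / emeasure \<theta> (A n)) \<longlonglongrightarrow> 0"
    using van_hove assms(1) by (auto simp: van_hove_sequence_def)
  then have "\<forall>\<^sub>F n in sequentially. emeasure \<theta> (van_hove_boundary K (A n)) / emeasure \<theta> (A n) < ennreal e"
    by (rule order_tendstoD) (use assms in simp)
  then show ?thesis
  proof eventually_elim
    case (elim n)
    define m where "m = measure \<theta> (A n)"
    have m: "m > 0" "emeasure \<theta> (A n) = ennreal m" using A_pos A_emeasure by (auto simp: m_def)
    have "emeasure \<theta> (van_hove_boundary K (A n)) / ennreal m * ennreal m \<le> ennreal e * ennreal m"
      using elim m(2) by (intro mult_right_mono) auto
    also have "\<dots> = ennreal (e * m)" using assms m by (simp add: ennreal_mult)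
    also have "emeasure \<theta> (van_hove_boundary K (A n)) / ennreal m * ennreal m = emeasure \<theta> (van_hove_boundary K (A n))"
      using m by (simp add: ennreal_divide_times ennreal_mult_divide_eq)
    finally show ?case by (simp add: m_def)
  qed
qed

text \<open>Monotonicity of \<open>emeasure\<close> asks for a measurable larger set. The difference
  set in the second part of the boundary is closed: its complement consists of the \<open>x\<close>
  whose translate of \<open>L\<close> lies in \<open>A n\<close>, an open condition since
  \<open>L\<close> is compact.\<close>

lemma boundary_measurable:
  assumes L: "compact L"
  shows "van_hove_boundary L (A n) \<in> sets borel"
proof -
  have "{b - k | b k. b \<in> UNIV - A n \<and> k \<in> L} = - {x. \<forall>k\<in>L. x + k \<in> A n}"
    by (auto) (metis add_diff_cancel_right' diff_add_cancel)+
  moreover have "open {x. \<forall>k\<in>L. x + k \<in> A n}"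
  proof (subst open_subopen, intro ballI)
    fix x assume x: "x \<in> {x. \<forall>k\<in>L. x + k \<in> A n}"
    then have "(+) x ` L \<subseteq> A n" by auto
    then obtain U where U: "open U" "0 \<in> U" "\<And>k u. k \<in> (+) x ` L \<Longrightarrow> u \<in> U \<Longrightarrow> k + u \<in> A n"
      using compact_add_neighbourhood[OF compact_image_add[OF L] A_open] by metis
    have "x \<in> (+) x ` U" using U(2) by (force simp: image_iff)
    moreover have "(+) x ` U \<subseteq> {x. \<forall>k\<in>L. x + k \<in> A n}"
    proof clarify
      fix u k assume "u \<in> U" "k \<in> L"
      then have "(x + k) + u \<in> A n" by (intro U(3)) auto
      then show "x + u + k \<in> A n" by (simp add: ac_simps)
    qed
    ultimately show "\<exists>T. open T \<and> x \<in> T \<and> T \<subseteq> {x. \<forall>k\<in>L. x + k \<in> A n}"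
      using open_image_add[OF U(1)] by blast
  qed
  ultimately have "{b - k | b k. b \<in> UNIV - A n \<and> k \<in> L} \<in> sets borel" by auto
  then show ?thesis
    unfolding van_hove_boundary_def by auto
qed

text \<open>The set \<open>B\<close> of \<open>covering_integral_le\<close> is the closure of the
  difference set of \<open>A n\<close> and \<open>closure V\<close>. Apart from points of
  \<open>A n\<close> it lies in the van Hove boundary for the reflected closure, so its measure is
  at most \<open>1 + e\<close> times that of \<open>A n\<close>. The quantifiers over
  \<open>h\<close>, \<open>S\<close> and \<open>K\<close> stand inside the eventuality: the
  threshold depends on \<open>V\<close> and \<open>e\<close> only, which makes later bounds uniform
  in the function.\<close>

lemma covering_integral_asymptotic:
  assumes V: "open V" "compact (closure V)" and e: "0 < e"
  shows "\<forall>\<^sub>F n in sequentially. \<forall>h S K. h \<in> borel_measurable borel \<longrightarrow> compact K \<longrightarrow> K \<subseteq> V \<longrightarrow>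
     (\<forall>t. (\<integral>\<^sup>+x\<in>(+) t ` V. h x \<partial>\<theta>) \<le> S) \<longrightarrow>
     emeasure \<theta> (uminus ` K) * (\<integral>\<^sup>+x\<in>A n. h x \<partial>\<theta>) \<le> ennreal ((1 + e) * measure \<theta> (A n)) * S"
proof -
  define L where "L = uminus ` closure V"
  have L: "compact L"
    unfolding L_def by (rule compact_continuous_image[OF _ V(2)]) (rule continuous_on_minus[OF continuous_on_id])
  show ?thesis using boundary_small[OF L e]
  proof eventually_elim
    case (elim n)
    define P where "P = {a + k | a k. a \<in> A n \<and> k \<in> L}"
    have "P \<subseteq> {a + k | a k. a \<in> closure (A n) \<and> k \<in> L}" unfolding P_def using closure_subset by blast
    moreover have Q: "compact {a + k | a k. a \<in> closure (A n) \<and> k \<in> L}"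
      by (rule compact_set_plus[OF A_precompact L])
    ultimately have "closure P \<subseteq> {a + k | a k. a \<in> closure (A n) \<and> k \<in> L}"
      using closure_minimal compact_imp_closed by blast
    then have cP: "compact (closure P)"
      using compact_Int_closed[OF Q closed_closure, of P] by (simp add: Int_absorb1)
    have "emeasure \<theta> (closure P) \<le> emeasure \<theta> (A n \<union> (closure P - A n))"
      by (rule emeasure_mono) auto
    also have "\<dots> \<le> emeasure \<theta> (A n) + emeasure \<theta> (closure P - A n)"
      by (rule emeasure_subadditive) auto
    also have "emeasure \<theta> (closure P - A n) \<le> emeasure \<theta> (van_hove_boundary L (A n))"
    proof (rule emeasure_mono)
      show "closure P - A n \<subseteq> van_hove_boundary L (A n)"
        unfolding van_hove_boundary_def P_def by auto
      show "van_hove_boundary L (A n) \<in> sets \<theta>"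
        using boundary_measurable[OF L] by simp
    qed
    also have "emeasure \<theta> (A n) + emeasure \<theta> (van_hove_boundary L (A n)) \<le> ennreal (measure \<theta> (A n)) + ennreal (e * measure \<theta> (A n))"
      using elim by (simp add: A_emeasure add_left_mono)
    also have "\<dots> = ennreal ((1 + e) * measure \<theta> (A n))"
      using e A_pos[of n] by (simp add: distrib_right flip: ennreal_plus)
    finally have meas: "emeasure \<theta> (closure P) \<le> ennreal ((1 + e) * measure \<theta> (A n))"
      by (simp add: add_left_mono)
    show ?case
    proof (intro allI impI)
      fix h :: "'a \<Rightarrow> ennreal" and S K
      assume h: "h \<in> borel_measurable borel" and K: "compact K" "K \<subseteq> V"
        and S: "\<forall>t. (\<integral>\<^sup>+x\<in>(+) t ` V. h x \<partial>\<theta>) \<le> S"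
      have "x - k \<in> closure P" if "x \<in> A n" "k \<in> K" for x k
      proof -
        have "- k \<in> L" unfolding L_def using that K closure_subset by blast
        then have "x + - k \<in> P" unfolding P_def using that by blast
        then show ?thesis using closure_subset[of P] by auto
      qed
      then have "emeasure \<theta> (uminus ` K) * (\<integral>\<^sup>+x\<in>A n. h x \<partial>\<theta>) \<le> emeasure \<theta> (closure P) * S"
        by (intro covering_integral_le[OF h V(1) K cP]) (use S in auto)
      also have "\<dots> \<le> ennreal ((1 + e) * measure \<theta> (A n)) * S"
        by (intro mult_right_mono meas) auto
      finally show "emeasure \<theta> (uminus ` K) * (\<integral>\<^sup>+x\<in>A n. h x \<partial>\<theta>) \<le> ennreal ((1 + e) * measure \<theta> (A n)) * S" .
    qed
  qed
qed

text \<open>In the covering inequality for \<open>h = 1\<close> the measure of \<open>A n\<close>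
  occurs on both sides and cancels. This leaves the bound \<open>1 + e'\<close> times
  \<open>emeasure \<theta> V\<close> for the reflection of a compact subset of \<open>V\<close>;
  \<open>e'\<close> tends to 0 and inner regularity does the rest. The van Hove sequence is thus the
  source of inversion invariance.\<close>

lemma emeasure_uminus_le:
  assumes V: "open V" "compact (closure V)"
  shows "emeasure \<theta> (uminus ` V) \<le> emeasure \<theta> V"
proof -
  define m where "m = measure \<theta> V"
  have m: "emeasure \<theta> V = ennreal m"
    unfolding m_def using emeasure_precompact[OF V(2)] by (simp add: emeasure_eq_ennreal_measure less_top)
  have uV: "open (uminus ` V)" by (rule open_uminus_image[OF V(1)])
  have le: "emeasure \<theta> (uminus ` K) \<le> emeasure \<theta> V" if K: "compact K" "K \<subseteq> V" for K
  proof -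
    have "emeasure \<theta> (uminus ` K) \<le> ennreal (m + e)" if e: "e > 0" for e
    proof -
      define e' where "e' = e / (m + 1)"
      have m0: "m \<ge> 0" by (simp add: m_def)
      have e': "e' > 0" "m * e' \<le> e" using e m0 by (auto simp: e'_def field_simps)
      obtain n where n: "emeasure \<theta> (uminus ` K) * (\<integral>\<^sup>+x\<in>A n. 1 \<partial>\<theta>) \<le> ennreal ((1 + e') * measure \<theta> (A n)) * emeasure \<theta> V"
      proof -
        have "(\<integral>\<^sup>+x\<in>(+) t ` V. 1 \<partial>\<theta>) \<le> emeasure \<theta> V" for t
          using emeasure_image_add[of V t] V(1) borel_image_add[of V t] by simp
        moreover note eventually_happens'[OF sequentially_bot covering_integral_asymptotic[OF V e'(1)]]
        ultimately show ?thesis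
          by (elim exE allE[of _ "\<lambda>_. 1"] allE[of _ "emeasure \<theta> V"] allE[of _ K]) (rule that, use K in simp)
      qed
      have k: "emeasure \<theta> (uminus ` K) < \<infinity>"
        using emeasure_compact[OF compact_uminus_image[OF K(1)]] .
      then obtain k where k: "emeasure \<theta> (uminus ` K) = ennreal k" "k \<ge> 0"
        by (cases "emeasure \<theta> (uminus ` K)") auto
      have "ennreal (k * measure \<theta> (A n)) \<le> ennreal (((1 + e') * measure \<theta> (A n)) * m)"
        using n e' m0 A_pos[of n] unfolding m k(1) by (simp add: A_emeasure ennreal_mult k(2))
      then have "k * measure \<theta> (A n) \<le> ((1 + e') * m) * measure \<theta> (A n)"
        using e' m0 A_pos[of n] by (simp add: ennreal_le_iff mult_ac)
      then have "k \<le> (1 + e') * m" using A_pos[of n] by simp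
      also have "\<dots> \<le> m + e" using e' by (simp add: algebra_simps)
      finally show ?thesis unfolding k(1) by (rule ennreal_leI)
    qed
    then have *: "emeasure \<theta> (uminus ` K) \<le> ennreal m + ennreal e" if "e > 0" for e
      using that by (simp add: m_def)
    show ?thesis unfolding m by (rule ennreal_le_epsilon) (rule *)
  qed
  have "emeasure \<theta> K \<le> emeasure \<theta> V" if "compact K" "K \<subseteq> uminus ` V" for K
  proof -
    have "compact (uminus ` K)" by (rule compact_uminus_image[OF that(1)])
    moreover have "uminus ` K \<subseteq> V" using that(2) by auto
    ultimately have "emeasure \<theta> (uminus ` uminus ` K) \<le> emeasure \<theta> V" by (rule le)
    then show ?thesis by (simp add: image_image)
  qed
  then show ?thesis unfolding inner_regular[OF uV] by (auto intro!: SUP_least)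
qed

lemma emeasure_uminus:
  assumes V: "open V" "compact (closure V)"
  shows "emeasure \<theta> (uminus ` V) = emeasure \<theta> V"
proof (rule antisym)
  have "closure (uminus ` V) \<subseteq> uminus ` closure V"
    using closure_subset[of V] compact_uminus_image[OF V(2)]
    by (intro closure_minimal image_mono compact_imp_closed)
  then have "compact (closure (uminus ` V))"
    using compact_Int_closed[OF compact_uminus_image[OF V(2)] closed_closure, of "uminus ` V"]
    by (simp add: Int_absorb1)
  from emeasure_uminus_le[OF open_uminus_image[OF V(1)] this]
  show "emeasure \<theta> V \<le> emeasure \<theta> (uminus ` V)" by (simp add: image_image)
qed (rule emeasure_uminus_le[OF V])

end

locale weyl_setting = haar_Lp \<theta> p + van_hove \<theta> A
  for \<theta> :: "'a::{topological_ab_group_add, t2_space} measure" and p A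
begin

text \<open>The covering inequality with \<open>e = 1 / 2\<close>, for a compact \<open>K'\<close>
  in \<open>V\<close> whose reflection has more than three quarters of the measure of
  \<open>V\<close>, loses the factor \<open>(3 / 2) / (3 / 4) = 2\<close> on integrals of p-th
  powers; since \<open>2 \<le> 2 powr p\<close>, the norm loses at most the factor 2. The threshold
  does not depend on \<open>g\<close>, so a bound at one scale controls the limsup.\<close>

theorem stepanov_le_domination:
  assumes V: "open V" "compact (closure V)" "V \<noteq> {}"
  shows "\<forall>\<^sub>F n in sequentially. \<forall>g c. g \<in> borel_measurable borel \<longrightarrow> stepanov_le V g c \<longrightarrow> stepanov_le (A n) g (2 * c)"
proof -
  define m where "m = measure \<theta> V"
  have m: "emeasure \<theta> V = ennreal m" unfolding m_def by (rule emeasure_eq_measure_precompact[OF V(2)])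
  have m0: "m > 0" using emeasure_open_pos[OF V(1,3)] m by (simp add: ennreal_less_zero_iff)
  \<comment> \<open>Inversion invariance enters because the covering inequality involves the measure
    of the reflected compact set.\<close>
  have "ennreal (3 / 4 * m) < emeasure \<theta> (uminus ` V)"
    unfolding emeasure_uminus[OF V(1,2)] m using m0 by (simp add: ennreal_less_iff)
  then obtain K where K: "compact K" "K \<subseteq> uminus ` V" "ennreal (3 / 4 * m) < emeasure \<theta> K"
    unfolding inner_regular[OF open_uminus_image[OF V(1)]] less_SUP_iff by auto
  define K' where "K' = uminus ` K"
  have K': "compact K'" "K' \<subseteq> V" "uminus ` K' = K"
    using compact_uminus_image[OF K(1)] K(2)
    by (auto simp: K'_def image_image)
  show ?thesis
    using covering_integral_asymptotic[OF V(1,2), of "1/2", simplified]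
  proof eventually_elim
    case (elim n)
    define a where "a = measure \<theta> (A n)"
    have a: "a > 0" using A_pos by (simp add: a_def)
    show ?case
    proof (intro allI impI)
      fix g c assume g: "g \<in> borel_measurable borel" and s: "stepanov_le V g c"
      have c: "0 \<le> c" using s by (rule stepanov_le_nonneg)
      have "Lp_le ((+) y ` A n) g (2 * c * a powr (1 / p))" for y
      proof -
        define h where "h = (\<lambda>x. ennreal (norm (g (x + y)) powr p))"
        have gy: "(\<lambda>x. g (x + y)) \<in> borel_measurable borel" by (rule measurable_shift[OF g])
        then have h: "h \<in> borel_measurable borel" unfolding h_def by measurable
        have S: "(\<integral>\<^sup>+x\<in>(+) t ` V. h x \<partial>\<theta>) \<le> ennreal (c powr p * m)" for t
        proof -
          have "stepanov_le V (\<lambda>x. g (x + y)) c" by (rule stepanov_le_translate[OF g V(1) s])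
          then have "pint ((+) t ` V) (\<lambda>x. g (x + y)) \<le> ennreal ((c * m powr (1 / p)) powr p)"
            unfolding stepanov_le_def Lp_le_def m_def by blast
          then show ?thesis unfolding pint_def h_def using c m0 p_pos by (simp add: powr_mult powr_powr)
        qed
        have "ennreal (3 / 4 * m) * (\<integral>\<^sup>+x\<in>A n. h x \<partial>\<theta>) \<le> emeasure \<theta> K * (\<integral>\<^sup>+x\<in>A n. h x \<partial>\<theta>)"
          using K(3) by (intro mult_right_mono) auto
        also have "\<dots> \<le> ennreal (3 / 2 * a) * ennreal (c powr p * m)"
          using elim[rule_format, OF h K'(1,2) S] K'(3) by (simp add: a_def)
        also have "\<dots> = ennreal (3 / 2 * a * (c powr p * m))"
          by (rule ennreal_mult[symmetric]) (use a m0 in auto)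
        finally have *: "ennreal (3 / 4 * m) * (\<integral>\<^sup>+x\<in>A n. h x \<partial>\<theta>) \<le> ennreal (3 / 2 * a * (c powr p * m))" .
        have "(\<integral>\<^sup>+x\<in>A n. h x \<partial>\<theta>) \<le> ennreal (2 * a * c powr p)"
        proof (cases "\<integral>\<^sup>+x\<in>A n. h x \<partial>\<theta>")
          case (real r)
          then have "3 / 4 * m * r \<le> 3 / 2 * a * (c powr p * m)"
            using * m0 a c by (simp add: ennreal_mult'[symmetric] ennreal_le_iff)
          then have "(3 / 4 * m) * r \<le> (3 / 4 * m) * (2 * a * c powr p)" by (simp add: algebra_simps)
          then have "r \<le> 2 * a * c powr p" using m0 by (subst (asm) mult_le_cancel_left_pos) auto
          then show ?thesis using real by (simp add: ennreal_leI)
        next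
          case top
          then show ?thesis using * m0 by (simp add: ennreal_mult_top top_unique)
        qed
        also have "\<dots> \<le> ennreal ((2 * c * a powr (1 / p)) powr p)"
        proof (rule ennreal_leI)
          have "2 * a * c powr p \<le> 2 powr p * a * c powr p"
            using a p_ge powr_mono[of 1 p 2] by (intro mult_right_mono) auto
          also have "\<dots> = (2 * c * a powr (1 / p)) powr p"
            using a c p_pos by (simp add: powr_mult powr_powr)
          finally show "2 * a * c powr p \<le> (2 * c * a powr (1 / p)) powr p" .
        qed
        finally have "pint (A n) (\<lambda>x. g (x + y)) \<le> ennreal ((2 * c * a powr (1 / p)) powr p)"
          by (simp add: pint_def h_def)
        then have "Lp_le (A n) (\<lambda>x. g (x + y)) (2 * c * a powr (1 / p))"
          using c by (simp add: Lp_le_def)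
        then show ?thesis using Lp_le_shift[OF g] by simp
      qed
      then show "stepanov_le (A n) g (2 * c)" using c by (simp add: stepanov_le_def a_def)
    qed
  qed
qed

end

section \<open>Uniform continuity for the group topology, density in local L^p and continuity of
  translations\<close>

definition unif_cont :: "('a::topological_ab_group_add \<Rightarrow> complex) \<Rightarrow> bool" where
  "unif_cont v \<longleftrightarrow> (\<forall>e>0. \<exists>U. open U \<and> 0 \<in> U \<and> (\<forall>x. \<forall>u\<in>U. norm (v (x + u) - v x) < e))"

lemma unif_contE:
  assumes "unif_cont v" "e > 0"
  obtains U where "open U" "0 \<in> U" "\<And>x u. u \<in> U \<Longrightarrow> norm (v (x + u) - v x) < e"
proof -
  have "\<exists>U. open U \<and> 0 \<in> U \<and> (\<forall>x. \<forall>u\<in>U. norm (v (x + u) - v x) < e)"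
    using assms by (simp add: unif_cont_def)
  then show ?thesis using that by blast
qed

lemma unif_cont_continuous:
  assumes "unif_cont v" shows "continuous_on UNIV v"
  unfolding continuous_on_topological
proof (intro ballI allI impI)
  fix x B assume "open B" "v x \<in> B"
  then obtain e where e: "e > 0" "ball (v x) e \<subseteq> B" using openE by blast
  from unif_contE[OF assms e(1)] obtain U where U: "open U" "0 \<in> U" "\<And>x u. u \<in> U \<Longrightarrow> norm (v (x + u) - v x) < e"
    by blast
  have "v y \<in> B" if "y \<in> (+) (- x) -` U" for y
    using U(3)[of "- x + y" x] that e(2) by (auto simp: dist_norm norm_minus_commute)
  moreover have "open ((+) (- x) -` U)" by (rule open_vimage[OF U(1) continuous_on_add_const])
  ultimately show "\<exists>A. open A \<and> x \<in> A \<and> (\<forall>y\<in>UNIV. y \<in> A \<longrightarrow> v y \<in> B)"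
    using U(2) by (intro exI[of _ "(+) (- x) -` U"]) auto
qed

lemma unif_cont_measurable: "unif_cont v \<Longrightarrow> v \<in> borel_measurable borel"
  by (rule borel_measurable_continuous_onI[OF unif_cont_continuous])

lemma unif_cont_cmult:
  assumes "unif_cont v" shows "unif_cont (\<lambda>x. c * v x)"
  unfolding unif_cont_def
proof (intro allI impI)
  fix e :: real assume "e > 0"
  then have e': "e / (norm c + 1) > 0" by (simp add: add_nonneg_pos)
  from unif_contE[OF assms e'] obtain U where U: "open U" "0 \<in> U"
    "\<And>x u. u \<in> U \<Longrightarrow> norm (v (x + u) - v x) < e / (norm c + 1)" by blast
  have "norm (c * v (x + u) - c * v x) < e" if "u \<in> U" for x u
  proof -
    have "norm (c * v (x + u) - c * v x) = norm c * norm (v (x + u) - v x)"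
      by (simp flip: right_diff_distrib add: norm_mult)
    also have "\<dots> \<le> norm c * (e / (norm c + 1))"
      using U(3)[OF that, of x] by (intro mult_left_mono) auto
    also have "\<dots> < (norm c + 1) * (e / (norm c + 1))"
      using e' by (intro mult_strict_right_mono) auto
    also have "\<dots> = e" using norm_ge_zero[of c] by (simp add: add_nonneg_eq_0_iff)
    finally show ?thesis .
  qed
  with U(1,2) show "\<exists>U. open U \<and> 0 \<in> U \<and> (\<forall>x. \<forall>u\<in>U. norm (c * v (x + u) - c * v x) < e)"
    by blast
qed

lemma unif_cont_add:
  assumes "unif_cont v" "unif_cont w" shows "unif_cont (\<lambda>x. v x + w x)"
  unfolding unif_cont_def
proof (intro allI impI)
  fix e :: real assume "e > 0"
  then have e': "e / 2 > 0" by simp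
  from unif_contE[OF assms(1) e'] obtain U where U: "open U" "0 \<in> U"
    "\<And>x u. u \<in> U \<Longrightarrow> norm (v (x + u) - v x) < e / 2" by blast
  from unif_contE[OF assms(2) e'] obtain U' where U': "open U'" "0 \<in> U'"
    "\<And>x u. u \<in> U' \<Longrightarrow> norm (w (x + u) - w x) < e / 2" by blast
  have "norm (v (x + u) + w (x + u) - (v x + w x)) < e" if "u \<in> U \<inter> U'" for x u
    using norm_triangle_ineq[of "v (x + u) - v x" "w (x + u) - w x"] U(3)[of u x] U'(3)[of u x] that
    by (simp add: algebra_simps)
  then show "\<exists>U. open U \<and> 0 \<in> U \<and> (\<forall>x. \<forall>u\<in>U. norm (v (x + u) + w (x + u) - (v x + w x)) < e)"
    using U(1,2) U'(1,2) by (intro exI[of _ "U \<inter> U'"]) auto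
qed

lemma unif_cont_sum:
  "finite J \<Longrightarrow> (\<And>j. j \<in> J \<Longrightarrow> unif_cont (v j)) \<Longrightarrow> unif_cont (\<lambda>x. \<Sum>j\<in>J. v j x)"
proof (induction J rule: finite_induct)
  case empty
  then show ?case unfolding unif_cont_def by (auto intro: exI[of _ UNIV])
qed (auto intro: unif_cont_add)

lemma difference_neighbourhood:
  assumes "open U" "(0::'a::topological_ab_group_add) \<in> U"
  obtains W where "open W" "0 \<in> W" "\<And>u w. u \<in> W \<Longrightarrow> w \<in> W \<Longrightarrow> u - w \<in> U"
proof -
  have "continuous_on UNIV (\<lambda>z::'a \<times> 'a. fst z - snd z)"
    by (intro continuous_on_diff continuous_on_fst continuous_on_snd continuous_on_id)
  then have "open ((\<lambda>z. fst z - snd z) -` U)" by (rule open_vimage[OF assms(1)])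
  moreover have "(0, 0) \<in> (\<lambda>z. fst z - snd z) -` U" using assms(2) by simp
  ultimately obtain X Y where XY: "open X" "open Y" "(0, 0) \<in> X \<times> Y" "X \<times> Y \<subseteq> (\<lambda>z. fst z - snd z) -` U"
    by (rule open_prod_elim)
  then show ?thesis by (intro that[of "X \<inter> Y"]) auto
qed

context haar_space
begin

lemma outer_approximation:
  assumes B: "B \<in> sets borel" "emeasure \<theta> B < \<infinity>" and d: "d > 0"
  obtains W where "open W" "B \<subseteq> W" "emeasure \<theta> (W - B) \<le> ennreal d"
proof -
  obtain b where b: "emeasure \<theta> B = ennreal b" "b \<ge> 0" using B(2) by (cases "emeasure \<theta> B") auto
  have "(INF U\<in>{U. open U \<and> B \<subseteq> U}. emeasure \<theta> U) < ennreal (b + d)"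
    unfolding outer_regular[OF B(1), symmetric] b(1) using d b(2) by (simp add: ennreal_less_iff)
  then obtain W where W: "open W" "B \<subseteq> W" "emeasure \<theta> W < ennreal (b + d)"
    unfolding INF_less_iff by auto
  have "emeasure \<theta> (W - B) = emeasure \<theta> W - emeasure \<theta> B"
    using W B by (intro emeasure_Diff) auto
  also have "\<dots> \<le> ennreal (b + d) - ennreal b"
    unfolding b(1) using W(3) by (intro ennreal_minus_mono) auto
  also have "\<dots> = ennreal d" using b(2) by (simp add: ennreal_minus)
  finally show ?thesis using W that by blast
qed

text \<open>An open \<open>W\<close> that exceeds \<open>closure U - U\<close> by little in measure
  is removed from the compact set \<open>closure U\<close>; what remains is compact and inside
  \<open>U\<close>.\<close>

lemma inner_approximation:
  assumes U: "open U" "compact (closure U)" and d: "d > 0"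
  obtains K where "compact K" "K \<subseteq> U" "emeasure \<theta> (U - K) \<le> ennreal d"
proof -
  have "emeasure \<theta> (closure U - U) < \<infinity>"
    using emeasure_mono[of "closure U - U" "closure U" \<theta>] emeasure_compact[OF U(2)] by auto
  then obtain W where W: "open W" "closure U - U \<subseteq> W" "emeasure \<theta> (W - (closure U - U)) \<le> ennreal d"
    using outer_approximation[of "closure U - U" d] U(1) d by (metis borel_closed borel_open closed_closure sets.Diff)
  show ?thesis
  proof (rule that[of "closure U - W"])
    show "compact (closure U - W)" using compact_diff[OF U(2) W(1)] .
    show "closure U - W \<subseteq> U" using W(2) by auto
    have "U - (closure U - W) \<subseteq> W - (closure U - U)" using closure_subset[of U] by auto
    then have "emeasure \<theta> (U - (closure U - W)) \<le> emeasure \<theta> (W - (closure U - U))"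
      using W(1) U(1) by (intro emeasure_mono) auto
    then show "emeasure \<theta> (U - (closure U - W)) \<le> ennreal d" using W(3) by simp
  qed
qed

text \<open>A compact \<open>K\<close> in \<open>U\<close> with small remainder stays inside
  \<open>U\<close> under small translations, so a translate of \<open>U\<close> misses at most the
  remainder. Both signs of \<open>u\<close> are recorded because two one-sided estimates are
  combined into a bound for an absolute value.\<close>

lemma small_translate_difference:
  assumes U: "open U" "compact (closure U)" and d: "d > 0"
  obtains N where "open N" "0 \<in> N" "\<And>u. u \<in> N \<Longrightarrow> emeasure \<theta> (U - (+) u ` U) \<le> ennreal d"
    "\<And>u. u \<in> N \<Longrightarrow> emeasure \<theta> (U - (+) (- u) ` U) \<le> ennreal d"
proof -
  obtain K where K: "compact K" "K \<subseteq> U" "emeasure \<theta> (U - K) \<le> ennreal d"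
    using inner_approximation[OF U d] by blast
  obtain N0 where N0: "open N0" "0 \<in> N0" "\<And>k u. k \<in> K \<Longrightarrow> u \<in> N0 \<Longrightarrow> k + u \<in> U"
    using compact_add_neighbourhood[OF K(1) U(1) K(2)] by blast
  define N where "N = N0 \<inter> uminus -` N0"
  have *: "emeasure \<theta> (U - (+) u ` U) \<le> ennreal d" if "- u \<in> N0" for u
  proof -
    have "K \<subseteq> (+) u ` U"
    proof
      fix k assume "k \<in> K"
      then show "k \<in> (+) u ` U" using N0(3)[of k "- u"] that by (intro image_eqI[of _ _ "k + - u"]) auto
    qed
    then have "emeasure \<theta> (U - (+) u ` U) \<le> emeasure \<theta> (U - K)"
      using U(1) compact_sets[OF K(1)] by (intro emeasure_mono) auto
    then show ?thesis using K(3) by simp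
  qed
  show ?thesis
  proof (rule that[of N])
    show "open N" unfolding N_def
      by (intro open_Int N0 open_vimage continuous_on_minus[OF continuous_on_id])
    show "emeasure \<theta> (U - (+) u ` U) \<le> ennreal d" if "u \<in> N" for u
      using that by (intro *) (simp add: N_def)
    show "emeasure \<theta> (U - (+) (- u) ` U) \<le> ennreal d" if "u \<in> N" for u
      using that by (intro *) (simp add: N_def)
  qed (use N0(2) in \<open>simp add: N_def\<close>)
qed

end

context haar_Lp
begin

text \<open>The approximant is a convolution of indicators: the share of the translate of
  \<open>U\<close> by \<open>x\<close> that lies in the set \<open>X\<close>, the sum of
  \<open>K\<close> and \<open>U\<close>. It equals 1 on \<open>K\<close> and vanishes outside
  \<open>W\<close>, so on \<open>Q\<close> it differs from the indicator of \<open>E\<close> only on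
  \<open>W - K\<close>, a set of measure at most \<open>e powr p\<close>;
  \<open>small_translate_difference\<close> makes it uniformly continuous.\<close>

lemma indicator_approximation:
  assumes E: "E \<in> sets borel" and Q: "compact Q" and e: "e > 0"
  obtains v where "unif_cont v" "Lp_le Q (\<lambda>x. indicator E x - v x) e"
proof -
  have Qs: "Q \<in> sets borel" using compact_sets[OF Q] by simp
  have Qf: "emeasure \<theta> B < \<infinity>" if "B \<subseteq> Q" for B
    using emeasure_mono[OF that, of \<theta>] emeasure_compact[OF Q] Qs by auto
  define d where "d = e powr p"
  have d: "d / 2 > 0" "d > 0" using e by (auto simp: d_def)
  obtain W where W: "open W" "E \<inter> Q \<subseteq> W" "emeasure \<theta> (W - E \<inter> Q) \<le> ennreal (d / 2)"
    by (rule outer_approximation[OF sets.Int[OF E Qs] Qf d(1)]) auto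
  obtain W' where W': "open W'" "Q - E \<subseteq> W'" "emeasure \<theta> (W' - (Q - E)) \<le> ennreal (d / 2)"
    by (rule outer_approximation[OF sets.Diff[OF Qs E] Qf d(1)]) auto
  \<comment> \<open>Inner approximation through the complement: \<open>W'\<close> covers
    \<open>Q - E\<close> with little excess, so removing it from \<open>Q\<close> leaves a compact
    subset of \<open>E \<inter> Q\<close> that lacks only little of it.\<close>
  define K where "K = Q - W'"
  have K: "compact K" unfolding K_def by (rule compact_diff[OF Q W'(1)])
  have KW: "K \<subseteq> E" "K \<subseteq> W" using W(2) W'(2) by (auto simp: K_def)
  have "W - K \<subseteq> (W - E \<inter> Q) \<union> (W' - (Q - E))" by (auto simp: K_def)
  then have "emeasure \<theta> (W - K) \<le> emeasure \<theta> ((W - E \<inter> Q) \<union> (W' - (Q - E)))"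
    using W(1) W'(1) E Qs by (intro emeasure_mono) auto
  also have "\<dots> \<le> emeasure \<theta> (W - E \<inter> Q) + emeasure \<theta> (W' - (Q - E))"
    using W(1) W'(1) E Qs by (intro emeasure_subadditive) auto
  also have "\<dots> \<le> ennreal (d / 2) + ennreal (d / 2)" by (intro add_mono W W')
  also have "\<dots> = ennreal d" using d by (simp flip: ennreal_plus)
  finally have WK: "emeasure \<theta> (W - K) \<le> ennreal d" .
  obtain U1 where U1: "open U1" "0 \<in> U1" "\<And>k u. k \<in> K \<Longrightarrow> u \<in> U1 \<Longrightarrow> k + u \<in> W"
    by (rule compact_add_neighbourhood[OF K W(1) KW(2)]) auto
  obtain U2 where U2: "open U2" "0 \<in> U2" "\<And>u w. u \<in> U2 \<Longrightarrow> w \<in> U2 \<Longrightarrow> u - w \<in> U1"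
    by (rule difference_neighbourhood[OF U1(1,2)]) auto
  obtain U0 :: "'a set" where U0: "open U0" "0 \<in> U0" "compact (closure U0)" by (rule precompact_neighbourhood)
  define U where "U = U2 \<inter> U0"
  have U: "open U" "0 \<in> U" using U2 U0 by (auto simp: U_def)
  have Uc: "compact (closure U)"
    using compact_Int_closed[OF U0(3) closed_closure, of U] closure_mono[of U U0] by (auto simp: U_def Int_absorb1)
  have Uf: "emeasure \<theta> U = ennreal (measure \<theta> U)"
    using emeasure_precompact[OF Uc] by (simp add: emeasure_eq_ennreal_measure less_top)
  define m where "m = measure \<theta> U"
  have m: "m > 0" using emeasure_open_pos[of U] U Uf by (auto simp: m_def ennreal_less_zero_iff)
  define X where "X = (\<Union>k\<in>K. (+) k ` U)"
  have X: "open X" unfolding X_def using open_image_add[OF U(1)] by auto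
  have fm: "B \<in> fmeasurable \<theta>" if "B \<in> sets borel" "B \<subseteq> (+) x ` U" for B x
  proof (rule fmeasurableI)
    have "emeasure \<theta> B \<le> emeasure \<theta> ((+) x ` U)"
      using that(2) open_image_add[OF U(1), of x] by (intro emeasure_mono) auto
    also have "\<dots> < \<infinity>" using emeasure_image_add[of U x] U(1) Uf by simp
    finally show "emeasure \<theta> B < \<infinity>" .
  qed (use that in simp)
  have mU: "measure \<theta> ((+) x ` U) = m" for x
    using emeasure_image_add[of U x] U(1) by (simp add: m_def measure_def)
  define v where "v = (\<lambda>x. measure \<theta> (X \<inter> (+) x ` U) / m)"
  have v01: "0 \<le> v x" "v x \<le> 1" for x
  proof -
    show "0 \<le> v x" using m by (simp add: v_def)
    have "measure \<theta> (X \<inter> (+) x ` U) \<le> measure \<theta> ((+) x ` U)"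
      using X open_image_add[OF U(1), of x] by (intro measure_mono_fmeasurable fm[of _ x]) auto
    then show "v x \<le> 1" using m by (simp add: v_def mU)
  qed
  have v1: "v x = 1" if "x \<in> K" for x
  proof -
    have "X \<inter> (+) x ` U = (+) x ` U" using that by (auto simp: X_def)
    then show ?thesis using m by (simp add: v_def mU)
  qed
  have v0: "v x = 0" if "x \<notin> W" for x
  proof -
    have "X \<inter> (+) x ` U = {}"
    proof (rule ccontr)
      assume "X \<inter> (+) x ` U \<noteq> {}"
      then obtain k u u' where "k \<in> K" "u \<in> U" "u' \<in> U" "k + u = x + u'" unfolding X_def by blast
      then have "k + (u - u') = x" by (simp add: algebra_simps)
      then show False using U1(3)[of k "u - u'"] U2(3)[of u u'] \<open>k \<in> K\<close> \<open>u \<in> U\<close> \<open>u' \<in> U\<close> that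
        by (auto simp: U_def)
    qed
    then show ?thesis by (simp add: v_def)
  qed
  have "unif_cont (\<lambda>x. of_real (v x))"
    unfolding unif_cont_def
  proof (intro allI impI)
    fix r :: real assume r: "r > 0"
    then have rm: "r * m / 2 > 0" using m by simp
    obtain N where N: "open N" "0 \<in> N" "\<And>u. u \<in> N \<Longrightarrow> emeasure \<theta> (U - (+) u ` U) \<le> ennreal (r * m / 2)"
      "\<And>u. u \<in> N \<Longrightarrow> emeasure \<theta> (U - (+) (- u) ` U) \<le> ennreal (r * m / 2)"
      by (rule small_translate_difference[OF U(1) Uc rm]) auto
    have le: "measure \<theta> (X \<inter> (+) y ` U) \<le> measure \<theta> (X \<inter> (+) (y + u) ` U) + r * m / 2"
      if "emeasure \<theta> (U - (+) u ` U) \<le> ennreal (r * m / 2)" for y u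
    proof -
      have eq: "(+) y ` U - (+) (y + u) ` U = (+) y ` (U - (+) u ` U)"
        by (auto simp: image_iff add.assoc)
      have ms: "(+) y ` U \<in> sets borel" for y using open_image_add[OF U(1), of y] by auto
      have "measure \<theta> (X \<inter> (+) y ` U) \<le> measure \<theta> ((X \<inter> (+) (y + u) ` U) \<union> ((+) y ` U - (+) (y + u) ` U))"
        using X ms by (intro measure_mono_fmeasurable fmeasurable.Un fm[of _ y] fm[of _ "y + u"]) auto
      also have "\<dots> \<le> measure \<theta> (X \<inter> (+) (y + u) ` U) + measure \<theta> ((+) y ` U - (+) (y + u) ` U)"
        using X ms by (intro measure_Un_le) auto
      also have "measure \<theta> ((+) y ` U - (+) (y + u) ` U) = measure \<theta> (U - (+) u ` U)"
        unfolding eq using emeasure_image_add[of "U - (+) u ` U" y] U(1) ms by (simp add: measure_def)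
      also have "\<dots> \<le> r * m / 2"
        using that rm unfolding measure_def by (metis enn2real_leI less_imp_le)
      finally show ?thesis by simp
    qed
    have "norm (of_real (v (x + u)) - of_real (v x) :: complex) < r" if "u \<in> N" for x u
    proof -
      have "\<bar>measure \<theta> (X \<inter> (+) (x + u) ` U) - measure \<theta> (X \<inter> (+) x ` U)\<bar> \<le> r * m / 2"
        using le[OF N(3)[OF that], of x] le[OF N(4)[OF that], of "x + u"]
        unfolding abs_le_iff by simp
      moreover have "\<bar>v (x + u) - v x\<bar> = \<bar>measure \<theta> (X \<inter> (+) (x + u) ` U) - measure \<theta> (X \<inter> (+) x ` U)\<bar> / m"
        using m by (simp only: v_def abs_divide abs_of_pos flip: diff_divide_distrib)
      ultimately have "\<bar>v (x + u) - v x\<bar> \<le> r / 2"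
        using m by (simp add: divide_le_eq)
      then show ?thesis using r by (simp flip: of_real_diff)
    qed
    with N(1,2) show "\<exists>U. open U \<and> 0 \<in> U \<and> (\<forall>x. \<forall>u\<in>U. norm (of_real (v (x + u)) - of_real (v x) :: complex) < r)"
      by (intro exI[of _ N] conjI allI ballI)
  qed
  moreover have "Lp_le Q (\<lambda>x. indicator E x - of_real (v x)) e"
  proof -
    have "pint Q (\<lambda>x. indicator E x - of_real (v x)) \<le> (\<integral>\<^sup>+x. indicator (W - K) x \<partial>\<theta>)"
      unfolding pint_def
    proof (rule nn_integral_mono)
      fix x
      have c: "norm (indicator E x - complex_of_real (v x)) \<le> 1"
      proof -
        have "indicator E x - complex_of_real (v x) = of_real (indicator E x - v x)"
          by (simp add: indicator_def)
        moreover have "\<bar>indicator E x - v x\<bar> \<le> 1" using v01[of x] by (simp add: indicator_def)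
        ultimately show ?thesis by (simp only: norm_of_real)
      qed
      have "norm (indicator E x - complex_of_real (v x)) powr p \<le> 1"
        using powr_mono2[OF _ _ c, of p] p_pos by simp
      then show "ennreal (norm (indicator E x - complex_of_real (v x)) powr p) * indicator Q x \<le> indicator (W - K) x"
        using v1[of x] v0[of x] KW W(2) by (auto simp: indicator_def)
    qed
    also have "\<dots> = emeasure \<theta> (W - K)" using W(1) compact_sets[OF K] by simp
    also have "\<dots> \<le> ennreal (e powr p)" using WK by (simp add: d_def)
    finally show ?thesis using e by (simp add: Lp_le_def)
  qed
  ultimately show ?thesis by (rule that)
qed

text \<open>Dominated convergence reduces the claim to a simple function, and each of its level sets
  is handled by \<open>indicator_approximation\<close> with an error \<open>b\<close> scaled to the
  total size of the values.\<close>

lemma density: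
  assumes F: "F \<in> Lp_loc \<theta> p" and Q: "compact Q" and e: "e > 0"
  obtains v where "unif_cont v" "Lp_le Q (\<lambda>x. F x - v x) e"
proof -
  note [measurable] = Lp_loc_measurable[OF F]
  have Qs [measurable]: "Q \<in> sets borel" using compact_sets[OF Q] by simp
  have "F \<in> borel_measurable \<theta>" by measurable
  from borel_measurable_implies_sequence_metric[OF this, of 0] obtain s where
    s0: "(\<forall>i. simple_function \<theta> (s i)) \<and> (\<forall>x\<in>space \<theta>. (\<lambda>i. s i x) \<longlonglongrightarrow> F x) \<and>
      (\<forall>i. \<forall>x\<in>space \<theta>. dist (s i x) 0 \<le> 2 * dist (F x) 0)"
    by (rule exE)
  have s: "simple_function \<theta> (s i)" "(\<lambda>i. s i x) \<longlonglongrightarrow> F x" "norm (s i x) \<le> 2 * norm (F x)" for i x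
    using s0 by simp_all
  have sm [measurable]: "s i \<in> borel_measurable \<theta>" for i using s(1) by (rule borel_measurable_simple_function)
  have "(\<lambda>i. pint Q (\<lambda>x. F x - s i x)) \<longlonglongrightarrow> (\<integral>\<^sup>+x. 0 \<partial>\<theta>)"
    unfolding pint_def
  proof (rule nn_integral_dominated_convergence[where w = "\<lambda>x. ennreal (3 powr p) * (ennreal (norm (F x) powr p) * indicator Q x)"])
    show "(\<integral>\<^sup>+x. ennreal (3 powr p) * (ennreal (norm (F x) powr p) * indicator Q x) \<partial>\<theta>) < \<infinity>"
    proof -
      have "(\<integral>\<^sup>+x. ennreal (norm (F x) powr p) * indicator Q x \<partial>\<theta>) < \<infinity>"
        using F Q by (auto simp: Lp_loc_def)
      then show ?thesis by (subst nn_integral_cmult) (auto simp: ennreal_mult_less_top)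
    qed
    show "AE x in \<theta>. ennreal (norm (F x - s j x) powr p) * indicator Q x
        \<le> ennreal (3 powr p) * (ennreal (norm (F x) powr p) * indicator Q x)" for j
    proof (rule AE_I2)
      fix x
      have "norm (F x - s j x) \<le> 3 * norm (F x)"
        using norm_triangle_ineq4[of "F x" "s j x"] s(3)[of j x] by linarith
      then have "norm (F x - s j x) powr p \<le> (3 * norm (F x)) powr p"
        using p_pos by (intro powr_mono2) auto
      also have "\<dots> = 3 powr p * norm (F x) powr p" by (simp add: powr_mult)
      finally show "ennreal (norm (F x - s j x) powr p) * indicator Q x
        \<le> ennreal (3 powr p) * (ennreal (norm (F x) powr p) * indicator Q x)"
        by (auto simp: indicator_def ennreal_leI simp flip: ennreal_mult')
    qed
    show "AE x in \<theta>. (\<lambda>i. ennreal (norm (F x - s i x) powr p) * indicator Q x) \<longlonglongrightarrow> 0"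
    proof (rule AE_I2)
      fix x
      have "(\<lambda>i. norm (F x - s i x)) \<longlonglongrightarrow> norm (F x - F x)" by (intro tendsto_intros s)
      then have "(\<lambda>i. norm (F x - s i x) powr p) \<longlonglongrightarrow> 0"
        using p_pos tendsto_powr'[of "\<lambda>i. norm (F x - s i x)" 0 sequentially "\<lambda>_. p" p] by auto
      then have "(\<lambda>i. ennreal (norm (F x - s i x) powr p)) \<longlonglongrightarrow> ennreal 0" by (rule tendsto_ennrealI)
      then show "(\<lambda>i. ennreal (norm (F x - s i x) powr p) * indicator Q x) \<longlonglongrightarrow> 0"
        by (cases "x \<in> Q") auto
    qed
  qed auto
  then have "(\<lambda>i. pint Q (\<lambda>x. F x - s i x)) \<longlonglongrightarrow> 0" by simp
  moreover have "0 < ennreal ((e / 2) powr p)" using e by simp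
  ultimately have "\<forall>\<^sub>F i in sequentially. pint Q (\<lambda>x. F x - s i x) < ennreal ((e / 2) powr p)"
    by (rule order_tendstoD)
  then obtain i where "pint Q (\<lambda>x. F x - s i x) < ennreal ((e / 2) powr p)"
    by (auto simp: eventually_sequentially)
  then have 1: "Lp_le Q (\<lambda>x. F x - s i x) (e / 2)" using e by (simp add: Lp_le_def)
  define R where "R = range (s i)"
  have R: "finite R" using s(1)[of i] by (simp add: R_def simple_function_def)
  define b where "b = e / (2 * (1 + (\<Sum>y\<in>R. norm y)))"
  have sn: "0 \<le> (\<Sum>y\<in>R. norm y)" by (simp add: sum_nonneg)
  have b: "b > 0" unfolding b_def using e sn by (intro divide_pos_pos) auto
  have Es: "s i -` {y} \<in> sets borel" for y
    using measurable_sets[OF sm[of i], of "{y}"] by simp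
  have "\<exists>v. unif_cont v \<and> Lp_le Q (\<lambda>x. indicator (s i -` {y}) x - v x) b" for y
    using indicator_approximation[OF Es Q b, of y] by blast
  then obtain v where v: "\<And>y. unif_cont (v y)" "\<And>y. Lp_le Q (\<lambda>x. indicator (s i -` {y}) x - v y x) b" by metis
  define w where "w = (\<lambda>x. \<Sum>y\<in>R. y * v y x)"
  have w: "unif_cont w" unfolding w_def by (intro unif_cont_sum R unif_cont_cmult v)
  have "Lp_le Q (\<lambda>x. \<Sum>y\<in>R. y * (indicator (s i -` {y}) x - v y x)) (\<Sum>y\<in>R. norm y * b)"
    by (rule Lp_le_sum) (use R Es v unif_cont_measurable[OF v(1)] in auto)
  moreover have "(\<Sum>y\<in>R. y * (indicator (s i -` {y}) x - v y x)) = s i x - w x" for x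
  proof -
    have "(\<Sum>y\<in>R. y * indicator (s i -` {y}) x) = (\<Sum>y\<in>R. if y = s i x then y else 0)"
      by (intro sum.cong) (auto simp: indicator_def)
    also have "\<dots> = s i x" using R by (simp add: R_def)
    finally show ?thesis by (simp add: w_def right_diff_distrib sum_subtractf)
  qed
  moreover have "(\<Sum>y\<in>R. norm y * b) \<le> e / 2"
  proof -
    have "(\<Sum>y\<in>R. norm y * b) = (\<Sum>y\<in>R. norm y) * b" by (simp add: sum_distrib_right)
    also have "\<dots> \<le> (1 + (\<Sum>y\<in>R. norm y)) * b" using b by (intro mult_right_mono) auto
    also have "\<dots> = e / 2" unfolding b_def using sn by (simp add: field_simps add_nonneg_eq_0_iff)
    finally show ?thesis .
  qed
  ultimately have 2: "Lp_le Q (\<lambda>x. s i x - w x) (e / 2)" using Lp_le_mono by simp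
  have "s i \<in> borel_measurable borel" using sm[of i] by simp
  then have "Lp_le Q (\<lambda>x. F x - w x) (e / 2 + e / 2)"
    by (rule Lp_le_triangle[OF Lp_loc_measurable[OF F] _ unif_cont_measurable[OF w] Qs 1 2])
  then show ?thesis using that[OF w] by simp
qed

text \<open>A three-term estimate through a uniformly continuous \<open>v\<close>. It needs
  \<open>v\<close> close to \<open>F\<close> both on \<open>Q\<close> and on the small translates of
  \<open>Q\<close>, hence the larger compact set \<open>Q'\<close>.\<close>

lemma translation_continuity:
  assumes F: "F \<in> Lp_loc \<theta> p" and Q: "compact Q" and e: "e > 0"
  obtains U where "open U" "0 \<in> U" "\<And>u. u \<in> U \<Longrightarrow> Lp_le Q (\<lambda>x. F (x - u) - F x) e"
proof -
  note Fm = Lp_loc_measurable[OF F]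
  have Qs: "Q \<in> sets borel" using compact_sets[OF Q] by simp
  obtain q where q: "emeasure \<theta> Q = ennreal q" "q \<ge> 0"
    using emeasure_compact[OF Q] by (cases "emeasure \<theta> Q") auto
  obtain U0 :: "'a set" where U0: "open U0" "0 \<in> U0" "compact (closure U0)" by (rule precompact_neighbourhood)
  define Q' where "Q' = {a - b | a b. a \<in> Q \<and> b \<in> closure U0}"
  have Q': "compact Q'" unfolding Q'_def by (rule compact_set_minus[OF Q U0(3)])
  have QQ': "a - u \<in> Q'" if "a \<in> Q" "u \<in> U0" for a u
    unfolding Q'_def using that closure_subset by blast
  have sub: "Q \<subseteq> Q'" using QQ'[OF _ U0(2)] by auto
  have e3: "e / 3 > 0" using e by simp
  obtain v where v: "unif_cont v" "Lp_le Q' (\<lambda>x. F x - v x) (e / 3)"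
    by (rule density[OF F Q' e3]) auto
  note vm = unif_cont_measurable[OF v(1)]
  define r where "r = e / (3 * (q powr (1 / p) + 1))"
  have r: "r > 0" unfolding r_def using e by (intro divide_pos_pos mult_pos_pos add_nonneg_pos) auto
  obtain U1 where U1: "open U1" "0 \<in> U1" "\<And>x u. u \<in> U1 \<Longrightarrow> norm (v (x + u) - v x) < r"
    by (rule unif_contE[OF v(1) r]) auto
  show ?thesis
  proof (rule that[of "U0 \<inter> U1"])
    fix u assume u: "u \<in> U0 \<inter> U1"
    have sub_image: "(+) (- u) ` Q \<subseteq> Q'" using u QQ' by auto
    have Fu: "(\<lambda>x. F (x - u)) \<in> borel_measurable borel" "(\<lambda>x. v (x - u)) \<in> borel_measurable borel"
      by (intro measurable_shift_minus Fm vm)+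
    have "Lp_le ((+) (- u) ` Q) (\<lambda>x. F x - v x) (e / 3)"
      by (rule Lp_le_subset[OF v(2) sub_image])
    then have 1: "Lp_le Q (\<lambda>x. F (x - u) - v (x - u)) (e / 3)"
      using Fm vm Lp_le_shift[of "\<lambda>x. F x - v x" Q "- u"] Qs by simp
    have "Lp_le Q (\<lambda>x. v (x - u) - v x) (r * q powr (1 / p))"
    proof (rule Lp_le_const[OF Qs _ q(2)])
      show "norm (v (x - u) - v x) \<le> r" for x
        using U1(3)[of u "x - u"] u by (simp add: norm_minus_commute)
    qed (use q r in auto)
    moreover have "r * q powr (1 / p) \<le> e / 3"
    proof -
      have "r * q powr (1 / p) \<le> r * (q powr (1 / p) + 1)" using r by (intro mult_left_mono) auto
      also have "\<dots> = e / 3"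
      proof -
        have "q powr (1 / p) + 1 \<noteq> 0" using powr_ge_zero[of q "1 / p"] by linarith
        then show ?thesis unfolding r_def by (simp add: divide_simps)
      qed
      finally show ?thesis .
    qed
    ultimately have 2: "Lp_le Q (\<lambda>x. v (x - u) - v x) (e / 3)" by (rule Lp_le_mono)
    have 3: "Lp_le Q (\<lambda>x. v x - F x) (e / 3)"
      by (rule Lp_le_minus[OF Lp_le_subset[OF v(2) sub]])
    have "Lp_le Q (\<lambda>x. F (x - u) - v x) (e / 3 + e / 3)"
      by (rule Lp_le_triangle[OF Fu(1,2) vm Qs 1 2])
    then have "Lp_le Q (\<lambda>x. F (x - u) - F x) (e / 3 + e / 3 + e / 3)"
      by (rule Lp_le_triangle[OF Fu(1) vm Fm Qs _ 3])
    then show "Lp_le Q (\<lambda>x. F (x - u) - F x) e" by simp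
  qed (use U0 U1 in auto)
qed

text \<open>Jensen's inequality for means, derived from Young's: applied to \<open>u / d\<close> it
  gives \<open>u \<le> k1 + k2 * u powr p\<close>, and integration collapses to \<open>d * m\<close>
  when the p-th power mean is at most \<open>d\<close>. The number \<open>d\<close> is a positive
  substitute for \<open>c\<close>, which may be 0.\<close>

lemma nn_integral_norm_le:
  assumes g: "g \<in> borel_measurable borel" and B: "B \<in> sets borel" "emeasure \<theta> B = ennreal m" "0 < m"
    and le: "Lp_le B g (c * m powr (1 / p))" and c: "0 \<le> c"
  shows "(\<integral>\<^sup>+x\<in>B. ennreal (norm (g x)) \<partial>\<theta>) \<le> ennreal (c * m)"
proof -
  note [measurable] = g B(1)
  have step: "(\<integral>\<^sup>+x\<in>B. ennreal (norm (g x)) \<partial>\<theta>) \<le> ennreal (d * m)" if d: "d > 0" "c \<le> d" for d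
  proof -
    define k1 where "k1 = d * (1 - 1 / p)"
    define k2 where "k2 = d * (1 / p) * d powr (- p)"
    have k: "0 \<le> k1" "0 \<le> k2" using d p_ge by (auto simp: k1_def k2_def)
    have young: "u \<le> k1 + k2 * u powr p" if "u \<ge> 0" for u
    proof -
      have "u / d \<le> 1 / p * (u / d) powr p + (1 - 1 / p)"
      proof (cases "u = 0")
        case False
        then have w: "u / d > 0" using \<open>u \<ge> 0\<close> d by simp
        have "((u / d) powr p) powr (1 / p) * 1 powr (1 - 1 / p) \<le> 1 / p * (u / d) powr p + (1 - 1 / p) * 1"
          by (rule Youngs_inequality_0) (use p_ge w in auto)
        then show ?thesis using \<open>u \<ge> 0\<close> d w p_pos by (simp add: powr_powr)
      qed (use p_ge in simp)
      then have "u \<le> d * (1 / p * (u / d) powr p + (1 - 1 / p))" using d by (simp add: divide_le_eq mult.commute)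
      also have "\<dots> = k1 + k2 * u powr p"
      proof -
        have "(u / d) powr p = u powr p * d powr (- p)"
          using that d by (simp add: powr_divide powr_minus_divide)
        then show ?thesis by (simp only: k1_def k2_def) (simp add: algebra_simps)
      qed
      finally show ?thesis .
    qed
    have "(\<integral>\<^sup>+x\<in>B. ennreal (norm (g x)) \<partial>\<theta>)
        \<le> (\<integral>\<^sup>+x. ennreal k1 * indicator B x + ennreal k2 * (ennreal (norm (g x) powr p) * indicator B x) \<partial>\<theta>)"
    proof (rule nn_integral_mono)
      fix x
      have "ennreal (norm (g x)) \<le> ennreal (k1 + k2 * norm (g x) powr p)"
        by (intro ennreal_leI young) simp
      also have "\<dots> = ennreal k1 + ennreal k2 * ennreal (norm (g x) powr p)"
        using k by (simp add: ennreal_mult')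
      finally show "ennreal (norm (g x)) * indicator B x
          \<le> ennreal k1 * indicator B x + ennreal k2 * (ennreal (norm (g x) powr p) * indicator B x)"
        by (simp add: indicator_def)
    qed
    also have "\<dots> = ennreal k1 * ennreal m + ennreal k2 * pint B g"
      unfolding pint_def by (simp add: nn_integral_add nn_integral_cmult nn_integral_cmult_indicator B)
    also have "\<dots> \<le> ennreal k1 * ennreal m + ennreal k2 * ennreal (d powr p * m)"
    proof (intro add_left_mono mult_left_mono)
      have "pint B g \<le> ennreal ((c * m powr (1 / p)) powr p)" using le by (simp add: Lp_le_def)
      also have "(c * m powr (1 / p)) powr p = c powr p * m" using c B(3) p_pos by (simp add: powr_mult powr_powr)
      also have "ennreal (c powr p * m) \<le> ennreal (d powr p * m)"
        using c d B(3) p_pos by (intro ennreal_leI mult_right_mono powr_mono2) auto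
      finally show "pint B g \<le> ennreal (d powr p * m)" .
    qed simp
    also have "\<dots> = ennreal (k1 * m + k2 * (d powr p * m))"
      using k B(3) by (simp add: ennreal_mult)
    also have "k1 * m + k2 * (d powr p * m) = d * m"
    proof -
      have "d powr (- p) * d powr p = 1" using d by (simp flip: powr_add)
      then have "k2 * (d powr p * m) = d * (1 / p) * m" unfolding k2_def by (simp add: mult.assoc flip: mult.assoc[of _ _ m])
      then show ?thesis unfolding k1_def by (simp add: algebra_simps)
    qed
    finally show ?thesis .
  qed
  show ?thesis
  proof (rule ennreal_le_epsilon)
    fix e :: real assume e: "e > 0"
    have "(\<integral>\<^sup>+x\<in>B. ennreal (norm (g x)) \<partial>\<theta>) \<le> ennreal ((c + e / m) * m)"
      by (rule step) (use c e B(3) in \<open>auto intro: add_nonneg_pos\<close>)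
    also have "(c + e / m) * m = c * m + e" using B(3) by (simp add: distrib_right)
    also have "ennreal (c * m + e) = ennreal (c * m) + ennreal e" using c B(3) e by simp
    finally show "(\<integral>\<^sup>+x\<in>B. ennreal (norm (g x)) \<partial>\<theta>) \<le> ennreal (c * m) + ennreal e" .
  qed
qed

text \<open>
  A function that is close to all its translates is close to its mean over \<open>V\<close>.  On a
  compact set, \<open>F\<close> is near a convex combination of translates of itself (close to \<open>F\<close>), and
  for a uniformly continuous approximation of \<open>F\<close> such a combination is a Riemann sum.
\<close>

theorem almost_constant:
  assumes V: "open V" "compact (closure V)" "V \<noteq> {}" and F: "F \<in> Lp_loc \<theta> p"
    and d: "\<And>s. stepanov_le V (\<lambda>x. F x - F (x - s)) d"
  obtains a where "stepanov_le V (\<lambda>x. F x - a) (2 * d)"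
proof -
  note Fm = Lp_loc_measurable[OF F]
  have d0: "d \<ge> 0" using stepanov_le_nonneg[OF d] .
  have Vs: "V \<in> sets borel" using V(1) by simp
  define m where "m = measure \<theta> V"
  have mV: "emeasure \<theta> V = ennreal m" unfolding m_def by (rule emeasure_eq_measure_precompact[OF V(2)])
  have m: "m > 0" using emeasure_open_pos[OF V(1,3)] mV by (simp add: ennreal_less_zero_iff)
  define k where "k = m powr (1 / p)"
  have k: "k > 0" using m by (simp add: k_def)
  have close: "Lp_le V (\<lambda>x. F (x + y) - F x) (d * k)" for y
  proof -
    have "Lp_le ((+) 0 ` V) (\<lambda>x. F x - F (x - - y)) (d * k)"
      using d[of "- y"] unfolding stepanov_le_def k_def m_def by blast
    then show ?thesis using Lp_le_minus by simp
  qed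
  have "set_integrable \<theta> V F"
  proof -
    obtain c where c: "Lp_le (closure V) F c" by (rule Lp_le_exists[OF F V(2)])
    then have "Lp_le V F (c / k * m powr (1 / p))"
      using Lp_le_subset[OF c closure_subset] k by (simp add: k_def)
    then have "(\<integral>\<^sup>+x\<in>V. ennreal (norm (F x)) \<partial>\<theta>) \<le> ennreal (c / k * m)"
      by (rule nn_integral_norm_le[OF Fm Vs mV m]) (use Lp_le_nonneg[OF c] k in simp)
    then have "(\<integral>\<^sup>+x\<in>V. ennreal (norm (F x)) \<partial>\<theta>) < \<infinity>"
      by (rule le_less_trans) simp
    moreover have "(\<integral>\<^sup>+x. ennreal (norm (indicator V x *\<^sub>R F x)) \<partial>\<theta>) = (\<integral>\<^sup>+x\<in>V. ennreal (norm (F x)) \<partial>\<theta>)"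
      by (intro nn_integral_cong) (simp add: indicator_def)
    moreover have "(\<lambda>x. indicator V x *\<^sub>R F x) \<in> borel_measurable \<theta>" using Fm Vs by measurable
    ultimately show ?thesis unfolding set_integrable_def by (intro integrableI_bounded) auto
  qed
  note int = this
  define a where "a = (LINT x:V|\<theta>. F x) / of_real m"
  have "Lp_le ((+) y ` V) (\<lambda>x. F x - a) (2 * d * k)" for y
  proof (rule Lp_le_limit)
    show "0 \<le> 2 * d * k" using d0 k by simp
    fix e :: real assume e: "e > 0"
    \<comment> \<open>The error \<open>r\<close> enters three times, each time multiplied by
      \<open>k\<close>; the denominator \<open>1 + k\<close> ensures
      \<open>3 * r * k \<le> e\<close>.\<close>
    define r where "r = e / 3 / (1 + k)"
    have r: "r > 0" using e k by (simp add: r_def)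
    define B where "B = (+) y ` V"
    have Bs: "B \<in> sets borel" unfolding B_def by (rule borel_image_add[OF Vs])
    have mB: "emeasure \<theta> B = ennreal m" unfolding B_def using emeasure_image_add[OF Vs] mV by simp
    \<comment> \<open>The approximation of \<open>F\<close> by \<open>v\<close> is needed at all
      points \<open>x + s\<close> with \<open>x\<close> in \<open>B\<close> and \<open>s\<close> in
      \<open>V\<close>; this compact set contains them.\<close>
    define Q where "Q = {b + s | b s. b \<in> (+) y ` closure V \<and> s \<in> closure V} \<union> (+) y ` closure V"
    have Q: "compact Q" unfolding Q_def by (intro compact_Un compact_set_plus compact_image_add V(2))
    have VV: "V \<subseteq> closure V" by (rule closure_subset)
    have BQ: "b + s \<in> Q" if "b \<in> B" "s \<in> V" for b s
    proof -
      have "b \<in> (+) y ` closure V" "s \<in> closure V" using that VV by (auto simp: B_def)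
      then show ?thesis unfolding Q_def by blast
    qed
    obtain v where v: "unif_cont v" "Lp_le Q (\<lambda>x. F x - v x) (r * k)"
      by (rule density[OF F Q, of "r * k"]) (use r k in auto)
    note vm = unif_cont_measurable[OF v(1)]
    obtain U where U: "open U" "0 \<in> U" "\<And>x u. u \<in> U \<Longrightarrow> norm (v (x + u) - v x) < r"
      by (rule unif_contE[OF v(1) r]) auto
    obtain W where W: "open W" "0 \<in> W" "\<And>u w. u \<in> W \<Longrightarrow> w \<in> W \<Longrightarrow> u - w \<in> U"
      by (rule difference_neighbourhood[OF U(1,2)]) auto
    obtain T where T: "finite T" "closure V \<subseteq> (\<Union>t\<in>T. (+) t ` W)"
    proof (rule compactE_image[OF V(2), of UNIV "\<lambda>t. (+) t ` W"])
      show "closure V \<subseteq> (\<Union>t\<in>UNIV. (+) t ` W)" using W(2) by (force simp: image_iff)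
    qed (use open_image_add[OF W(1)] in auto)
    have "\<exists>E. (\<forall>t\<in>T. E t \<in> sets borel \<and> E t \<subseteq> V \<inter> (+) t ` W) \<and> disjoint_family_on E T \<and>
        (\<Union>t\<in>T. E t) = (\<Union>t\<in>T. V \<inter> (+) t ` W)"
      by (rule disjoint_refinement[OF T(1)]) (use V(1) open_image_add[OF W(1)] in auto)
    then obtain E where E: "\<And>t. t \<in> T \<Longrightarrow> E t \<in> sets borel" "\<And>t. t \<in> T \<Longrightarrow> E t \<subseteq> V \<inter> (+) t ` W"
      "disjoint_family_on E T" "(\<Union>t\<in>T. E t) = (\<Union>t\<in>T. V \<inter> (+) t ` W)" by metis
    have EV: "(\<Union>t\<in>T. E t) = V" unfolding E(4) using T(2) VV by auto
    define J where "J = {t\<in>T. E t \<noteq> {}}"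
    have J: "finite J" "J \<subseteq> T" using T(1) by (auto simp: J_def)
    define \<sigma> where "\<sigma> = (\<lambda>t. SOME s. s \<in> E t)"
    have \<sigma>: "\<sigma> t \<in> E t" if "t \<in> J" for t
      using that unfolding J_def \<sigma>_def by (auto intro: someI_ex)
    have \<sigma>V: "\<sigma> t \<in> V" if "t \<in> J" for t using \<sigma>[OF that] E(2)[of t] J that by blast
    have \<sigma>U: "s - \<sigma> t \<in> U" if t: "t \<in> J" and s: "s \<in> E t" for s t
    proof -
      have "s \<in> (+) t ` W" "\<sigma> t \<in> (+) t ` W" using \<sigma>[OF t] E(2)[of t] J t s by blast+
      then obtain w w' where "s = t + w" "w \<in> W" "\<sigma> t = t + w'" "w' \<in> W" by blast
      then show ?thesis using W(3)[of w w'] by simp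
    qed
    have EJ: "(\<Union>t\<in>J. E t) = V" using EV by (auto simp: J_def)
    have disj: "disjoint_family_on E J" using E(3) J(2) by (rule disjoint_family_on_mono[rotated])
    have Efin: "emeasure \<theta> (E t) < \<infinity>" if "t \<in> J" for t
    proof -
      have "emeasure \<theta> (E t) \<le> emeasure \<theta> V" using EJ that Vs by (intro emeasure_mono) auto
      then show ?thesis using mV by (simp add: le_less_trans)
    qed
    define c where "c = (\<lambda>t. measure \<theta> (E t) / m)"
    have c0: "c t \<ge> 0" for t using m by (simp add: c_def)
    have c1: "(\<Sum>t\<in>J. c t) = 1"
    proof -
      have "measure \<theta> (\<Union>t\<in>J. E t) = (\<Sum>t\<in>J. measure \<theta> (E t))"
        by (rule measure_finite_Union[OF J(1)]) (use E(1) J disj Efin in \<open>auto simp: less_top\<close>)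
      then have "(\<Sum>t\<in>J. measure \<theta> (E t)) = m" unfolding EJ m_def by simp
      then show ?thesis using m by (simp add: c_def flip: sum_divide_distrib)
    qed
    \<comment> \<open>The weighted sum is a Riemann sum for the mean of \<open>v (x + s)\<close>
      over \<open>s\<close> in \<open>V\<close>, with error \<open>r\<close>; passing from
      \<open>v\<close> to \<open>F\<close> costs another \<open>r\<close>, and passing from
      \<open>F (x + s)\<close> to \<open>F s\<close> costs \<open>d\<close> by hypothesis. The
      estimate is pointwise because \<open>x\<close> enters as the translation parameter.\<close>
    have Riemann: "norm ((\<Sum>t\<in>J. of_real (c t) * v (x + \<sigma> t)) - a) \<le> d + 2 * r" if x: "x \<in> B" for x
    proof -
      define w where "w = (\<lambda>s. \<Sum>t\<in>J. indicator (E t) s *\<^sub>R v (x + \<sigma> t))"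
      have w_eq: "w s = v (x + \<sigma> t)" if t: "t \<in> J" "s \<in> E t" for s t
      proof -
        have "w s = (\<Sum>t'\<in>J. if t' = t then v (x + \<sigma> t) else 0)"
          unfolding w_def
        proof (rule sum.cong[OF refl])
          fix t' assume "t' \<in> J"
          then show "indicator (E t') s *\<^sub>R v (x + \<sigma> t') = (if t' = t then v (x + \<sigma> t) else 0)"
            using disj t unfolding disjoint_family_on_def by (auto simp: indicator_def)
        qed
        then show ?thesis using J t by simp
      qed
      have iw: "integrable \<theta> w"
        unfolding w_def using E(1) J Efin
        by (intro Bochner_Integration.integrable_sum integrable_scaleR_left) (auto simp: less_top)
      have Iw: "(LINT s|\<theta>. w s) = (\<Sum>t\<in>J. measure \<theta> (E t) *\<^sub>R v (x + \<sigma> t))"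
        unfolding w_def using E(1) J Efin
        by (subst Bochner_Integration.integral_sum) (auto simp: less_top intro!: integrable_scaleR_left sum.cong)
      have diff: "(\<Sum>t\<in>J. of_real (c t) * v (x + \<sigma> t)) - a
          = (LINT s|\<theta>. w s - indicator V s *\<^sub>R F s) / of_real m"
      proof -
        have "(LINT s|\<theta>. w s - indicator V s *\<^sub>R F s) = (LINT s|\<theta>. w s) - (LINT s:V|\<theta>. F s)"
          using int iw unfolding set_integrable_def set_lebesgue_integral_def
          by (intro Bochner_Integration.integral_diff)
        moreover have "(\<Sum>t\<in>J. of_real (c t) * v (x + \<sigma> t)) = (LINT s|\<theta>. w s) / of_real m"
          unfolding Iw c_def by (simp add: sum_divide_distrib scaleR_conv_of_real)
        ultimately show ?thesis unfolding a_def by (simp add: diff_divide_distrib)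
      qed
      have p1: "norm (w s - F s) \<le> norm (v (s + x) - F (s + x)) + norm (F (s + x) - F s) + r" if s: "s \<in> V" for s
      proof -
        obtain t where t: "t \<in> J" "s \<in> E t" using s EJ by blast
        have "norm (v ((x + \<sigma> t) + (s - \<sigma> t)) - v (x + \<sigma> t)) < r" by (rule U(3)[OF \<sigma>U[OF t]])
        then have "norm (v (s + x) - w s) < r" by (simp add: w_eq[OF t] ac_simps)
        moreover have "norm (w s - F s) \<le> norm (w s - v (s + x)) + norm (v (s + x) - F (s + x)) + norm (F (s + x) - F s)"
          using norm_triangle_ineq[of "w s - v (s + x)" "(v (s + x) - F (s + x)) + (F (s + x) - F s)"]
            norm_triangle_ineq[of "v (s + x) - F (s + x)" "F (s + x) - F s"] by simp
        ultimately show ?thesis by (simp add: norm_minus_commute)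
      qed
      have Fx: "(\<lambda>s. F (s + x)) \<in> borel_measurable borel" "(\<lambda>s. v (s + x)) \<in> borel_measurable borel"
        by (intro measurable_shift Fm vm)+
      have m1: "(\<lambda>s. v (s + x) - F (s + x)) \<in> borel_measurable borel"
        "(\<lambda>s. F (s + x) - F s) \<in> borel_measurable borel"
        using Fx Fm by measurable
      have "(+) x ` V \<subseteq> Q" using BQ[OF x] by auto
      from Lp_le_subset[OF Lp_le_minus[OF v(2)] this]
      have "Lp_le V (\<lambda>s. v (s + x) - F (s + x)) (r * m powr (1 / p))"
        using Lp_le_shift[of "\<lambda>x. v x - F x" V x] Vs Fm vm by (simp add: k_def)
      then have i1: "(\<integral>\<^sup>+s\<in>V. ennreal (norm (v (s + x) - F (s + x))) \<partial>\<theta>) \<le> ennreal (r * m)"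
        by (rule nn_integral_norm_le[OF m1(1) Vs mV m]) (use r in simp)
      have i2: "(\<integral>\<^sup>+s\<in>V. ennreal (norm (F (s + x) - F s)) \<partial>\<theta>) \<le> ennreal (d * m)"
        by (rule nn_integral_norm_le[OF m1(2) Vs mV m _ d0]) (use close[of x] in \<open>simp add: k_def\<close>)
      have "ennreal (norm (LINT s|\<theta>. w s - indicator V s *\<^sub>R F s))
          \<le> (\<integral>\<^sup>+s. ennreal (norm (w s - indicator V s *\<^sub>R F s)) \<partial>\<theta>)"
        using int iw unfolding set_integrable_def
        by (intro integral_norm_bound_ennreal Bochner_Integration.integrable_diff)
      also have "\<dots> \<le> (\<integral>\<^sup>+s. (ennreal (norm (v (s + x) - F (s + x))) * indicator V s +
          ennreal (norm (F (s + x) - F s)) * indicator V s) + ennreal r * indicator V s \<partial>\<theta>)"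
      proof (rule nn_integral_mono)
        fix s
        show "ennreal (norm (w s - indicator V s *\<^sub>R F s)) \<le>
          (ennreal (norm (v (s + x) - F (s + x))) * indicator V s +
          ennreal (norm (F (s + x) - F s)) * indicator V s) + ennreal r * indicator V s"
        proof (cases "s \<in> V")
          case True
          then show ?thesis using ennreal_leI[OF p1[OF True]] r by simp
        next
          case False
          then have "w s = 0" unfolding w_def using EJ by (intro sum.neutral) (auto simp: indicator_def)
          then show ?thesis using False by simp
        qed
      qed
      also have "\<dots> = ((\<integral>\<^sup>+s\<in>V. ennreal (norm (v (s + x) - F (s + x))) \<partial>\<theta>) +
          (\<integral>\<^sup>+s\<in>V. ennreal (norm (F (s + x) - F s)) \<partial>\<theta>)) + ennreal r * ennreal m"
        using m1 Vs by (simp add: nn_integral_add nn_integral_cmult_indicator mV)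
      also have "\<dots> \<le> (ennreal (r * m) + ennreal (d * m)) + ennreal r * ennreal m"
        by (intro add_mono i1 i2) simp
      also have "\<dots> = ennreal ((d + 2 * r) * m)"
        using r d0 m by (simp add: ennreal_mult[symmetric] algebra_simps flip: ennreal_plus)
      finally have "norm (LINT s|\<theta>. w s - indicator V s *\<^sub>R F s) \<le> (d + 2 * r) * m"
        using r d0 m by (simp add: ennreal_le_iff)
      then show ?thesis unfolding diff using m by (simp add: norm_divide divide_le_eq)
    qed
    have Fs: "(\<lambda>x. F (x + \<sigma> t)) \<in> borel_measurable borel" "(\<lambda>x. v (x + \<sigma> t)) \<in> borel_measurable borel" for t
      by (intro measurable_shift Fm vm)+
    have s1: "Lp_le B (\<lambda>x. \<Sum>t\<in>J. of_real (c t) * (F x - F (x + \<sigma> t))) (\<Sum>t\<in>J. norm (complex_of_real (c t)) * (d * k))"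
    proof (rule Lp_le_sum[OF J(1) _ Bs])
      show "Lp_le B (\<lambda>x. F x - F (x + \<sigma> t)) (d * k)" for t
        using d[of "- \<sigma> t"] unfolding stepanov_le_def k_def m_def B_def by simp
      show "(\<lambda>x. F x - F (x + \<sigma> t)) \<in> borel_measurable borel" for t using Fm Fs by measurable
    qed
    have s2: "Lp_le B (\<lambda>x. \<Sum>t\<in>J. of_real (c t) * (F (x + \<sigma> t) - v (x + \<sigma> t))) (\<Sum>t\<in>J. norm (complex_of_real (c t)) * (r * k))"
    proof (rule Lp_le_sum[OF J(1) _ Bs])
      fix t assume t: "t \<in> J"
      have "(+) (\<sigma> t) ` B \<subseteq> Q" using BQ[OF _ \<sigma>V[OF t]] by (auto simp: add.commute)
      from Lp_le_subset[OF v(2) this]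
      show "Lp_le B (\<lambda>x. F (x + \<sigma> t) - v (x + \<sigma> t)) (r * k)"
        using Lp_le_shift[of "\<lambda>x. F x - v x" B "\<sigma> t"] Bs Fm vm by simp
      show "(\<lambda>x. F (x + \<sigma> t) - v (x + \<sigma> t)) \<in> borel_measurable borel" using Fs by measurable
    qed
    have cn: "(\<Sum>t\<in>J. norm (complex_of_real (c t)) * z) = z" for z
      using c0 c1 by (simp flip: sum_distrib_right)
    have Jm: "(\<lambda>x. \<Sum>t\<in>J. of_real (c t) * G x t) \<in> borel_measurable borel"
      if "\<And>t. (\<lambda>x. G x t) \<in> borel_measurable borel" for G :: "'a \<Rightarrow> 'a \<Rightarrow> complex"
      using that by measurable
    have s3: "Lp_le B (\<lambda>x. (\<Sum>t\<in>J. of_real (c t) * v (x + \<sigma> t)) - a) ((d + 2 * r) * m powr (1 / p))"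
      by (rule Lp_le_const[OF Bs]) (use Riemann mB m d0 r in auto)
    have m1: "(\<lambda>x. \<Sum>t\<in>J. of_real (c t) * (F x - F (x + \<sigma> t))) \<in> borel_measurable borel"
      by (rule Jm) (rule borel_measurable_diff[OF Fm Fs(1)])
    have m2: "(\<lambda>x. \<Sum>t\<in>J. of_real (c t) * (F (x + \<sigma> t) - v (x + \<sigma> t))) \<in> borel_measurable borel"
      by (rule Jm) (rule borel_measurable_diff[OF Fs])
    have m3: "(\<lambda>x. (\<Sum>t\<in>J. of_real (c t) * v (x + \<sigma> t)) - a) \<in> borel_measurable borel"
      by (rule borel_measurable_diff[OF Jm[OF Fs(2)] borel_measurable_const])
    \<comment> \<open>\<open>F\<close> is replaced by a convex combination of its translates (cost
      \<open>d\<close>), that by the one of the translates of \<open>v\<close> (cost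
      \<open>r\<close>), and that by \<open>a\<close> (cost \<open>d + 2 * r\<close>); this explains
      the factor 2 in the conclusion.\<close>
    have "Lp_le B (\<lambda>x. ((\<Sum>t\<in>J. of_real (c t) * (F x - F (x + \<sigma> t)))
        + (\<Sum>t\<in>J. of_real (c t) * (F (x + \<sigma> t) - v (x + \<sigma> t))))
        + ((\<Sum>t\<in>J. of_real (c t) * v (x + \<sigma> t)) - a)) (d * k + r * k + (d + 2 * r) * k)"
      by (rule Lp_le_add[OF borel_measurable_add[OF m1 m2] m3 Bs
            Lp_le_add[OF m1 m2 Bs s1[unfolded cn] s2[unfolded cn]] s3[folded k_def]])
    moreover have "((\<Sum>t\<in>J. of_real (c t) * (F x - F (x + \<sigma> t)))
        + (\<Sum>t\<in>J. of_real (c t) * (F (x + \<sigma> t) - v (x + \<sigma> t))))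
        + ((\<Sum>t\<in>J. of_real (c t) * v (x + \<sigma> t)) - a) = F x - a" for x
    proof -
      have "(\<Sum>t\<in>J. complex_of_real (c t) * F x) = F x"
        using c1 by (simp flip: sum_distrib_right of_real_sum)
      then show ?thesis by (simp add: right_diff_distrib sum_subtractf)
    qed
    moreover have "d * k + r * k + (d + 2 * r) * k \<le> 2 * d * k + e"
    proof -
      have "3 * r * k \<le> 3 * r * (1 + k)" using r by (intro mult_left_mono) auto
      also have "3 * r * (1 + k) = e"
        using iffD1[OF nonzero_eq_divide_eq r_def] k by simp
      finally show ?thesis by (simp add: algebra_simps)
    qed
    ultimately show "Lp_le ((+) y ` V) (\<lambda>x. F x - a) (2 * d * k + e)"
      using Lp_le_mono unfolding B_def by simp
  qed
  then have "stepanov_le V (\<lambda>x. F x - a) (2 * d)"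
    using d0 by (simp add: stepanov_le_def k_def m_def)
  then show ?thesis by (rule that)
qed

end

section \<open>Averages along a van Hove sequence\<close>

lemma uc_continuous:
  fixes D :: "'a::topological_ab_group_add \<Rightarrow> real"
  assumes "pseudonorm D" and D: "continuous_on UNIV D" and w: "pseudonorm.uc D w"
  shows "continuous_on UNIV w"
  unfolding continuous_on_topological
proof (intro ballI allI impI)
  interpret pseudonorm D by fact
  fix x B assume "open B" "w x \<in> B"
  then obtain e where e: "e > 0" "ball (w x) e \<subseteq> B" using openE by blast
  obtain d where d: "d > 0" "\<And>x y. D (x - y) < d \<Longrightarrow> norm (w x - w y) < e" by (rule ucE[OF w e(1)]) auto
  have "continuous_on UNIV (\<lambda>y::'a. y - x)"
    by (rule continuous_on_diff[OF continuous_on_id continuous_on_const])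
  then have "continuous_on UNIV (\<lambda>y. D (y - x))"
    by (rule continuous_on_compose2[OF D]) simp
  then have "open ((\<lambda>y. D (y - x)) -` {..<d})" by (rule open_vimage[OF open_lessThan])
  moreover have "w y \<in> B" if "y \<in> (\<lambda>y. D (y - x)) -` {..<d}" for y
    using d(2)[of y x] that e(2) by (auto simp: dist_norm norm_minus_commute)
  ultimately show "\<exists>A. open A \<and> x \<in> A \<and> (\<forall>y\<in>UNIV. y \<in> A \<longrightarrow> w y \<in> B)"
    using d(1) by (intro exI[of _ "(\<lambda>y. D (y - x)) -` {..<d}"]) auto
qed

context van_hove
begin

definition average :: "nat \<Rightarrow> ('a \<Rightarrow> complex) \<Rightarrow> complex" where
  "average n w = (LINT x:A n|\<theta>. w x) / of_real (measure \<theta> (A n))"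

lemma integrable_indicator_scaleR:
  fixes w :: "'a \<Rightarrow> 'b::{banach, second_countable_topology}"
  assumes w: "w \<in> borel_measurable borel" "\<And>x. norm (w x) \<le> b"
    and B: "B \<in> sets borel" "emeasure \<theta> B < \<infinity>"
  shows "integrable \<theta> (\<lambda>x. indicator B x *\<^sub>R w x)"
proof (rule integrableI_bounded_set[where A = B and B = b])
  show "(\<lambda>x. indicator B x *\<^sub>R w x) \<in> borel_measurable \<theta>" using w(1) B(1) by measurable
  show "AE x in \<theta>. x \<in> B \<longrightarrow> norm (indicator B x *\<^sub>R w x) \<le> b" using w(2) by simp
qed (use B in auto)

lemma A_finite: "emeasure \<theta> (A n) < \<infinity>"
  by (simp add: A_emeasure)

lemma average_of_real:
  "average n (\<lambda>x. of_real (h x)) = of_real ((LINT x|\<theta>. indicator (A n) x *\<^sub>R h x) / measure \<theta> (A n))"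
proof -
  have "(LINT x|\<theta>. indicator (A n) x *\<^sub>R complex_of_real (h x)) = (LINT x|\<theta>. complex_of_real (indicator (A n) x *\<^sub>R h x))"
    by (intro Bochner_Integration.integral_cong) (auto simp: scaleR_conv_of_real)
  also have "\<dots> = of_real (LINT x|\<theta>. indicator (A n) x *\<^sub>R h x)" by (rule integral_complex_of_real)
  finally show ?thesis by (simp add: average_def set_lebesgue_integral_def)
qed

lemma norm_average_le: "norm (average n w) \<le> Re (average n (\<lambda>x. of_real (norm (w x))))"
proof -
  have "norm (LINT x|\<theta>. indicator (A n) x *\<^sub>R w x) \<le> (LINT x|\<theta>. norm (indicator (A n) x *\<^sub>R w x))"
    by (rule integral_norm_bound)
  also have "\<dots> = (LINT x|\<theta>. indicator (A n) x *\<^sub>R norm (w x))"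
    by (intro Bochner_Integration.integral_cong) auto
  finally have "norm (LINT x|\<theta>. indicator (A n) x *\<^sub>R w x) / measure \<theta> (A n)
      \<le> (LINT x|\<theta>. indicator (A n) x *\<^sub>R norm (w x)) / measure \<theta> (A n)"
    by (rule divide_right_mono) simp
  then show ?thesis
    unfolding average_of_real by (simp add: average_def set_lebesgue_integral_def norm_divide)
qed

lemma average_bound:
  assumes w: "w \<in> borel_measurable borel" "\<And>x. norm (w x) \<le> b"
  shows "norm (average n w) \<le> b"
proof -
  have "norm (LINT x|\<theta>. indicator (A n) x *\<^sub>R w x) \<le> (LINT x|\<theta>. norm (indicator (A n) x *\<^sub>R w x))"
    by (rule integral_norm_bound)
  also have "\<dots> \<le> (LINT x|\<theta>. indicator (A n) x *\<^sub>R b)"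
  proof (rule integral_mono)
    show "integrable \<theta> (\<lambda>x. norm (indicator (A n) x *\<^sub>R w x))"
      by (rule integrable_norm[OF integrable_indicator_scaleR[OF w _ A_finite]]) simp
    show "integrable \<theta> (\<lambda>x. indicator (A n) x *\<^sub>R b)"
      by (rule integrable_indicator_scaleR[where b = "\<bar>b\<bar>", OF _ _ _ A_finite]) auto
  qed (use w(2) in \<open>simp add: indicator_def\<close>)
  also have "\<dots> = measure \<theta> (A n) * b" by simp
  finally show ?thesis
    using A_pos[of n] by (simp add: average_def set_lebesgue_integral_def norm_divide divide_le_eq mult.commute)
qed

text \<open>The two averages differ by an integral over the symmetric difference of
  \<open>A n\<close> and its translate \<open>B\<close>. One half lies in the van Hove boundary for
  \<open>{t}\<close>, the other is a translate of a set in the boundary for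
  \<open>{- t}\<close>.\<close>

lemma average_shift:
  assumes w: "w \<in> borel_measurable borel" "\<And>x. norm (w x) \<le> b" and e: "e > 0"
  shows "\<forall>\<^sub>F n in sequentially. norm (average n (\<lambda>x. w (x + t)) - average n w) \<le> e"
proof -
  have b: "b \<ge> 0" using w(2) norm_ge_zero order_trans by blast
  define r where "r = e / 2 / (b + 1)"
  have r: "r > 0" using e b by (simp add: r_def)
  have "b + 1 \<noteq> 0" using b by simp
  from iffD1[OF nonzero_eq_divide_eq[OF this] r_def] have r2: "2 * b * r \<le> e"
    using r by (simp add: algebra_simps)
  have f1: "\<forall>\<^sub>F n in sequentially. emeasure \<theta> (van_hove_boundary {t} (A n)) \<le> ennreal (r * measure \<theta> (A n))"
    by (rule boundary_small) (use r in auto)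
  have f2: "\<forall>\<^sub>F n in sequentially. emeasure \<theta> (van_hove_boundary {- t} (A n)) \<le> ennreal (r * measure \<theta> (A n))"
    by (rule boundary_small) (use r in auto)
  show ?thesis using f1 f2
  proof eventually_elim
    case (elim n)
    define m where "m = measure \<theta> (A n)"
    have m: "m > 0" using A_pos by (simp add: m_def)
    define B where "B = (+) t ` A n"
    have B: "B \<in> sets borel" unfolding B_def by (rule borel_image_add) simp
    have As: "A n \<in> sets borel" by simp
    have sub: "(+) s ` A n - A n \<subseteq> van_hove_boundary {s} (A n)" for s
    proof
      fix z assume z: "z \<in> (+) s ` A n - A n"
      then obtain a where a: "a \<in> A n" "z = a + s" by (auto simp: add.commute)
      have "z \<in> closure {a + k | a k. a \<in> A n \<and> k \<in> {s}}"
        by (rule subsetD[OF closure_subset]) (use a in blast)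
      then show "z \<in> van_hove_boundary {s} (A n)"
        using z unfolding van_hove_boundary_def by simp
    qed
    have le: "emeasure \<theta> ((+) s ` A n - A n) \<le> emeasure \<theta> (van_hove_boundary {s} (A n))" for s
      by (rule emeasure_mono[OF sub]) (simp add: boundary_measurable)
    have 1: "emeasure \<theta> (B - A n) \<le> ennreal (r * m)"
      using order_trans[OF le elim(1)] by (simp add: B_def m_def)
    have "A n - B = (+) t ` ((+) (- t) ` A n - A n)"
      unfolding B_def image_set_diff[OF inj_on_add] by (simp add: image_image)
    then have "emeasure \<theta> (A n - B) = emeasure \<theta> ((+) (- t) ` A n - A n)"
      using emeasure_image_add[of "(+) (- t) ` A n - A n" t] borel_image_add[OF As, of "- t"] As
      by (simp only: sets.Diff)
    then have 2: "emeasure \<theta> (A n - B) \<le> ennreal (r * m)"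
      using order_trans[OF le elim(2)] by (simp only: m_def)
    have mle: "measure \<theta> C \<le> r * m" if "emeasure \<theta> C \<le> ennreal (r * m)" for C
      unfolding measure_def by (rule enn2real_leI[OF _ that]) (use r m in auto)
    have Bf: "emeasure \<theta> B < \<infinity>" using emeasure_image_add[OF As] A_finite by (simp add: B_def)
    have fin: "emeasure \<theta> (B - A n) < \<infinity>" "emeasure \<theta> (A n - B) < \<infinity>"
      using 1 2 by (auto simp: le_less_trans)
    note iA = integrable_indicator_scaleR[OF w As A_finite]
    note iB = integrable_indicator_scaleR[OF w B Bf]
    have mw: "(\<lambda>x. indicator B x *\<^sub>R w x) \<in> borel_measurable borel" using w(1) B by measurable
    have "(LINT x|\<theta>. indicator B x *\<^sub>R w x) = (LINT x|distr \<theta> borel ((+) t). indicator B x *\<^sub>R w x)"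
      by (simp add: distr_add)
    also have "\<dots> = (LINT x|\<theta>. indicator B (t + x) *\<^sub>R w (t + x))"
      by (rule integral_distr) (use mw measurable_add_const in auto)
    also have "\<dots> = (LINT x|\<theta>. indicator (A n) x *\<^sub>R w (x + t))"
      by (intro Bochner_Integration.integral_cong) (auto simp: B_def indicator_def add.commute)
    finally have eq: "(LINT x|\<theta>. indicator (A n) x *\<^sub>R w (x + t)) - (LINT x|\<theta>. indicator (A n) x *\<^sub>R w x)
        = (LINT x|\<theta>. indicator B x *\<^sub>R w x - indicator (A n) x *\<^sub>R w x)"
      using iA iB by simp
    have i1: "integrable \<theta> (\<lambda>x. indicator (B - A n) x *\<^sub>R b)" "integrable \<theta> (\<lambda>x. indicator (A n - B) x *\<^sub>R b)"
      using fin B As b by (auto intro!: integrable_indicator_scaleR[where b = b])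
    have "norm (LINT x|\<theta>. indicator B x *\<^sub>R w x - indicator (A n) x *\<^sub>R w x)
        \<le> (LINT x|\<theta>. norm (indicator B x *\<^sub>R w x - indicator (A n) x *\<^sub>R w x))"
      by (rule integral_norm_bound)
    also have "\<dots> \<le> (LINT x|\<theta>. indicator (B - A n) x *\<^sub>R b + indicator (A n - B) x *\<^sub>R b)"
      using iA iB i1 w(2) by (intro integral_mono) (auto simp: indicator_def)
    also have "\<dots> = measure \<theta> (B - A n) * b + measure \<theta> (A n - B) * b"
      using i1 by simp
    also have "\<dots> \<le> (r * m) * b + (r * m) * b"
      by (intro add_mono mult_right_mono mle 1 2 b)
    also have "\<dots> = (2 * b * r) * m" by (simp add: algebra_simps)
    also have "\<dots> \<le> e * m" using r2 m by (intro mult_right_mono) auto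
    finally have "norm (LINT x|\<theta>. indicator B x *\<^sub>R w x - indicator (A n) x *\<^sub>R w x) \<le> e * m" .
    then show ?case
      unfolding average_def set_lebesgue_integral_def diff_divide_distrib[symmetric] eq
      using m by (simp add: norm_divide divide_le_eq m_def)
  qed
qed

text \<open>\<open>M\<close> is a pointwise cluster point of the averages over \<open>A n\<close>.
  Each law involves finitely many functions, so it passes from \<open>average n\<close> to
  \<open>M\<close> through a single suitable \<open>n\<close>; invariance holds for the averages
  only asymptotically and uses that \<open>n\<close> can be taken large.\<close>

theorem exists_invariant_mean:
  fixes D :: "'a \<Rightarrow> real"
  assumes "totally_bounded_pseudonorm D" and D: "continuous_on UNIV D"
  obtains M where "invariant_mean D M"
proof -
  interpret totally_bounded_pseudonorm D by fact
  have meas: "w \<in> borel_measurable borel" if w: "uc w" for w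
    by (rule borel_measurable_continuous_onI[OF uc_continuous[OF pseudonorm_axioms D w]])
  have "\<exists>b. uc w \<longrightarrow> 0 \<le> b \<and> (\<forall>x. norm (w x) \<le> b)" for w
    using uc_bounded[of w] by (metis less_imp_le)
  then obtain b where b: "\<And>w. uc w \<Longrightarrow> 0 \<le> b w" "\<And>w x. uc w \<Longrightarrow> norm (w x) \<le> b w" by metis
  \<comment> \<open>The value 0 off the \<open>uc\<close> functions gives every coordinate a bound,
    as compactness requires; the laws concern \<open>uc\<close> functions only.\<close>
  define X where "X = (\<lambda>n w. if uc w then average n w else 0)"
  have Xb: "norm (X n w) \<le> (if uc w then b w else 0)" for n w
    using average_bound[OF meas[of w] b(2)[of w], of n] by (simp add: X_def)
  obtain M where M: "\<And>F e N. finite F \<Longrightarrow> e > 0 \<Longrightarrow> \<exists>n\<ge>N. \<forall>i\<in>F. norm (X n i - M i) < e"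
    using pointwise_cluster_point[of X "\<lambda>w. if uc w then b w else 0", OF Xb] by metis
  have int: "integrable \<theta> (\<lambda>x. indicator (A n) x *\<^sub>R w x)" if "uc w" for w n
    by (rule integrable_indicator_scaleR[OF meas[OF that] b(2)[OF that] _ A_finite]) simp
  have av_add: "average n (\<lambda>x. f x + g x) = average n f + average n g" if "uc f" "uc g" for f g n
    using int[OF that(1), of n] int[OF that(2), of n]
    by (simp add: average_def set_lebesgue_integral_def scaleR_right_distrib add_divide_distrib)
  have av_cmult: "average n (\<lambda>x. c * f x) = c * average n f" if "uc f" for f c n
    using int[OF that, of n] by (simp add: average_def set_lebesgue_integral_def flip: mult_scaleR_right)
  have av_cnj: "average n (\<lambda>x. cnj (f x)) = cnj (average n f)" if "uc f" for f n
    using integral_bounded_linear[OF bounded_linear_cnj int[OF that, of n]]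
    by (simp add: average_def set_lebesgue_integral_def)
  have av_one: "average n (\<lambda>x. 1) = 1" for n
    using A_pos[of n] by (simp add: average_def set_lebesgue_integral_def scaleR_conv_of_real)
  have lim: "norm z \<le> 0" if "\<And>e. e > 0 \<Longrightarrow> norm z \<le> C * e" for z :: complex and C
    by (rule le_of_le_add_mult_eps[where C = C]) (use that in simp)
  have "invariant_mean D M"
  proof unfold_locales
    fix f g assume f: "uc f" and g: "uc g"
    have "norm (M (\<lambda>x. f x + g x) - (M f + M g)) \<le> 0"
    proof (rule lim[where C = 3])
      fix e :: real assume "e > 0"
      then obtain n where n: "\<forall>i\<in>{\<lambda>x. f x + g x, f, g}. norm (X n i - M i) < e"
        using M[of "{\<lambda>x. f x + g x, f, g}" e 0] by auto
      have "X n (\<lambda>x. f x + g x) = X n f + X n g" using f g by (simp add: X_def av_add uc_add)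
      then have "M (\<lambda>x. f x + g x) - (M f + M g)
          = ((X n f - M f) + (X n g - M g)) - (X n (\<lambda>x. f x + g x) - M (\<lambda>x. f x + g x))" by simp
      also have "norm \<dots> \<le> norm (X n f - M f) + norm (X n g - M g) + norm (X n (\<lambda>x. f x + g x) - M (\<lambda>x. f x + g x))"
        by (rule norm_add_diff_le)
      finally show "norm (M (\<lambda>x. f x + g x) - (M f + M g)) \<le> 3 * e" using n by auto
    qed
    then show "M (\<lambda>x. f x + g x) = M f + M g" by simp
  next
    fix f c assume f: "uc f"
    have "norm (M (\<lambda>x. c * f x) - c * M f) \<le> 0"
    proof (rule lim[where C = "1 + norm c"])
      fix e :: real assume "e > 0"
      then obtain n where n: "\<forall>i\<in>{\<lambda>x. c * f x, f}. norm (X n i - M i) < e"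
        using M[of "{\<lambda>x. c * f x, f}" e 0] by auto
      have "X n (\<lambda>x. c * f x) = c * X n f" using f by (simp add: X_def av_cmult uc_mult)
      then have "M (\<lambda>x. c * f x) - c * M f = c * (X n f - M f) - (X n (\<lambda>x. c * f x) - M (\<lambda>x. c * f x))"
        by (simp add: algebra_simps)
      also have "norm \<dots> \<le> norm c * norm (X n f - M f) + norm (X n (\<lambda>x. c * f x) - M (\<lambda>x. c * f x))"
        by (metis norm_mult norm_triangle_ineq4)
      also have "\<dots> \<le> norm c * e + e" using n by (intro add_mono mult_left_mono) auto
      finally show "norm (M (\<lambda>x. c * f x) - c * M f) \<le> (1 + norm c) * e" by (simp add: algebra_simps)
    qed
    then show "M (\<lambda>x. c * f x) = c * M f" by simp
  next
    have "norm (M (\<lambda>x. 1) - 1) \<le> 0"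
    proof (rule lim[where C = 1])
      fix e :: real assume "e > 0"
      then obtain n where "norm (X n (\<lambda>x. 1) - M (\<lambda>x. 1)) < e" using M[of "{\<lambda>x. 1}" e 0] by auto
      then show "norm (M (\<lambda>x. 1) - 1) \<le> 1 * e" by (simp add: X_def av_one norm_minus_commute)
    qed
    then show "M (\<lambda>x. 1) = 1" by simp
  next
    fix f assume f: "uc f"
    have "norm (M (\<lambda>x. cnj (f x)) - cnj (M f)) \<le> 0"
    proof (rule lim[where C = 2])
      fix e :: real assume "e > 0"
      then obtain n where n: "\<forall>i\<in>{\<lambda>x. cnj (f x), f}. norm (X n i - M i) < e"
        using M[of "{\<lambda>x. cnj (f x), f}" e 0] by auto
      have "X n (\<lambda>x. cnj (f x)) = cnj (X n f)" using f by (simp add: X_def av_cnj uc_cnj)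
      then have "M (\<lambda>x. cnj (f x)) - cnj (M f) = cnj (X n f - M f) - (X n (\<lambda>x. cnj (f x)) - M (\<lambda>x. cnj (f x)))"
        by simp
      also have "norm \<dots> \<le> norm (X n f - M f) + norm (X n (\<lambda>x. cnj (f x)) - M (\<lambda>x. cnj (f x)))"
        by (metis complex_mod_cnj norm_triangle_ineq4)
      finally show "norm (M (\<lambda>x. cnj (f x)) - cnj (M f)) \<le> 2 * e" using n by simp
    qed
    then show "M (\<lambda>x. cnj (f x)) = cnj (M f)" by simp
  next
    fix h :: "'a \<Rightarrow> real" assume h: "uc (\<lambda>x. of_real (h x))" "\<And>x. 0 \<le> h x"
    show "0 \<le> Re (M (\<lambda>x. of_real (h x)))"
    proof (rule le_of_le_add_mult_eps[where C = 1])
      fix e :: real assume "e > 0"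
      then obtain n where n: "norm (X n (\<lambda>x. of_real (h x)) - M (\<lambda>x. of_real (h x))) < e"
        using M[of "{\<lambda>x. of_real (h x)}" e 0] by auto
      have "0 \<le> (LINT x|\<theta>. indicator (A n) x *\<^sub>R h x) / measure \<theta> (A n)"
        using h(2) by (intro divide_nonneg_nonneg integral_nonneg_AE AE_I2) auto
      then have "0 \<le> Re (X n (\<lambda>x. of_real (h x)))"
        using h(1) by (simp add: X_def average_of_real)
      then show "0 \<le> Re (M (\<lambda>x. of_real (h x))) + 1 * e"
        using n abs_Re_le_cmod[of "X n (\<lambda>x. of_real (h x)) - M (\<lambda>x. of_real (h x))"] by simp
    qed
  next
    fix f assume f: "uc f"
    show "norm (M f) \<le> Re (M (\<lambda>x. of_real (norm (f x))))"
    proof (rule le_of_le_add_mult_eps[where C = 2])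
      fix e :: real assume "e > 0"
      then obtain n where n: "\<forall>i\<in>{\<lambda>x. of_real (norm (f x)), f}. norm (X n i - M i) < e"
        using M[of "{\<lambda>x. of_real (norm (f x)), f}" e 0] by auto
      have "norm (X n f) \<le> Re (X n (\<lambda>x. of_real (norm (f x))))"
        using norm_average_le[of n f] f by (simp add: X_def uc_norm)
      moreover have "norm (M f) \<le> norm (X n f) + norm (X n f - M f)"
        by (metis norm_triangle_sub norm_minus_commute)
      moreover have "Re (X n (\<lambda>x. of_real (norm (f x)))) \<le> Re (M (\<lambda>x. of_real (norm (f x)))) + e"
        using n abs_Re_le_cmod[of "X n (\<lambda>x. of_real (norm (f x))) - M (\<lambda>x. of_real (norm (f x)))"]
        by (simp add: abs_le_iff)
      ultimately show "norm (M f) \<le> Re (M (\<lambda>x. of_real (norm (f x)))) + 2 * e" using n by auto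
    qed
  next
    fix f t assume f: "uc f"
    have ft: "uc (\<lambda>x. f (x + t))" by (rule uc_shift[OF f])
    have "norm (M (\<lambda>x. f (x + t)) - M f) \<le> 0"
    proof (rule lim[where C = 3])
      fix e :: real assume e: "e > 0"
      obtain N where N: "\<And>n. n \<ge> N \<Longrightarrow> norm (average n (\<lambda>x. f (x + t)) - average n f) \<le> e"
        using average_shift[OF meas[OF f] b(2)[OF f] e, of t] unfolding eventually_sequentially by auto
      obtain n where n: "n \<ge> N" "\<forall>i\<in>{\<lambda>x. f (x + t), f}. norm (X n i - M i) < e"
        using M[of "{\<lambda>x. f (x + t), f}" e N] e by auto
      have "M (\<lambda>x. f (x + t)) - M f = (X n (\<lambda>x. f (x + t)) - X n f) + (X n f - M f) - (X n (\<lambda>x. f (x + t)) - M (\<lambda>x. f (x + t)))"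
        by simp
      also have "norm \<dots> \<le> norm (X n (\<lambda>x. f (x + t)) - X n f) + norm (X n f - M f) + norm (X n (\<lambda>x. f (x + t)) - M (\<lambda>x. f (x + t)))"
        by (rule norm_add_diff_le)
      also have "norm (X n (\<lambda>x. f (x + t)) - X n f) \<le> e" using N[OF n(1)] f ft by (simp add: X_def)
      finally show "norm (M (\<lambda>x. f (x + t)) - M f) \<le> 3 * e" using n(2) by auto
    qed
    then show "M (\<lambda>x. f (x + t)) = M f" by simp
  qed
  then show ?thesis by (rule that)
qed

end

section \<open>Weyl almost periods\<close>

locale weyl_function = weyl_setting \<theta> p A
  for \<theta> :: "'a::{topological_ab_group_add, t2_space} measure" and p A +
  fixes f :: "'a \<Rightarrow> complex"
  assumes f: "f \<in> Lp_loc \<theta> p"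
    and almost_period: "e > 0 \<Longrightarrow> \<exists>R N. relatively_dense R \<and>
      (\<forall>n\<ge>N. \<forall>t\<in>R. stepanov_le (A n) (\<lambda>x. f x - f (x - t)) e)"
begin

lemma fm: "f \<in> borel_measurable borel"
  by (rule Lp_loc_measurable[OF f])

lemma ftm: "(\<lambda>x. f (x - t)) \<in> borel_measurable borel"
  by (rule measurable_shift_minus[OF fm])

lemma fdm: "(\<lambda>x. f (x - s) - f (x - t)) \<in> borel_measurable borel"
  by (rule borel_measurable_diff[OF ftm ftm])

lemma fdm': "(\<lambda>x. f x - f (x - t)) \<in> borel_measurable borel"
  by (rule borel_measurable_diff[OF fm ftm])

lemma almost_periodE:
  assumes "e > 0"
  obtains R N K where "compact K" "\<And>y. \<exists>r\<in>R. \<exists>k\<in>K. y = r + k"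
    "\<And>n t. n \<ge> N \<Longrightarrow> t \<in> R \<Longrightarrow> stepanov_le (A n) (\<lambda>x. f x - f (x - t)) e"
proof -
  obtain R N where R: "relatively_dense R" "\<And>n t. n \<ge> N \<Longrightarrow> t \<in> R \<Longrightarrow> stepanov_le (A n) (\<lambda>x. f x - f (x - t)) e"
    using almost_period[OF assms] by blast
  obtain K where K: "compact K" "{r + k | r k. r \<in> R \<and> k \<in> K} = UNIV"
    using R(1) unfolding relatively_dense_def by blast
  have "\<exists>r\<in>R. \<exists>k\<in>K. y = r + k" for y
  proof -
    have "y \<in> {r + k | r k. r \<in> R \<and> k \<in> K}" using K(2) by simp
    then show ?thesis by blast
  qed
  with K(1) R(2) show ?thesis by (intro that[of K R N]) auto
qed

lemma stepanov_le_shift_iff: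
  assumes "g \<in> borel_measurable borel"
  shows "stepanov_le (A n) (\<lambda>x. g (x - t)) c \<longleftrightarrow> stepanov_le (A n) g c"
proof
  assume "stepanov_le (A n) (\<lambda>x. g (x - t)) c"
  from stepanov_le_translate[OF measurable_shift_minus[OF assms] A_open this, of t]
  show "stepanov_le (A n) g c" by simp
qed (rule stepanov_le_translate_minus[OF assms A_open])

lemma stepanov_diff_shift:
  "stepanov_le (A n) (\<lambda>x. f (x - s) - f (x - t)) c \<longleftrightarrow> stepanov_le (A n) (\<lambda>x. f x - f (x - (t - s))) c"
  using stepanov_le_shift_iff[OF fdm', of n s "t - s" c] by (simp add: algebra_simps)

lemma stepanov_diff_add:
  assumes "stepanov_le (A n) (\<lambda>x. f x - f (x - s)) a" "stepanov_le (A n) (\<lambda>x. f x - f (x - t)) b"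
  shows "stepanov_le (A n) (\<lambda>x. f x - f (x - (s + t))) (a + b)"
proof -
  have "stepanov_le (A n) (\<lambda>x. f (x - s) - f (x - (s + t))) b"
    using assms(2) by (simp add: stepanov_diff_shift)
  from stepanov_le_triangle[OF fm ftm ftm A_open assms(1) this] show ?thesis .
qed

lemma stepanov_diff_minus:
  assumes "stepanov_le (A n) (\<lambda>x. f x - f (x - s)) a"
  shows "stepanov_le (A n) (\<lambda>x. f x - f (x - (- s))) a"
proof -
  have "stepanov_le (A n) (\<lambda>x. f (x - s) - f (x - 0)) a"
    using stepanov_le_minus[OF assms] by simp
  then show ?thesis unfolding stepanov_diff_shift by simp
qed

text \<open>With \<open>y = r + k\<close>, the almost period \<open>r\<close> replaces the translate
  of \<open>A n\<close> by \<open>y\<close> with the one by \<open>k\<close>, at cost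
  \<open>e\<close>. The supremum over the whole group thus reduces to one compact set. The lemma is
  applied to \<open>f\<close> and to the differences \<open>f x - f (x - u)\<close>.\<close>

lemma local_bound:
  assumes K: "compact K" "\<And>y. \<exists>r\<in>R. \<exists>k\<in>K. y = r + k" and g: "g \<in> borel_measurable borel"
    and R: "\<And>t. t \<in> R \<Longrightarrow> stepanov_le (A n) (\<lambda>x. g x - g (x - t)) e"
    and Q: "Lp_le {k + a | k a. k \<in> K \<and> a \<in> closure (A n)} g (c * measure \<theta> (A n) powr (1 / p))" and c: "0 \<le> c"
  shows "stepanov_le (A n) g (e + c)"
  unfolding stepanov_le_def
proof (intro conjI allI)
  have e: "0 \<le> e" using K(2)[of 0] R stepanov_le_nonneg by blast
  then show "0 \<le> e + c" using c by simp
  fix y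
  define m where "m = measure \<theta> (A n) powr (1 / p)"
  obtain r k where rk: "r \<in> R" "k \<in> K" "y = r + k" using K(2)[of y] by blast
  have As: "A n \<in> sets borel" by simp
  have ys: "(+) y ` A n \<in> sets borel" by (rule borel_image_add[OF As])
  have gr: "(\<lambda>x. g (x - r)) \<in> borel_measurable borel" by (rule measurable_shift_minus[OF g])
  have 1: "Lp_le ((+) y ` A n) (\<lambda>x. g x - g (x - r)) (e * m)"
    using R[OF rk(1)] unfolding stepanov_le_def m_def by blast
  have "(+) k ` A n \<subseteq> {k + a | k a. k \<in> K \<and> a \<in> closure (A n)}"
    using rk(2) closure_subset by blast
  then have "Lp_le ((+) k ` A n) g (c * m)" using Lp_le_subset[OF Q] by (simp add: m_def)
  moreover have "(+) y ` A n = (+) r ` (+) k ` A n" unfolding rk(3) by (simp add: image_image add.assoc)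
  ultimately have 2: "Lp_le ((+) y ` A n) (\<lambda>x. g (x - r)) (c * m)"
    using Lp_le_shift[OF gr borel_image_add[OF As, of k], of r] by simp
  have "Lp_le ((+) y ` A n) (\<lambda>x. (g x - g (x - r)) + g (x - r)) (e * m + c * m)"
    by (rule Lp_le_add[OF borel_measurable_diff[OF g gr] gr ys 1 2])
  then show "Lp_le ((+) y ` A n) g ((e + c) * measure \<theta> (A n) powr (1 / p))"
    by (simp add: m_def distrib_right)
qed

lemma domination:
  obtains N where "\<And>n g c. n \<ge> N \<Longrightarrow> g \<in> borel_measurable borel \<Longrightarrow> stepanov_le (A k) g c \<Longrightarrow> stepanov_le (A n) g (2 * c)"
  using stepanov_le_domination[OF A_open A_precompact A_nonempty, of k]
  unfolding eventually_sequentially by blast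

lemma bounded:
  obtains c N where "c > 0" "\<And>n. n \<ge> N \<Longrightarrow> stepanov_le (A n) f c"
proof -
  obtain R N K where R: "compact K" "\<And>y. \<exists>r\<in>R. \<exists>k\<in>K. y = r + k"
    "\<And>n t. n \<ge> N \<Longrightarrow> t \<in> R \<Longrightarrow> stepanov_le (A n) (\<lambda>x. f x - f (x - t)) 1"
    by (rule almost_periodE[OF zero_less_one]) blast
  define m where "m = measure \<theta> (A N) powr (1 / p)"
  have m: "m > 0" using A_pos[of N] by (simp add: m_def)
  obtain c where c: "Lp_le {k + a | k a. k \<in> K \<and> a \<in> closure (A N)} f c"
    by (rule Lp_le_exists[OF f compact_set_plus[OF R(1) A_precompact[of N]]])
  have cm: "0 \<le> c / m" using Lp_le_nonneg[OF c] m by simp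
  have "stepanov_le (A N) f (1 + c / m)"
    by (rule local_bound[OF R(1,2) fm R(3)]) (use c cm m in \<open>auto simp: m_def[symmetric]\<close>)
  moreover obtain N' where "\<And>n g c. n \<ge> N' \<Longrightarrow> g \<in> borel_measurable borel \<Longrightarrow> stepanov_le (A N) g c \<Longrightarrow> stepanov_le (A n) g (2 * c)"
    using domination[of N] by blast
  ultimately have "stepanov_le (A n) f (2 * (1 + c / m))" if "n \<ge> N'" for n
    using fm that by blast
  then show ?thesis using cm by (intro that[of "2 * (1 + c / m)" N']) auto
qed

text \<open>Continuity of translations in local L^p gives smallness on a compact set only;
  \<open>local_bound\<close> extends it over the whole group at the fixed scale \<open>A N\<close>,
  and \<open>domination\<close> carries it to later scales.\<close>

lemma small_translates:
  assumes e: "e > 0"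
  obtains U N where "open U" "0 \<in> U" "\<And>n u. n \<ge> N \<Longrightarrow> u \<in> U \<Longrightarrow> stepanov_le (A n) (\<lambda>x. f x - f (x - u)) e"
proof -
  \<comment> \<open>For the difference \<open>f x - f (x - u)\<close> an almost period of
    \<open>f\<close> costs \<open>2 * d\<close>, continuity of translations on the compact set adds
    \<open>d\<close>, and \<open>domination\<close> doubles the sum:
    \<open>6 * d = e\<close>.\<close>
  define d where "d = e / 6"
  have d: "d > 0" using e by (simp add: d_def)
  obtain R N K where R: "compact K" "\<And>y. \<exists>r\<in>R. \<exists>k\<in>K. y = r + k"
    "\<And>n t. n \<ge> N \<Longrightarrow> t \<in> R \<Longrightarrow> stepanov_le (A n) (\<lambda>x. f x - f (x - t)) d"
    by (rule almost_periodE[OF d]) blast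
  define m where "m = measure \<theta> (A N) powr (1 / p)"
  have m: "m > 0" using A_pos[of N] by (simp add: m_def)
  have dm: "d * m > 0" using d m by simp
  obtain U where U: "open U" "0 \<in> U" "\<And>u. u \<in> U \<Longrightarrow>
      Lp_le {k + a | k a. k \<in> K \<and> a \<in> closure (A N)} (\<lambda>x. f (x - u) - f x) (d * m)"
    by (rule translation_continuity[OF f compact_set_plus[OF R(1) A_precompact[of N]] dm]) auto
  have "stepanov_le (A N) (\<lambda>x. f x - f (x - u)) ((d + d) + d)" if u: "u \<in> U" for u
  proof (rule local_bound[OF R(1,2) fdm'])
    show "Lp_le {k + a | k a. k \<in> K \<and> a \<in> closure (A N)} (\<lambda>x. f x - f (x - u)) (d * measure \<theta> (A N) powr (1 / p))"
      using Lp_le_minus[OF U(3)[OF u]] by (simp add: m_def)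
    fix t assume t: "t \<in> R"
    have 1: "stepanov_le (A N) (\<lambda>x. f x - f (x - t)) d" using R(3)[OF _ t] by simp
    then have "stepanov_le (A N) (\<lambda>x. f (x - u) - f (x - (u + t))) d"
      by (simp add: stepanov_diff_shift)
    then have 2: "stepanov_le (A N) (\<lambda>x. f (x - u - t) - f (x - u)) d"
      using stepanov_le_minus by (simp only: diff_diff_eq)
    have m2: "(\<lambda>x. f (x - u - t) - f (x - u)) \<in> borel_measurable borel"
      using fdm[of "u + t" u] by (simp add: diff_diff_eq)
    show "stepanov_le (A N) (\<lambda>x. (f x - f (x - u)) - (f (x - t) - f (x - t - u))) (d + d)"
      using stepanov_le_add[OF fdm' m2 A_open 1 2] by (simp add: algebra_simps)
  qed (use d in simp)
  moreover obtain N' where "\<And>n g c. n \<ge> N' \<Longrightarrow> g \<in> borel_measurable borel \<Longrightarrow> stepanov_le (A N) g c \<Longrightarrow> stepanov_le (A n) g (2 * c)"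
    using domination[of N] by blast
  ultimately have "stepanov_le (A n) (\<lambda>x. f x - f (x - u)) (2 * (d + d + d))" if "n \<ge> N'" "u \<in> U" for n u
    using fdm' that by blast
  then show ?thesis using U(1,2) by (intro that[of U N']) (auto simp: d_def)
qed

text \<open>Write \<open>t = r + k\<close> with an almost period \<open>r\<close>, and cover the
  compact set of all \<open>k\<close> by finitely many translates of \<open>U\<close>, so that
  \<open>k = s + u\<close>; then \<open>t - s = r + u\<close> is an almost period up to
  \<open>e\<close>. The threshold \<open>N\<close> is common to all \<open>t\<close>.\<close>

lemma finite_net:
  assumes e: "e > 0"
  obtains F N where "finite F" "\<And>t. \<exists>s\<in>F. \<forall>n\<ge>N. stepanov_le (A n) (\<lambda>x. f x - f (x - (t - s))) e"
proof -
  have e2: "e / 2 > 0" using e by simp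
  obtain R N1 K where R: "compact K" "\<And>y. \<exists>r\<in>R. \<exists>k\<in>K. y = r + k"
    "\<And>n t. n \<ge> N1 \<Longrightarrow> t \<in> R \<Longrightarrow> stepanov_le (A n) (\<lambda>x. f x - f (x - t)) (e / 2)"
    by (rule almost_periodE[OF e2]) blast
  obtain U N2 where U: "open U" "0 \<in> U" "\<And>n u. n \<ge> N2 \<Longrightarrow> u \<in> U \<Longrightarrow> stepanov_le (A n) (\<lambda>x. f x - f (x - u)) (e / 2)"
    by (rule small_translates[OF e2]) blast
  obtain F where F: "finite F" "K \<subseteq> (\<Union>t\<in>F. (+) t ` U)"
  proof (rule compactE_image[OF R(1), of UNIV "\<lambda>t. (+) t ` U"])
    show "K \<subseteq> (\<Union>t\<in>UNIV. (+) t ` U)" using U(2) by (force simp: image_iff)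
  qed (use open_image_add[OF U(1)] in auto)
  show ?thesis
  proof (rule that[OF F(1), of "max N1 N2"])
    fix t
    obtain r k where rk: "r \<in> R" "k \<in> K" "t = r + k" using R(2)[of t] by blast
    obtain s u where su: "s \<in> F" "u \<in> U" "k = s + u" using F(2) rk(2) by blast
    have "stepanov_le (A n) (\<lambda>x. f x - f (x - (t - s))) e" if n: "n \<ge> max N1 N2" for n
    proof -
      have "stepanov_le (A n) (\<lambda>x. f x - f (x - (r + u))) (e / 2 + e / 2)"
        by (rule stepanov_diff_add) (use R(3)[OF _ rk(1), of n] U(3)[OF _ su(2), of n] n in auto)
      moreover have "t - s = r + u" using rk su by simp
      ultimately show ?thesis by simp
    qed
    then show "\<exists>s\<in>F. \<forall>n\<ge>max N1 N2. stepanov_le (A n) (\<lambda>x. f x - f (x - (t - s))) e" using su(1) by blast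
  qed
qed

text \<open>The limsup of the Stepanov norms of \<open>f x - f (x - t)\<close>, written as the
  infimum of the eventual bounds in order to stay in the reals; by \<open>bounded\<close> such
  bounds exist.\<close>

definition weyl_dist :: "'a \<Rightarrow> real" where
  "weyl_dist t = Inf {c. \<exists>N. \<forall>n\<ge>N. stepanov_le (A n) (\<lambda>x. f x - f (x - t)) c}"

lemma weyl_dist_le:
  assumes "\<And>n. n \<ge> N \<Longrightarrow> stepanov_le (A n) (\<lambda>x. f x - f (x - t)) c"
  shows "weyl_dist t \<le> c"
  unfolding weyl_dist_def
proof (rule cInf_lower)
  show "bdd_below {c. \<exists>N. \<forall>n\<ge>N. stepanov_le (A n) (\<lambda>x. f x - f (x - t)) c}"
    by (rule bdd_belowI[of _ 0]) (use stepanov_le_nonneg in blast)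
qed (use assms in blast)

lemma weyl_dist_less:
  assumes "weyl_dist t < c"
  obtains N where "\<And>n. n \<ge> N \<Longrightarrow> stepanov_le (A n) (\<lambda>x. f x - f (x - t)) c"
proof -
  obtain c0 N0 where c0: "\<And>n. n \<ge> N0 \<Longrightarrow> stepanov_le (A n) f c0" using bounded by blast
  have "stepanov_le (A n) (\<lambda>x. f x - f (x - t)) (c0 + c0)" if "n \<ge> N0" for n
  proof -
    have "stepanov_le (A n) (\<lambda>x. - f (x - t)) c0"
      using stepanov_le_dominated[OF stepanov_le_translate_minus[OF fm A_open c0[OF that], of t]] by simp
    from stepanov_le_add[OF fm borel_measurable_uminus[OF ftm] A_open c0[OF that] this] show ?thesis by simp
  qed
  then have "{c. \<exists>N. \<forall>n\<ge>N. stepanov_le (A n) (\<lambda>x. f x - f (x - t)) c} \<noteq> {}" by blast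
  from cInf_lessD[OF this assms[unfolded weyl_dist_def]] obtain d N
    where "d < c" "\<And>n. n \<ge> N \<Longrightarrow> stepanov_le (A n) (\<lambda>x. f x - f (x - t)) d" by blast
  then show ?thesis by (intro that[of N] stepanov_le_mono[of _ _ d c]) auto
qed

sublocale totally_bounded_pseudonorm weyl_dist
proof
  have nn: "0 \<le> weyl_dist t" for t
  proof (rule ccontr)
    assume "\<not> ?thesis"
    then have "weyl_dist t < 0" by simp
    then obtain N where "\<And>n. n \<ge> N \<Longrightarrow> stepanov_le (A n) (\<lambda>x. f x - f (x - t)) (weyl_dist t / 2)"
      using weyl_dist_less[of t "weyl_dist t / 2"] by auto
    then have "0 \<le> weyl_dist t / 2" using stepanov_le_nonneg by blast
    with \<open>weyl_dist t < 0\<close> show False by simp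
  qed
  have "stepanov_le (A n) (\<lambda>x. f x - f (x - 0)) 0" for n
    by (rule stepanov_le_const) (auto simp: A_precompact)
  then show "weyl_dist 0 = 0" using nn[of 0] weyl_dist_le[of 0 0 0] by simp
  have le: "weyl_dist (- t) \<le> weyl_dist t" for t
  proof (rule field_le_epsilon)
    fix e :: real assume "e > 0"
    then obtain N where "\<And>n. n \<ge> N \<Longrightarrow> stepanov_le (A n) (\<lambda>x. f x - f (x - t)) (weyl_dist t + e)"
      using weyl_dist_less[of t "weyl_dist t + e"] by auto
    then show "weyl_dist (- t) \<le> weyl_dist t + e"
      by (intro weyl_dist_le[of N]) (rule stepanov_diff_minus)
  qed
  show "weyl_dist (- t) = weyl_dist t" for t using le[of t] le[of "- t"] by simp
  show "weyl_dist (s + t) \<le> weyl_dist s + weyl_dist t" for s t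
  proof (rule le_of_le_add_mult_eps[where C = 2])
    fix e :: real assume e: "e > 0"
    obtain N where N: "\<And>n. n \<ge> N \<Longrightarrow> stepanov_le (A n) (\<lambda>x. f x - f (x - s)) (weyl_dist s + e)"
      using weyl_dist_less[of s "weyl_dist s + e"] e by auto
    obtain N' where N': "\<And>n. n \<ge> N' \<Longrightarrow> stepanov_le (A n) (\<lambda>x. f x - f (x - t)) (weyl_dist t + e)"
      using weyl_dist_less[of t "weyl_dist t + e"] e by auto
    have "weyl_dist (s + t) \<le> (weyl_dist s + e) + (weyl_dist t + e)"
      by (rule weyl_dist_le[of "max N N'"], rule stepanov_diff_add) (use N N' in auto)
    then show "weyl_dist (s + t) \<le> weyl_dist s + weyl_dist t + 2 * e" by simp
  qed
  fix e :: real assume e: "e > 0"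
  then have e2: "e / 2 > 0" by simp
  obtain F N where F: "finite F" "\<And>t. \<exists>s\<in>F. \<forall>n\<ge>N. stepanov_le (A n) (\<lambda>x. f x - f (x - (t - s))) (e / 2)"
    by (rule finite_net[OF e2]) blast
  have "\<exists>s\<in>F. weyl_dist (t - s) < e" for t
  proof -
    obtain s where s: "s \<in> F" "\<And>n. n \<ge> N \<Longrightarrow> stepanov_le (A n) (\<lambda>x. f x - f (x - (t - s))) (e / 2)"
      using F(2)[of t] by blast
    have "weyl_dist (t - s) \<le> e / 2" by (rule weyl_dist_le[OF s(2)])
    then show ?thesis using s(1) e by (intro bexI[of _ s]) auto
  qed
  then show "\<exists>F. finite F \<and> (\<forall>t. \<exists>s\<in>F. weyl_dist (t - s) < e)" using F(1) by blast
qed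

lemma weyl_dist_continuous: "continuous_on UNIV weyl_dist"
  unfolding continuous_on_topological
proof (intro ballI allI impI)
  fix x B assume "open B" "weyl_dist x \<in> B"
  then obtain e where e: "e > 0" "ball (weyl_dist x) e \<subseteq> B" using openE by blast
  then have e2: "e / 2 > 0" by simp
  obtain U N where U: "open U" "0 \<in> U" "\<And>n u. n \<ge> N \<Longrightarrow> u \<in> U \<Longrightarrow> stepanov_le (A n) (\<lambda>x. f x - f (x - u)) (e / 2)"
    by (rule small_translates[OF e2]) blast
  have "weyl_dist y \<in> B" if y: "y \<in> (+) x ` U" for y
  proof -
    have "y - x \<in> U" using y by auto
    then have "weyl_dist (y - x) \<le> e / 2" by (intro weyl_dist_le[of N] U(3))
    then have "\<bar>weyl_dist x - weyl_dist y\<bar> < e"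
      using D_diff[of x y] D_commute[of x y] e(1) by linarith
    then show ?thesis using e(2) by (auto simp: dist_real_def)
  qed
  moreover have "x \<in> (+) x ` U" using U(2) by (force simp: image_iff)
  ultimately show "\<exists>A. open A \<and> x \<in> A \<and> (\<forall>y\<in>UNIV. y \<in> A \<longrightarrow> weyl_dist y \<in> B)"
    using open_image_add[OF U(1)] by (intro exI[of _ "(+) x ` U"]) auto
qed

text \<open>For a single \<open>t\<close> the bound holds from a threshold that depends on
  \<open>t\<close>. A finite net makes the threshold uniform: every \<open>t\<close> is close to
  some \<open>s\<close> in \<open>F\<close> from a common index on, and the finitely many thresholds
  of the \<open>s\<close> have a maximum.\<close>

lemma uniform_weyl_dist:
  assumes d: "d > 0"
  obtains N where "\<And>n t. n \<ge> N \<Longrightarrow> stepanov_le (A n) (\<lambda>x. f x - f (x - t)) (weyl_dist t + d)"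
proof -
  have d4: "d / 4 > 0" using d by simp
  obtain F N where F: "finite F" "\<And>t. \<exists>s\<in>F. \<forall>n\<ge>N. stepanov_le (A n) (\<lambda>x. f x - f (x - (t - s))) (d / 4)"
    by (rule finite_net[OF d4]) blast
  have "\<exists>N. \<forall>n\<ge>N. stepanov_le (A n) (\<lambda>x. f x - f (x - s)) (weyl_dist s + d / 4)" for s
    using weyl_dist_less[of s "weyl_dist s + d / 4"] d4 by (metis less_add_same_cancel1)
  then obtain N' where N': "\<And>s n. n \<ge> N' s \<Longrightarrow> stepanov_le (A n) (\<lambda>x. f x - f (x - s)) (weyl_dist s + d / 4)" by metis
  define N2 where "N2 = Max (insert N (N' ` F))"
  have N2: "N \<le> N2" "\<And>s. s \<in> F \<Longrightarrow> N' s \<le> N2" using F(1) by (auto simp: N2_def)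
  show ?thesis
  proof (rule that[of N2])
    fix n t assume n: "n \<ge> N2"
    obtain s where s: "s \<in> F" "\<And>n. n \<ge> N \<Longrightarrow> stepanov_le (A n) (\<lambda>x. f x - f (x - (t - s))) (d / 4)"
      using F(2)[of t] by blast
    have "weyl_dist (t - s) \<le> d / 4" by (rule weyl_dist_le[OF s(2)])
    then have ds: "weyl_dist s \<le> weyl_dist t + d / 4" using D_diff[of t s] by linarith
    have "stepanov_le (A n) (\<lambda>x. f x - f (x - ((t - s) + s))) (d / 4 + (weyl_dist s + d / 4))"
      by (rule stepanov_diff_add) (use s(2)[of n] N'[of s n] N2(1) N2(2)[OF s(1)] n in auto)
    then show "stepanov_le (A n) (\<lambda>x. f x - f (x - t)) (weyl_dist t + d)"
      using stepanov_le_mono[of "A n" _ "d / 4 + (weyl_dist s + d / 4)" "weyl_dist t + d"] ds d by simp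
  qed
qed

end

section \<open>Smoothing by characters and trigonometric approximation\<close>

locale weyl_mean = weyl_function \<theta> p A f
  for \<theta> :: "'a::{topological_ab_group_add, t2_space} measure" and p A f +
  fixes M :: "('a \<Rightarrow> complex) \<Rightarrow> complex"
  assumes mean: "invariant_mean weyl_dist M"
begin

sublocale invariant_mean weyl_dist M
  by (rule mean)

lemma ap_character_continuous:
  assumes "ap_character \<xi>" shows "continuous_character \<xi>"
  using assms uc_continuous[OF pseudonorm_axioms weyl_dist_continuous, of \<xi>]
  by (auto simp: ap_character_def continuous_character_def)

lemma norm_mean_weighted_le:
  assumes w: "uc w" "\<And>x. norm (w x) \<le> b" and h: "uc (\<lambda>x. of_real (h x))" "\<And>x. 0 \<le> h x"
  shows "norm (M (\<lambda>s. w s * of_real (h s))) \<le> b * Re (M (\<lambda>s. of_real (h s)))"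
proof -
  have b: "0 \<le> b" using w(2) norm_ge_zero order_trans by blast
  have uwh: "uc (\<lambda>s. w s * of_real (h s))" by (rule uc_mult[OF w(1) h(1)])
  have ub: "uc (\<lambda>s. of_real (b * h s))" using uc_mult[OF uc_const h(1), of "of_real b"] by simp
  have "norm (M (\<lambda>s. w s * of_real (h s))) \<le> Re (M (\<lambda>x. of_real (norm (w x * of_real (h x)))))"
    by (rule M_norm_le[OF uwh])
  also have "\<dots> \<le> Re (M (\<lambda>x. of_real (b * h x)))"
    by (rule M_mono[OF uc_norm[OF uwh] ub]) (use w(2) h(2) in \<open>simp add: norm_mult mult_right_mono\<close>)
  also have "M (\<lambda>x. of_real (b * h x)) = of_real b * M (\<lambda>x. of_real (h x))"
    using M_cmult[OF h(1), of "of_real b"] by simp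
  finally show ?thesis by simp
qed

definition smoothing :: "('a \<Rightarrow> 'a \<Rightarrow> real) \<Rightarrow> 'a set \<Rightarrow> ('a \<Rightarrow> complex) \<Rightarrow> 'a \<Rightarrow> complex" where
  "smoothing \<phi> F w x = (\<Sum>j\<in>F. M (\<lambda>s. w s * of_real (\<phi> j s)) * f (x - j))"

lemma smoothing_measurable: "smoothing \<phi> F w \<in> borel_measurable borel"
  unfolding smoothing_def by (intro borel_measurable_sum borel_measurable_times borel_measurable_const ftm)

lemma Lp_loc_smoothing_mult:
  assumes F: "finite F" and \<xi>: "\<xi> \<in> borel_measurable borel" "\<And>x. norm (\<xi> x) = 1"
  shows "(\<lambda>x. \<xi> x * smoothing \<phi> F w x) \<in> Lp_loc \<theta> p"
proof (rule Lp_locI)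
  show "(\<lambda>x. \<xi> x * smoothing \<phi> F w x) \<in> borel_measurable borel"
    by (rule borel_measurable_times[OF \<xi>(1) smoothing_measurable])
  fix Q :: "'a set" assume Q: "compact Q"
  have Qs: "Q \<in> sets borel" using compact_sets[OF Q] by simp
  have "\<exists>c. Lp_le Q (\<lambda>x. f (x - j)) c" for j
  proof -
    obtain c where "Lp_le ((+) (- j) ` Q) f c" by (rule Lp_le_exists[OF f compact_image_add[OF Q]])
    then show ?thesis using Lp_le_shift[OF fm Qs, of "- j" c] by auto
  qed
  then obtain c where c: "\<And>j. Lp_le Q (\<lambda>x. f (x - j)) (c j)" by metis
  have "Lp_le Q (smoothing \<phi> F w) (\<Sum>j\<in>F. norm (M (\<lambda>s. w s * of_real (\<phi> j s))) * c j)"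
    unfolding smoothing_def by (rule Lp_le_sum[OF F ftm Qs c])
  then have "Lp_le Q (\<lambda>x. \<xi> x * smoothing \<phi> F w x) (\<Sum>j\<in>F. norm (M (\<lambda>s. w s * of_real (\<phi> j s))) * c j)"
    by (rule Lp_le_dominated[OF _ order_refl]) (simp add: norm_mult \<xi>(2))
  then show "\<exists>c. Lp_le Q (\<lambda>x. \<xi> x * smoothing \<phi> F w x) c" by (rule exI)
qed

text \<open>
  Up to a small error, \<open>smoothing \<phi> F \<xi>\<close> is the mean of \<open>\<xi> s * f (x - s)\<close> over \<open>s\<close>, which
  transforms under translations like the character \<open>\<xi>\<close>.
\<close>

lemma smoothing_character:
  assumes F: "finite F" and \<phi>: "\<And>s. uc (\<lambda>x. of_real (\<phi> s x))" "\<And>s x. 0 \<le> \<phi> s x" "\<And>x. (\<Sum>s\<in>F. \<phi> s x) = 1"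
    "\<And>s x. \<phi> s x \<noteq> 0 \<Longrightarrow> weyl_dist (x - s) < e" and e: "e > 0" and \<xi>: "ap_character \<xi>"
  obtains a N where "\<And>n. n \<ge> N \<Longrightarrow> stepanov_le (A n) (\<lambda>x. smoothing \<phi> F \<xi> x - a * \<xi> x) (12 * e)"
proof -
  note \<xi>D = ap_characterD[OF \<xi>]
  have \<xi>m: "(\<lambda>x. cnj (\<xi> x)) \<in> borel_measurable borel" "\<xi> \<in> borel_measurable borel"
    using borel_measurable_continuous_onI[OF uc_continuous[OF pseudonorm_axioms weyl_dist_continuous]]
      \<xi>D(1) uc_cnj[OF \<xi>D(1)] by auto
  define G where "G = (\<lambda>x. cnj (\<xi> x) * smoothing \<phi> F \<xi> x)"
  have G: "G \<in> Lp_loc \<theta> p"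
    unfolding G_def by (rule Lp_loc_smoothing_mult[OF F \<xi>m(1)]) (simp add: \<xi>D(2))
  obtain N where N: "\<And>n t. n \<ge> N \<Longrightarrow> stepanov_le (A n) (\<lambda>x. f x - f (x - t)) (weyl_dist t + e)"
    using uniform_weyl_dist[OF e] by blast
  have inv: "stepanov_le (A N) (\<lambda>x. G x - G (x - t)) (3 * e)" for t
  proof -
    have \<phi>t: "uc (\<lambda>s. of_real (\<phi> j (s - t)))" for j using uc_shift_minus[OF \<phi>(1)] .
    \<comment> \<open>Weights for the common refinement of the partition and its translate by
      \<open>t\<close>. Summed over the second index they give the coefficients of
      \<open>smoothing \<phi> F \<xi> x\<close> (\<open>left\<close>), summed over the first index
      those of \<open>\<xi> t * smoothing \<phi> F \<xi> (x - t)\<close> (\<open>right\<close>), so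
      the two finite sums can be compared term by term.\<close>
    define c where "c = (\<lambda>z. M (\<lambda>s. \<xi> s * of_real (\<phi> (fst z) s * \<phi> (snd z) (s - t))))"
    define m where "m = (\<lambda>z. Re (M (\<lambda>s. of_real (\<phi> (fst z) s * \<phi> (snd z) (s - t)))))"
    have u2: "uc (\<lambda>s. of_real (\<phi> i s * \<phi> j (s - t)))" for i j
      using uc_mult[OF \<phi>(1) \<phi>t] by simp
    have cm: "norm (c z) \<le> m z" for z
      using norm_mean_weighted_le[OF \<xi>D(1) _ u2, of 1 "fst z" "snd z"] \<phi>(2) \<xi>D(2)
      by (simp add: c_def m_def)
    have msum: "(\<Sum>z\<in>F \<times> F. m z) = 1"
    proof -
      have "(\<Sum>z\<in>F \<times> F. m z) = Re (\<Sum>z\<in>F \<times> F. M (\<lambda>s. of_real (\<phi> (fst z) s * \<phi> (snd z) (s - t))))"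
        by (simp add: m_def)
      also have "(\<Sum>z\<in>F \<times> F. M (\<lambda>s. of_real (\<phi> (fst z) s * \<phi> (snd z) (s - t))))
          = M (\<lambda>s. \<Sum>z\<in>F \<times> F. of_real (\<phi> (fst z) s * \<phi> (snd z) (s - t)))"
        by (rule M_sum[symmetric]) (rule u2)
      also have "(\<lambda>s. \<Sum>z\<in>F \<times> F. complex_of_real (\<phi> (fst z) s * \<phi> (snd z) (s - t))) = (\<lambda>s. 1)"
      proof
        fix s
        have "(\<Sum>z\<in>F \<times> F. \<phi> (fst z) s * \<phi> (snd z) (s - t)) = (\<Sum>i\<in>F. \<phi> i s) * (\<Sum>j\<in>F. \<phi> j (s - t))"
          by (simp add: sum_product sum.cartesian_product case_prod_beta)
        then show "(\<Sum>z\<in>F \<times> F. complex_of_real (\<phi> (fst z) s * \<phi> (snd z) (s - t))) = 1"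
          by (simp only: \<phi>(3) of_real_sum[symmetric] mult_1 of_real_1)
      qed
      finally show ?thesis by simp
    qed
    have left: "M (\<lambda>s. \<xi> s * of_real (\<phi> i s)) = (\<Sum>j\<in>F. c (i, j))" for i
    proof -
      have "(\<Sum>j\<in>F. c (i, j)) = M (\<lambda>s. \<Sum>j\<in>F. \<xi> s * of_real (\<phi> i s * \<phi> j (s - t)))"
        unfolding c_def fst_conv snd_conv by (rule M_sum[symmetric]) (rule uc_mult[OF \<xi>D(1) u2])
      also have "(\<lambda>s. \<Sum>j\<in>F. \<xi> s * of_real (\<phi> i s * \<phi> j (s - t))) = (\<lambda>s. \<xi> s * of_real (\<phi> i s))"
        by (simp add: \<phi>(3) flip: sum_distrib_left of_real_sum)
      finally show ?thesis by simp
    qed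
    have right: "\<xi> t * M (\<lambda>s. \<xi> s * of_real (\<phi> j s)) = (\<Sum>i\<in>F. c (i, j))" for j
    proof -
      have us: "uc (\<lambda>s. \<xi> s * of_real (\<phi> j s))" by (rule uc_mult[OF \<xi>D(1) \<phi>(1)])
      have "\<xi> t * M (\<lambda>s. \<xi> s * of_real (\<phi> j s)) = \<xi> t * M (\<lambda>s. \<xi> (s - t) * of_real (\<phi> j (s - t)))"
        using M_shift'[OF us, of t] by simp
      also have "\<dots> = M (\<lambda>s. \<xi> t * (\<xi> (s - t) * of_real (\<phi> j (s - t))))"
        by (rule M_cmult[symmetric]) (rule uc_shift_minus[OF us])
      also have "(\<lambda>s. \<xi> t * (\<xi> (s - t) * of_real (\<phi> j (s - t)))) = (\<lambda>s. \<Sum>i\<in>F. \<xi> s * of_real (\<phi> i s * \<phi> j (s - t)))"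
      proof
        fix s
        have "\<xi> t * \<xi> (s - t) = \<xi> s" using \<xi>D(3)[of t "s - t"] by simp
        then have "\<xi> t * (\<xi> (s - t) * of_real (\<phi> j (s - t))) = \<xi> s * of_real (\<phi> j (s - t))"
          by (simp only: mult.assoc[symmetric])
        also have "\<dots> = (\<Sum>i\<in>F. \<xi> s * of_real (\<phi> i s * \<phi> j (s - t)))"
          by (simp add: \<phi>(3) flip: sum_distrib_left sum_distrib_right of_real_sum)
        finally show "\<xi> t * (\<xi> (s - t) * of_real (\<phi> j (s - t))) = (\<Sum>i\<in>F. \<xi> s * of_real (\<phi> i s * \<phi> j (s - t)))" .
      qed
      also have "M \<dots> = (\<Sum>i\<in>F. c (i, j))"
        unfolding c_def fst_conv snd_conv by (rule M_sum) (rule uc_mult[OF \<xi>D(1) u2])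
      finally show ?thesis .
    qed
    define J where "J = {z\<in>F \<times> F. c z \<noteq> 0}"
    have J: "finite J" using F by (simp add: J_def)
    \<comment> \<open>A nonzero weight means that the two supports meet, so the nodes
      \<open>fst z\<close> and \<open>t + snd z\<close> are within \<open>2 * e\<close>; with the
      slack \<open>e\<close> in the choice of \<open>N\<close> each term contributes at most
      \<open>3 * e\<close> times its weight, and the weights sum to at most 1.\<close>
    have near: "weyl_dist (t + snd z - fst z) \<le> 2 * e" if z: "z \<in> J" for z
    proof -
      have "\<exists>s. \<phi> (fst z) s \<noteq> 0 \<and> \<phi> (snd z) (s - t) \<noteq> 0"
      proof (rule ccontr)
        assume "\<not> ?thesis"
        then have "(\<lambda>s. \<xi> s * of_real (\<phi> (fst z) s * \<phi> (snd z) (s - t))) = (\<lambda>s. 0)" by auto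
        then have "c z = 0" by (simp add: c_def)
        then show False using z by (simp add: J_def)
      qed
      then obtain s where s: "\<phi> (fst z) s \<noteq> 0" "\<phi> (snd z) (s - t) \<noteq> 0" by blast
      have "weyl_dist ((s - fst z) - (s - t - snd z)) \<le> weyl_dist (s - fst z) + weyl_dist (s - t - snd z)"
        using D_add[of "s - fst z" "- (s - t - snd z)"] unfolding D_minus diff_conv_add_uminus[symmetric] .
      moreover have "(s - fst z) - (s - t - snd z) = t + snd z - fst z" by (simp add: algebra_simps)
      ultimately show ?thesis using \<phi>(4)[OF s(1)] \<phi>(4)[OF s(2)] by simp
    qed
    have "stepanov_le (A N) (\<lambda>x. \<Sum>z\<in>J. c z * (f (x - fst z) - f (x - (t + snd z)))) (\<Sum>z\<in>J. norm (c z) * (3 * e))"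
    proof (rule stepanov_le_sum[OF J fdm A_open])
      fix z assume "z \<in> J"
      from stepanov_le_mono[OF N[OF order_refl], of "t + snd z - fst z" "3 * e"] near[OF this]
      show "stepanov_le (A N) (\<lambda>x. f (x - fst z) - f (x - (t + snd z))) (3 * e)"
        unfolding stepanov_diff_shift by simp
    qed
    moreover have "(\<Sum>z\<in>J. norm (c z) * (3 * e)) \<le> 3 * e"
    proof -
      have "(\<Sum>z\<in>J. norm (c z)) \<le> (\<Sum>z\<in>F \<times> F. norm (c z))"
        using F by (intro sum_mono2) (auto simp: J_def)
      also have "\<dots> \<le> (\<Sum>z\<in>F \<times> F. m z)" by (intro sum_mono cm)
      finally have "(\<Sum>z\<in>J. norm (c z)) \<le> 1" using msum by simp
      then show ?thesis using e by (simp flip: sum_distrib_right)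
    qed
    ultimately have "stepanov_le (A N) (\<lambda>x. \<Sum>z\<in>J. c z * (f (x - fst z) - f (x - (t + snd z)))) (3 * e)"
      by (rule stepanov_le_mono)
    then show ?thesis
    proof (rule stepanov_le_dominated)
      fix x
      have "(\<Sum>z\<in>J. c z * (f (x - fst z) - f (x - (t + snd z)))) = (\<Sum>z\<in>F \<times> F. c z * (f (x - fst z) - f (x - (t + snd z))))"
        using F by (intro sum.mono_neutral_left) (auto simp: J_def)
      also have "\<dots> = (\<Sum>i\<in>F. \<Sum>j\<in>F. c (i, j) * f (x - i)) - (\<Sum>i\<in>F. \<Sum>j\<in>F. c (i, j) * f (x - (t + j)))"
        by (simp add: sum.cartesian_product case_prod_beta right_diff_distrib sum_subtractf)
      also have "(\<Sum>i\<in>F. \<Sum>j\<in>F. c (i, j) * f (x - i)) = smoothing \<phi> F \<xi> x"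
        unfolding smoothing_def left by (simp add: sum_distrib_right)
      also have "(\<Sum>i\<in>F. \<Sum>j\<in>F. c (i, j) * f (x - (t + j))) = \<xi> t * smoothing \<phi> F \<xi> (x - t)"
      proof -
        have "\<xi> t * smoothing \<phi> F \<xi> (x - t) = (\<Sum>j\<in>F. (\<xi> t * M (\<lambda>s. \<xi> s * of_real (\<phi> j s))) * f (x - t - j))"
          unfolding smoothing_def by (simp add: sum_distrib_left mult.assoc)
        also have "\<dots> = (\<Sum>j\<in>F. \<Sum>i\<in>F. c (i, j) * f (x - (t + j)))"
          unfolding right by (simp add: sum_distrib_right diff_diff_eq)
        also have "\<dots> = (\<Sum>i\<in>F. \<Sum>j\<in>F. c (i, j) * f (x - (t + j)))" by (rule sum.swap)
        finally show ?thesis by simp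
      qed
      finally have eq: "(\<Sum>z\<in>J. c z * (f (x - fst z) - f (x - (t + snd z)))) = smoothing \<phi> F \<xi> x - \<xi> t * smoothing \<phi> F \<xi> (x - t)" .
      have "cnj (\<xi> x) * \<xi> t = cnj (\<xi> (x - t)) * (\<xi> t * cnj (\<xi> t))"
        using \<xi>D(3)[of "x - t" t] by (simp del: \<xi>D(4))
      then have "cnj (\<xi> (x - t)) = cnj (\<xi> x) * \<xi> t" by (simp add: \<xi>D(4))
      then have "G x - G (x - t) = cnj (\<xi> x) * (smoothing \<phi> F \<xi> x - \<xi> t * smoothing \<phi> F \<xi> (x - t))"
        by (simp add: G_def algebra_simps)
      then show "norm (G x - G (x - t)) \<le> norm (\<Sum>z\<in>J. c z * (f (x - fst z) - f (x - (t + snd z))))"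
        unfolding eq by (simp add: norm_mult \<xi>D(2))
    qed
  qed
  \<comment> \<open>The almost invariance \<open>3 * e\<close> becomes \<open>6 * e\<close> through
    \<open>almost_constant\<close> and \<open>12 * e\<close> through
    \<open>domination\<close>.\<close>
  obtain a where a: "stepanov_le (A N) (\<lambda>x. G x - a) (2 * (3 * e))"
    by (rule almost_constant[OF A_open A_precompact A_nonempty G inv])
  obtain N' where "\<And>n g c. n \<ge> N' \<Longrightarrow> g \<in> borel_measurable borel \<Longrightarrow> stepanov_le (A N) g c \<Longrightarrow> stepanov_le (A n) g (2 * c)"
    using domination[of N] by blast
  then have N': "stepanov_le (A n) (\<lambda>x. G x - a) (2 * (2 * (3 * e)))" if "n \<ge> N'" for n
    using a that borel_measurable_diff[OF Lp_loc_measurable[OF G] borel_measurable_const] by blast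
  show ?thesis
  proof (rule that[of N' a])
    fix n assume n: "n \<ge> N'"
    have "stepanov_le (A n) (\<lambda>x. smoothing \<phi> F \<xi> x - a * \<xi> x) (2 * (2 * (3 * e)))"
    proof (rule stepanov_le_dominated[OF N'[OF n]])
      fix x
      have "smoothing \<phi> F \<xi> x - a * \<xi> x = \<xi> x * (G x - a)"
        using \<xi>D(4)[of x] by (simp add: G_def right_diff_distrib mult.assoc[symmetric] del: \<xi>D(4))
      then show "norm (smoothing \<phi> F \<xi> x - a * \<xi> x) \<le> norm (G x - a)" by (simp add: norm_mult \<xi>D(2))
    qed
    then show "stepanov_le (A n) (\<lambda>x. smoothing \<phi> F \<xi> x - a * \<xi> x) (12 * e)" by simp
  qed
qed

text \<open>The difference of \<open>f\<close> and \<open>P\<close> splits into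
  \<open>g1 + g2 + g3\<close>: averaging \<open>f\<close> over translations near 0 with weight
  \<open>\<kappa>\<close> divided by \<open>\<mu>\<close>, replacing \<open>\<kappa>\<close> by its
  trigonometric approximant \<open>w\<close>, and replacing the smoothing by each character with a
  multiple of that character. Each part costs at most \<open>\<epsilon> / 4\<close>.\<close>

theorem trigonometric_approximation:
  assumes \<epsilon>: "\<epsilon> > 0"
  obtains P N where "trigonometric_polynomial P" "\<And>n. n \<ge> N \<Longrightarrow> stepanov_le (A n) (\<lambda>x. f x - P x) \<epsilon>"
proof -
  obtain b N0 where b: "b > 0" "\<And>n. n \<ge> N0 \<Longrightarrow> stepanov_le (A n) f b" using bounded by blast
  \<comment> \<open>The autocorrelation of \<open>bump e\<close> lives where
    \<open>weyl_dist\<close> is below \<open>2 * e\<close>, and the partition adds at most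
    \<open>e\<close>; the translations involved therefore have \<open>weyl_dist\<close> below
    \<open>3 * e = \<epsilon> / 4\<close>.\<close>
  define e where "e = \<epsilon> / 12"
  have e: "e > 0" using \<epsilon> by (simp add: e_def)
  define k where "k = (\<lambda>x. complex_of_real (bump e x))"
  have k: "uc k" unfolding k_def by (rule uc_bump)
  have uck: "uc (\<lambda>s. of_real (bump e (x + s) * bump e s))" for x
    using uc_mult[OF uc_shift'[OF uc_bump] uc_bump, of e x e] by simp
  define \<kappa> where "\<kappa> = (\<lambda>x. Re (acorr k x))"
  have acorr_k: "acorr k x = M (\<lambda>s. of_real (bump e (x + s) * bump e s))" for x
    by (simp add: acorr_def conv_def k_def)
  have \<kappa>: "acorr k = (\<lambda>x. of_real (\<kappa> x))"
    using M_real[OF uck] by (intro ext) (simp add: \<kappa>_def acorr_k)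
  have uc\<kappa>: "uc (\<lambda>x. of_real (\<kappa> x))" using uc_acorr[OF k] by (simp only: \<kappa>)
  have \<kappa>0: "0 \<le> \<kappa> x" for x
    unfolding \<kappa>_def acorr_k by (rule M_pos[OF uck]) (simp add: bump_def)
  have \<kappa>_supp: "weyl_dist x < 2 * e" if "\<kappa> x \<noteq> 0" for x
  proof (rule ccontr)
    assume *: "\<not> ?thesis"
    have "bump e (x + s) * bump e s = 0" for s
    proof -
      have "weyl_dist ((x + s) - s) \<le> weyl_dist (x + s) + weyl_dist s"
        using D_add[of "x + s" "- s"] unfolding D_minus diff_conv_add_uminus[symmetric] .
      then have "weyl_dist (x + s) \<ge> e \<or> weyl_dist s \<ge> e" using * by auto
      then show ?thesis by (auto simp: bump_def)
    qed
    then have "acorr k x = 0" unfolding acorr_k by (simp only: of_real_0 M_const)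
    then show False using that by (simp add: \<kappa>_def)
  qed
  define \<mu> where "\<mu> = Re (M (\<lambda>x. of_real (\<kappa> x)))"
  have "\<kappa> 0 > 0"
  proof -
    have "0 < Re (M (\<lambda>s. of_real (bump e (0 + s) * bump e s)))"
      by (rule positive_mean[OF uck, where z = 0]) (use e in \<open>auto simp: bump_def\<close>)
    then show ?thesis unfolding \<kappa>_def acorr_k .
  qed
  then have \<mu>: "\<mu> > 0" unfolding \<mu>_def by (rule positive_mean[OF uc\<kappa> \<kappa>0])
  have M\<kappa>: "M (\<lambda>x. of_real (\<kappa> x)) = of_real \<mu>" unfolding \<mu>_def using M_real[OF uc\<kappa>] by simp
  \<comment> \<open>An error \<open>\<eta> * \<mu>\<close> in the kernel, divided by
    \<open>\<mu>\<close>, meets translates of \<open>f\<close> of size at most \<open>b\<close>: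
    cost \<open>\<eta> * b = \<epsilon> / 4\<close>.\<close>
  define \<eta> where "\<eta> = \<epsilon> / (4 * b)"
  have \<eta>: "\<eta> > 0" using \<epsilon> b by (simp add: \<eta>_def)
  obtain X c where X: "finite X" "\<And>\<xi>. \<xi> \<in> X \<Longrightarrow> ap_character \<xi>"
    "\<And>x. norm (acorr k x - (\<Sum>\<xi>\<in>X. c \<xi> * \<xi> x)) \<le> \<eta> * \<mu>"
    using acorr_approximation[OF k, of "\<eta> * \<mu>"] \<eta> \<mu> by auto
  define w where "w = (\<lambda>x. \<Sum>\<xi>\<in>X. c \<xi> * \<xi> x)"
  have ucw: "uc w" unfolding w_def by (rule uc_trig_sum[OF X(2)])
  have \<kappa>w: "norm (of_real (\<kappa> x) - w x) \<le> \<eta> * \<mu>" for x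
    using X(3)[of x] by (simp add: \<kappa> w_def)
  define C where "C = (\<Sum>\<xi>\<in>X. norm (c \<xi> / of_real \<mu>))"
  have C: "C \<ge> 0" by (simp add: C_def sum_nonneg)
  \<comment> \<open>The partition is chosen after \<open>w\<close>: each character contributes an
    error \<open>12 * e'\<close> times its coefficient, and \<open>C\<close> is the total size of
    the coefficients divided by \<open>\<mu>\<close>. The bound by \<open>e\<close> keeps the
    supports near 0.\<close>
  define e' where "e' = min e (\<epsilon> / 48 / (C + 1))"
  have e': "e' > 0" "e' \<le> e" using e \<epsilon> C by (auto simp: e'_def)
  have Ce: "C * (12 * e') \<le> \<epsilon> / 4"
  proof -
    have "C * (12 * e') \<le> (C + 1) * (12 * (\<epsilon> / 48 / (C + 1)))"
      using C e'(1) by (intro mult_mono mult_left_mono) (auto simp: e'_def)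
    also have "\<dots> = \<epsilon> / 4"
    proof -
      have "C + 1 \<noteq> 0" using C by simp
      then have "(\<epsilon> / 48 / (C + 1)) * (C + 1) = \<epsilon> / 48" by (rule iffD1[OF nonzero_eq_divide_eq refl])
      then show ?thesis by (simp add: algebra_simps)
    qed
    finally show ?thesis .
  qed
  from uc_partition_of_unity[OF e'(1)] obtain F \<phi> where \<phi>: "finite F" "\<And>s. uc (\<lambda>x. of_real (\<phi> s x :: real))"
    "\<And>s x. 0 \<le> \<phi> s x" "\<And>x. (\<Sum>s\<in>F. \<phi> s x) = 1" "\<And>s x. \<phi> s x \<noteq> 0 \<Longrightarrow> weyl_dist (x - s) < e'" by metis
  have M\<phi>: "(\<Sum>j\<in>F. Re (M (\<lambda>s. of_real (\<phi> j s)))) = 1"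
  proof -
    have "(\<Sum>j\<in>F. M (\<lambda>s. of_real (\<phi> j s))) = M (\<lambda>s. \<Sum>j\<in>F. of_real (\<phi> j s))"
      by (rule M_sum[symmetric]) (rule \<phi>(2))
    also have "\<dots> = 1" by (simp only: \<phi>(4) of_real_sum[symmetric] of_real_1 M_one)
    finally show ?thesis by (simp flip: Re_sum)
  qed
  define v where "v = (\<lambda>j. M (\<lambda>s. of_real (\<kappa> s) * of_real (\<phi> j s)))"
  have uv: "uc (\<lambda>s. of_real (\<kappa> s) * of_real (\<phi> j s))" for j by (rule uc_mult[OF uc\<kappa> \<phi>(2)])
  have uv': "uc (\<lambda>s. of_real (\<kappa> s * \<phi> j s))" for j using uv by simp
  have uw: "uc (\<lambda>s. w s * of_real (\<phi> j s))" for j by (rule uc_mult[OF ucw \<phi>(2)])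
  have vsum: "(\<Sum>j\<in>F. v j) = of_real \<mu>"
  proof -
    have "(\<Sum>j\<in>F. v j) = M (\<lambda>s. \<Sum>j\<in>F. of_real (\<kappa> s) * of_real (\<phi> j s))"
      unfolding v_def by (rule M_sum[symmetric]) (rule uv)
    also have "(\<lambda>s. \<Sum>j\<in>F. complex_of_real (\<kappa> s) * of_real (\<phi> j s)) = (\<lambda>s. of_real (\<kappa> s))"
      by (simp only: sum_distrib_left[symmetric] of_real_sum[symmetric] \<phi>(4) of_real_1 mult_1_right)
    finally show ?thesis by (simp only: M\<kappa>)
  qed
  have vreal: "v j = of_real (Re (v j))" "0 \<le> Re (v j)" for j
  proof -
    have "v j = M (\<lambda>s. of_real (\<kappa> s * \<phi> j s))" by (simp add: v_def)
    then show "v j = of_real (Re (v j))" "0 \<le> Re (v j)"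
      using M_real[OF uv', of j] M_pos[OF uv', of j] \<kappa>0 \<phi>(3) by auto
  qed
  have vnorm: "norm (v j) = Re (v j)" for j
    using vreal[of j] by (metis abs_of_nonneg norm_of_real)
  have Revsum: "(\<Sum>j\<in>F. Re (v j)) = \<mu>" using arg_cong[OF vsum, of Re] by simp
  \<comment> \<open>Only the nodes with nonzero weight are near 0, so only for them is
    \<open>f x - f (x - j)\<close> known to be small.\<close>
  define F' where "F' = {j\<in>F. v j \<noteq> 0}"
  have F': "finite F'" "F' \<subseteq> F" using \<phi>(1) by (auto simp: F'_def)
  have near: "weyl_dist j < 3 * e" if j: "j \<in> F'" for j
  proof -
    have "\<exists>s. \<kappa> s \<noteq> 0 \<and> \<phi> j s \<noteq> 0"
    proof (rule ccontr)
      assume "\<not> ?thesis"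
      then have "(\<lambda>s. complex_of_real (\<kappa> s) * of_real (\<phi> j s)) = (\<lambda>s. 0)" by auto
      then show False using j by (simp add: F'_def v_def)
    qed
    then obtain s where s: "\<kappa> s \<noteq> 0" "\<phi> j s \<noteq> 0" by blast
    have "weyl_dist (s - (s - j)) \<le> weyl_dist s + weyl_dist (s - j)"
      using D_add[of s "- (s - j)"] unfolding D_minus diff_conv_add_uminus[symmetric] .
    then show ?thesis using \<kappa>_supp[OF s(1)] \<phi>(5)[OF s(2)] e'(2) by simp
  qed
  have "\<exists>N. \<forall>n\<ge>N. stepanov_le (A n) (\<lambda>x. f x - f (x - j)) (3 * e)" if "j \<in> F'" for j
    using weyl_dist_less[OF near[OF that]] by blast
  then obtain N1 where N1: "\<And>j n. j \<in> F' \<Longrightarrow> n \<ge> N1 j \<Longrightarrow> stepanov_le (A n) (\<lambda>x. f x - f (x - j)) (3 * e)" by metis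
  have "\<exists>a N. \<forall>n\<ge>N. stepanov_le (A n) (\<lambda>x. smoothing \<phi> F \<xi> x - a * \<xi> x) (12 * e')" if "\<xi> \<in> X" for \<xi>
    using smoothing_character[OF \<phi> e'(1) X(2)[OF that]] by blast
  then obtain a N2 where N2: "\<And>\<xi> n. \<xi> \<in> X \<Longrightarrow> n \<ge> N2 \<xi> \<Longrightarrow> stepanov_le (A n) (\<lambda>x. smoothing \<phi> F \<xi> x - a \<xi> * \<xi> x) (12 * e')"
    by metis
  define N where "N = Max (insert N0 (N1 ` F' \<union> N2 ` X))"
  have N: "N0 \<le> N" "\<And>j. j \<in> F' \<Longrightarrow> N1 j \<le> N" "\<And>\<xi>. \<xi> \<in> X \<Longrightarrow> N2 \<xi> \<le> N"
    using F'(1) X(1) by (auto simp: N_def)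
  define P where "P = (\<lambda>x. \<Sum>\<xi>\<in>X. (c \<xi> * a \<xi> / of_real \<mu>) * \<xi> x)"
  have P: "trigonometric_polynomial P"
    unfolding trigonometric_polynomial_def P_def
    using X(1,2) ap_character_continuous by (intro exI[of _ X] exI[of _ "\<lambda>\<xi>. c \<xi> * a \<xi> / of_real \<mu>"]) auto
  have char_m: "\<xi> \<in> borel_measurable borel" if "\<xi> \<in> X" for \<xi>
    using ap_character_continuous[OF X(2)[OF that]] borel_measurable_continuous_onI
    by (auto simp: continuous_character_def)
  show ?thesis
  proof (rule that[OF P, of N])
    fix n assume n: "n \<ge> N"
    define g1 where "g1 = (\<lambda>x. \<Sum>j\<in>F'. (v j / of_real \<mu>) * (f x - f (x - j)))"
    define g2 where "g2 = (\<lambda>x. \<Sum>j\<in>F. ((v j - M (\<lambda>s. w s * of_real (\<phi> j s))) / of_real \<mu>) * f (x - j))"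
    define g3 where "g3 = (\<lambda>x. \<Sum>\<xi>\<in>X. (c \<xi> / of_real \<mu>) * (smoothing \<phi> F \<xi> x - a \<xi> * \<xi> x))"
    have m: "g1 \<in> borel_measurable borel" "g2 \<in> borel_measurable borel"
      unfolding g1_def g2_def
      by (rule borel_measurable_sum, rule borel_measurable_times[OF borel_measurable_const], rule fdm' ftm)+
    have m3: "(\<lambda>x. smoothing \<phi> F \<xi> x - a \<xi> * \<xi> x) \<in> borel_measurable borel" if "\<xi> \<in> X" for \<xi>
      by (intro borel_measurable_diff smoothing_measurable borel_measurable_times borel_measurable_const char_m that)
    then have m3': "g3 \<in> borel_measurable borel"
      unfolding g3_def by (intro borel_measurable_sum borel_measurable_times borel_measurable_const)
    have s1: "stepanov_le (A n) g1 (3 * e)"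
    proof -
      have "stepanov_le (A n) g1 (\<Sum>j\<in>F'. norm (v j / of_real \<mu>) * (3 * e))"
        unfolding g1_def by (rule stepanov_le_sum[OF F'(1) fdm' A_open]) (use N1 N(2) n in \<open>meson order_trans\<close>)
      moreover have "(\<Sum>j\<in>F'. norm (v j / of_real \<mu>) * (3 * e)) \<le> 3 * e"
      proof -
        have "(\<Sum>j\<in>F'. norm (v j / of_real \<mu>)) = (\<Sum>j\<in>F'. Re (v j)) / \<mu>"
          using \<mu> by (simp add: norm_divide vnorm sum_divide_distrib)
        also have "\<dots> \<le> (\<Sum>j\<in>F. Re (v j)) / \<mu>"
          using \<mu> F'(2) \<phi>(1) vreal(2) by (intro divide_right_mono sum_mono2) auto
        also have "\<dots> = 1" using Revsum \<mu> by simp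
        finally show ?thesis using e by (simp flip: sum_distrib_right)
      qed
      ultimately show ?thesis by (rule stepanov_le_mono)
    qed
    have s2: "stepanov_le (A n) g2 (\<eta> * b)"
    proof -
      have fb: "stepanov_le (A n) (\<lambda>x. f (x - j)) b" for j
        by (rule stepanov_le_translate_minus[OF fm A_open b(2)]) (use N(1) n in simp)
      have "stepanov_le (A n) g2 (\<Sum>j\<in>F. norm ((v j - M (\<lambda>s. w s * of_real (\<phi> j s))) / of_real \<mu>) * b)"
        unfolding g2_def by (rule stepanov_le_sum[OF \<phi>(1) ftm A_open fb])
      moreover have "(\<Sum>j\<in>F. norm ((v j - M (\<lambda>s. w s * of_real (\<phi> j s))) / of_real \<mu>) * b) \<le> \<eta> * b"
      proof -
        have "norm (v j - M (\<lambda>s. w s * of_real (\<phi> j s))) \<le> (\<eta> * \<mu>) * Re (M (\<lambda>s. of_real (\<phi> j s)))" for j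
        proof -
          have "v j - M (\<lambda>s. w s * of_real (\<phi> j s)) = M (\<lambda>s. (of_real (\<kappa> s) - w s) * of_real (\<phi> j s))"
            unfolding v_def left_diff_distrib by (rule M_diff[OF uv uw, symmetric])
          then show ?thesis
            using norm_mean_weighted_le[OF uc_diff[OF uc\<kappa> ucw] \<kappa>w \<phi>(2,3)] by simp
        qed
        then have "(\<Sum>j\<in>F. norm ((v j - M (\<lambda>s. w s * of_real (\<phi> j s))) / of_real \<mu>))
            \<le> (\<Sum>j\<in>F. ((\<eta> * \<mu>) * Re (M (\<lambda>s. of_real (\<phi> j s)))) / \<mu>)"
          using \<mu> by (intro sum_mono) (simp add: norm_divide divide_le_eq mult_ac)
        also have "\<dots> = \<eta> * (\<Sum>j\<in>F. Re (M (\<lambda>s. of_real (\<phi> j s))))"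
          using \<mu> by (simp add: sum_distrib_left)
        finally show ?thesis using b(1) M\<phi> by (simp flip: sum_distrib_right)
      qed
      ultimately show ?thesis by (rule stepanov_le_mono)
    qed
    have s3: "stepanov_le (A n) g3 (\<epsilon> / 4)"
    proof -
      have "stepanov_le (A n) g3 (\<Sum>\<xi>\<in>X. norm (c \<xi> / of_real \<mu>) * (12 * e'))"
        unfolding g3_def by (rule stepanov_le_sum[OF X(1) m3 A_open]) (use N2 N(3) n in \<open>auto intro: order_trans\<close>)
      moreover have "(\<Sum>\<xi>\<in>X. norm (c \<xi> / of_real \<mu>) * (12 * e')) \<le> \<epsilon> / 4"
        using Ce by (simp only: C_def sum_distrib_right)
      ultimately show ?thesis by (rule stepanov_le_mono)
    qed
    \<comment> \<open>The sums telescope: the weights \<open>v j\<close> sum to \<open>\<mu>\<close>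
      and so reproduce \<open>f x\<close>, and \<open>smoothing\<close> is linear in its weight
      function, which splits the smoothing by \<open>w\<close> into those by the characters in
      \<open>X\<close>.\<close>
    have eq: "f x - P x = (g1 x + g2 x) + g3 x" for x
    proof -
      have \<mu>nz: "complex_of_real \<mu> \<noteq> 0" using \<mu> by simp
      have "g1 x = (\<Sum>j\<in>F. (v j / of_real \<mu>) * (f x - f (x - j)))"
        unfolding g1_def using \<phi>(1) by (intro sum.mono_neutral_left) (auto simp: F'_def)
      also have "\<dots> = (\<Sum>j\<in>F. v j) / of_real \<mu> * f x - (\<Sum>j\<in>F. v j / of_real \<mu> * f (x - j))"
        by (simp add: right_diff_distrib sum_subtractf sum_distrib_right sum_divide_distrib)
      finally have 1: "g1 x = f x - (\<Sum>j\<in>F. v j / of_real \<mu> * f (x - j))"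
        unfolding vsum using \<mu>nz by simp
      have "smoothing \<phi> F w x = (\<Sum>\<xi>\<in>X. c \<xi> * smoothing \<phi> F \<xi> x)"
      proof -
        have "M (\<lambda>s. w s * of_real (\<phi> j s)) = (\<Sum>\<xi>\<in>X. c \<xi> * M (\<lambda>s. \<xi> s * of_real (\<phi> j s)))" for j
        proof -
          have u\<xi>: "uc (\<lambda>s. \<xi> s * of_real (\<phi> j s))" if "\<xi> \<in> X" for \<xi>
            by (rule uc_mult[OF ap_characterD(1)[OF X(2)[OF that]] \<phi>(2)])
          have "M (\<lambda>s. w s * of_real (\<phi> j s)) = M (\<lambda>s. \<Sum>\<xi>\<in>X. c \<xi> * (\<xi> s * of_real (\<phi> j s)))"
            by (simp add: w_def sum_distrib_right mult.assoc)
          also have "\<dots> = (\<Sum>\<xi>\<in>X. M (\<lambda>s. c \<xi> * (\<xi> s * of_real (\<phi> j s))))"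
            by (rule M_sum) (rule uc_mult[OF uc_const u\<xi>])
          also have "\<dots> = (\<Sum>\<xi>\<in>X. c \<xi> * M (\<lambda>s. \<xi> s * of_real (\<phi> j s)))"
            by (intro sum.cong refl M_cmult u\<xi>)
          finally show ?thesis .
        qed
        then show ?thesis
          unfolding smoothing_def by (simp add: sum_distrib_left sum_distrib_right mult.assoc sum.swap[of _ X F])
      qed
      then have 3: "g3 x = smoothing \<phi> F w x / of_real \<mu> - P x"
        unfolding g3_def P_def by (simp add: right_diff_distrib sum_subtractf sum_divide_distrib mult.assoc)
      have 2: "g2 x = (\<Sum>j\<in>F. v j / of_real \<mu> * f (x - j)) - smoothing \<phi> F w x / of_real \<mu>"
        unfolding g2_def smoothing_def
        by (simp add: diff_divide_distrib left_diff_distrib sum_subtractf sum_divide_distrib)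
      show ?thesis unfolding 1 2 3 by simp
    qed
    have "stepanov_le (A n) (\<lambda>x. (g1 x + g2 x) + g3 x) ((3 * e + \<eta> * b) + \<epsilon> / 4)"
      by (rule stepanov_le_add[OF borel_measurable_add[OF m] m3' A_open stepanov_le_add[OF m A_open s1 s2] s3])
    moreover have "(3 * e + \<eta> * b) + \<epsilon> / 4 \<le> \<epsilon>"
      using \<epsilon> b(1) by (simp add: e_def \<eta>_def)
    ultimately show "stepanov_le (A n) (\<lambda>x. f x - P x) \<epsilon>"
      unfolding eq by (rule stepanov_le_mono)
  qed
qed

end

section \<open>Almost periods of trigonometric polynomials\<close>

text \<open>The characters in \<open>X\<close> map the group to a torus, which is totally bounded.\<close>

lemma relatively_dense_character_periods:
  fixes X :: "('a::{topological_ab_group_add, t2_space} \<Rightarrow> complex) set"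
  assumes X: "finite X" "\<And>\<psi>. \<psi> \<in> X \<Longrightarrow> continuous_character \<psi>" and d: "d > 0"
  shows "relatively_dense {t. \<forall>\<psi>\<in>X. norm (\<psi> t - 1) < d}"
proof -
  have mult: "\<psi> (x + y) = \<psi> x * \<psi> y" and n1: "norm (\<psi> x) = 1" if "\<psi> \<in> X" for \<psi> x y
    using X(2)[OF that] by (auto simp: continuous_character_def)
  have "compact (sphere (0::complex) 1)" by simp
  then have "\<exists>k. finite k \<and> k \<subseteq> sphere (0::complex) 1 \<and> sphere (0::complex) 1 \<subseteq> (\<Union>x\<in>k. ball x (d / 2))"
    by (rule compactE_image[of _ "sphere 0 1" "\<lambda>x. ball x (d / 2)"]) (use d in auto)
  then obtain C where C: "finite C" "sphere (0::complex) 1 \<subseteq> (\<Union>x\<in>C. ball x (d / 2))" by blast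
  have "\<exists>z\<in>C. dist z (\<psi> t) < d / 2" if "\<psi> \<in> X" for \<psi> t
    using C(2) n1[OF that, of t] by (auto simp: subset_iff dist_norm)
  then have "\<forall>t \<psi>. \<exists>z. \<psi> \<in> X \<longrightarrow> z \<in> C \<and> dist z (\<psi> t) < d / 2" by blast
  then obtain q where q: "\<And>\<psi> t. \<psi> \<in> X \<Longrightarrow> q t \<psi> \<in> C \<and> dist (q t \<psi>) (\<psi> t) < d / 2" by metis
  \<comment> \<open>Pigeonhole: \<open>Q t\<close> records for every character in \<open>X\<close> a
    net point near its value at \<open>t\<close>, and takes finitely many values. One representative
    \<open>s\<close> per value suffices, because \<open>Q s = Q t\<close> puts
    \<open>\<psi> t\<close> and \<open>\<psi> s\<close> closer than \<open>d\<close>, that is,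
    \<open>t - s\<close> is a common almost period.\<close>
  define Q where "Q = (\<lambda>t. restrict (q t) X)"
  have "range Q \<subseteq> (\<Pi>\<^sub>E \<psi>\<in>X. C)" using q by (auto simp: Q_def)
  then have fin: "finite (range Q)" using finite_PiE[OF X(1), of "\<lambda>_. C"] C(1) finite_subset by blast
  define F where "F = (\<lambda>z. SOME t. Q t = z) ` range Q"
  have F: "finite F" using fin by (simp add: F_def)
  show ?thesis unfolding relatively_dense_def
  proof (intro exI conjI)
    show "compact F" by (rule finite_imp_compact[OF F])
    have "t \<in> {r + k | r k. r \<in> {t. \<forall>\<psi>\<in>X. norm (\<psi> t - 1) < d} \<and> k \<in> F}" for t
    proof -
      define s where "s = (SOME s. Q s = Q t)"
      have sF: "s \<in> F" by (auto simp: F_def s_def)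
      have "Q s = Q t" unfolding s_def by (rule someI[of _ t]) simp
      have "norm (\<psi> (t - s) - 1) < d" if \<psi>: "\<psi> \<in> X" for \<psi>
      proof -
        have "q s \<psi> = q t \<psi>" using fun_cong[OF \<open>Q s = Q t\<close>, of \<psi>] \<psi> by (simp add: Q_def)
        then have "dist (\<psi> t) (\<psi> s) < d"
          using q[OF \<psi>, of s] q[OF \<psi>, of t] dist_triangle3[of "\<psi> t" "\<psi> s" "q t \<psi>"] by simp
        moreover have "\<psi> t - \<psi> s = (\<psi> (t - s) - 1) * \<psi> s"
          using mult[OF \<psi>, of "t - s" s] by (simp add: left_diff_distrib)
        ultimately show ?thesis by (simp add: dist_norm norm_mult n1[OF \<psi>])
      qed
      then show ?thesis using sF by (intro CollectI exI[of _ "t - s"] exI[of _ s]) simp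
    qed
    then show "{r + k | r k. r \<in> {t. \<forall>\<psi>\<in>X. norm (\<psi> t - 1) < d} \<and> k \<in> F} = UNIV" by blast
  qed
qed

lemma trigonometric_polynomial_continuous:
  "trigonometric_polynomial P \<Longrightarrow> continuous_on UNIV P"
  by (auto simp: trigonometric_polynomial_def continuous_character_def
      intro!: continuous_on_sum continuous_on_mult continuous_on_const)

lemma trigonometric_polynomial_almost_period:
  fixes P :: "'a::{topological_ab_group_add, t2_space} \<Rightarrow> complex"
  assumes P: "trigonometric_polynomial P" and e: "e > 0"
  obtains R where "relatively_dense R" "\<And>t x. t \<in> R \<Longrightarrow> norm (P x - P (x - t)) \<le> e"
proof -
  obtain X c where X: "finite X" "\<And>\<psi>. \<psi> \<in> X \<Longrightarrow> continuous_character \<psi>" "P = (\<lambda>x. \<Sum>\<psi>\<in>X. c \<psi> * \<psi> x)"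
    using P unfolding trigonometric_polynomial_def by blast
  define S where "S = (\<Sum>\<psi>\<in>X. norm (c \<psi>))"
  have S: "S \<ge> 0" by (simp add: S_def sum_nonneg)
  define d where "d = e / (S + 1)"
  have d: "d > 0" using e S by (simp add: d_def)
  show ?thesis
  proof (rule that[OF relatively_dense_character_periods[OF X(1,2) d]])
    fix t x assume t: "t \<in> {t. \<forall>\<psi>\<in>X. norm (\<psi> t - 1) < d}"
    have "P x - P (x - t) = (\<Sum>\<psi>\<in>X. c \<psi> * (\<psi> x - \<psi> (x - t)))"
      by (simp add: X(3) right_diff_distrib sum_subtractf)
    also have "norm \<dots> \<le> (\<Sum>\<psi>\<in>X. norm (c \<psi>) * d)"
    proof (rule sum_norm_le)
      fix \<psi> assume \<psi>: "\<psi> \<in> X"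
      have cc: "\<psi> (y + z) = \<psi> y * \<psi> z" "norm (\<psi> y) = 1" for y z
        using X(2)[OF \<psi>] by (auto simp: continuous_character_def)
      have "\<psi> x - \<psi> (x - t) = \<psi> (x - t) * (\<psi> t - 1)"
        using cc(1)[of "x - t" t] by (simp add: right_diff_distrib)
      then have "norm (\<psi> x - \<psi> (x - t)) \<le> d" using t \<psi> cc(2) by (auto simp: norm_mult less_imp_le)
      then show "norm (c \<psi> * (\<psi> x - \<psi> (x - t))) \<le> norm (c \<psi>) * d"
        by (simp add: norm_mult mult_left_mono)
    qed
    also have "\<dots> = S * d" by (simp add: S_def sum_distrib_right)
    also have "\<dots> \<le> e" using e S by (simp add: d_def divide_le_eq mult.commute)
    finally show "norm (P x - P (x - t)) \<le> e" .
  qed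
qed

theorem proposition3p13:
  fixes \<theta> :: "'a::{topological_ab_group_add, t2_space} measure"
    and A :: "nat \<Rightarrow> 'a set"
    and p :: real
    and f :: "'a \<Rightarrow> complex"
  assumes "locally_compact_space (euclidean :: 'a topology)"
    and "haar_measure \<theta>"
    and "van_hove_sequence \<theta> A"
    and "1 \<le> p"
    and "f \<in> Lp_loc \<theta> p"
  shows "weyl_almost_periodic \<theta> p A f \<longleftrightarrow>
    (\<forall>\<epsilon>>0::real. \<exists>R N. relatively_dense R \<and>
       (\<forall>n\<ge>N. \<forall>t\<in>R. stepanov_norm \<theta> p (A n) (\<lambda>x. f x - translate t f x) < ennreal \<epsilon>))"
proof -
  interpret weyl_setting \<theta> p A
    by unfold_locales (use assms in auto)
  note fm = Lp_loc_measurable[OF assms(5)]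
  note norm_iff = stepanov_norm_le_iff[OF A_open A_nonempty A_precompact]
  show ?thesis
  proof
    assume "weyl_almost_periodic \<theta> p A f"
    then obtain P where P: "\<And>m. trigonometric_polynomial (P m)"
      "(\<lambda>m. limsup (\<lambda>n. stepanov_norm \<theta> p (A n) (\<lambda>x. f x - P m x))) \<longlonglongrightarrow> 0"
      unfolding weyl_almost_periodic_def by blast
    show "\<forall>\<epsilon>>0::real. \<exists>R N. relatively_dense R \<and>
       (\<forall>n\<ge>N. \<forall>t\<in>R. stepanov_norm \<theta> p (A n) (\<lambda>x. f x - translate t f x) < ennreal \<epsilon>)"
    proof (intro allI impI)
      fix \<epsilon> :: real assume \<epsilon>: "\<epsilon> > 0"
      \<comment> \<open>Three errors of size \<open>e\<close> leave room for the strict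
        inequality.\<close>
      define e where "e = \<epsilon> / 4"
      have e: "e > 0" using \<epsilon> by (simp add: e_def)
      have "\<forall>\<^sub>F m in sequentially. limsup (\<lambda>n. stepanov_norm \<theta> p (A n) (\<lambda>x. f x - P m x)) < ennreal e"
        by (rule order_tendstoD(2)[OF P(2)]) (use e in simp)
      then obtain m where "limsup (\<lambda>n. stepanov_norm \<theta> p (A n) (\<lambda>x. f x - P m x)) < ennreal e"
        by (auto simp: eventually_sequentially)
      then have "\<forall>\<^sub>F n in sequentially. stepanov_norm \<theta> p (A n) (\<lambda>x. f x - P m x) < ennreal e"
        by (rule Limsup_lessD)
      then obtain N where "\<And>n. n \<ge> N \<Longrightarrow> stepanov_norm \<theta> p (A n) (\<lambda>x. f x - P m x) < ennreal e"
        unfolding eventually_sequentially by blast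
      then have N: "stepanov_le (A n) (\<lambda>x. f x - P m x) e" if "n \<ge> N" for n
        using that norm_iff[of e n] e by (meson less_imp_le)
      obtain R where R: "relatively_dense R" "\<And>t x. t \<in> R \<Longrightarrow> norm (P m x - P m (x - t)) \<le> e"
        using trigonometric_polynomial_almost_period[OF P(1)[of m] e] by blast
      have Pm: "P m \<in> borel_measurable borel"
        by (rule borel_measurable_continuous_onI[OF trigonometric_polynomial_continuous[OF P(1)]])
      have "stepanov_norm \<theta> p (A n) (\<lambda>x. f x - translate t f x) < ennreal \<epsilon>" if n: "n \<ge> N" and t: "t \<in> R" for n t
      proof -
        have ft: "(\<lambda>x. f (x - t)) \<in> borel_measurable borel" "(\<lambda>x. P m (x - t)) \<in> borel_measurable borel"
          by (rule measurable_shift_minus[OF fm] measurable_shift_minus[OF Pm])+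
        have 1: "stepanov_le (A n) (\<lambda>x. P m x - P m (x - t)) e"
          by (rule stepanov_le_const[OF A_open A_precompact]) (use e R(2)[OF t] in auto)
        have 2: "stepanov_le (A n) (\<lambda>x. P m (x - t) - f (x - t)) e"
          by (rule stepanov_le_minus[OF stepanov_le_translate_minus[OF borel_measurable_diff[OF fm Pm] A_open N[OF n]]])
        have "stepanov_le (A n) (\<lambda>x. f x - f (x - t)) (e + e + e)"
          by (rule stepanov_le_triangle[OF fm ft(2,1) A_open stepanov_le_triangle[OF fm Pm ft(2) A_open N[OF n] 1] 2])
        then have "stepanov_norm \<theta> p (A n) (\<lambda>x. f x - translate t f x) \<le> ennreal (e + e + e)"
          using norm_iff[of "e + e + e" n] e unfolding translate_def by simp
        also have "\<dots> < ennreal \<epsilon>" using \<epsilon> by (intro ennreal_lessI) (auto simp: e_def)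
        finally show ?thesis .
      qed
      with R(1) show "\<exists>R N. relatively_dense R \<and>
         (\<forall>n\<ge>N. \<forall>t\<in>R. stepanov_norm \<theta> p (A n) (\<lambda>x. f x - translate t f x) < ennreal \<epsilon>)" by blast
    qed
  next
    assume H: "\<forall>\<epsilon>>0::real. \<exists>R N. relatively_dense R \<and>
       (\<forall>n\<ge>N. \<forall>t\<in>R. stepanov_norm \<theta> p (A n) (\<lambda>x. f x - translate t f x) < ennreal \<epsilon>)"
    interpret weyl_function \<theta> p A f
    proof unfold_locales
      fix e :: real assume e: "e > 0"
      from H e obtain R N where R: "relatively_dense R"
        "\<And>n t. n \<ge> N \<Longrightarrow> t \<in> R \<Longrightarrow> stepanov_norm \<theta> p (A n) (\<lambda>x. f x - translate t f x) < ennreal e" by blast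
      have "stepanov_le (A n) (\<lambda>x. f x - f (x - t)) e" if "n \<ge> N" "t \<in> R" for n t
        using R(2)[OF that] norm_iff[of e n] e unfolding translate_def by (meson less_imp_le)
      with R(1) show "\<exists>R N. relatively_dense R \<and> (\<forall>n\<ge>N. \<forall>t\<in>R. stepanov_le (A n) (\<lambda>x. f x - f (x - t)) e)"
        by blast
    qed (rule assms(5))
    \<comment> \<open>The mean is built for the pseudonorm of this particular \<open>f\<close>;
      total boundedness and continuity of \<open>weyl_dist\<close> are what its construction asks
      for.\<close>
    obtain M where "invariant_mean weyl_dist M"
      by (rule exists_invariant_mean[OF totally_bounded_pseudonorm_axioms weyl_dist_continuous])
    then interpret weyl_mean \<theta> p A f M
      by (rule weyl_mean.intro[OF weyl_function_axioms weyl_mean_axioms.intro])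
    have "\<exists>P. trigonometric_polynomial P \<and>
        limsup (\<lambda>n. stepanov_norm \<theta> p (A n) (\<lambda>x. f x - P x)) \<le> ennreal (inverse (real (Suc m)))" for m
    proof -
      have pos: "inverse (real (Suc m)) > 0" by simp
      obtain P N where P: "trigonometric_polynomial P"
        "\<And>n. n \<ge> N \<Longrightarrow> stepanov_le (A n) (\<lambda>x. f x - P x) (inverse (real (Suc m)))"
        by (rule trigonometric_approximation[OF pos]) blast
      have "\<forall>\<^sub>F n in sequentially. stepanov_norm \<theta> p (A n) (\<lambda>x. f x - P x) \<le> ennreal (inverse (real (Suc m)))"
        unfolding eventually_sequentially
        by (intro exI[of _ N] allI impI iffD2[OF norm_iff[OF less_imp_le[OF pos]]] P(2))
      from Limsup_bounded[OF this] P(1) show ?thesis by (intro exI[of _ P] conjI)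
    qed
    then obtain P where P: "\<And>m. trigonometric_polynomial (P m)"
      "\<And>m. limsup (\<lambda>n. stepanov_norm \<theta> p (A n) (\<lambda>x. f x - P m x)) \<le> ennreal (inverse (real (Suc m)))"
      by metis
    have "(\<lambda>m. ennreal (inverse (real (Suc m)))) \<longlonglongrightarrow> ennreal 0"
      by (rule tendsto_ennrealI[OF LIMSEQ_inverse_real_of_nat])
    then have lim: "(\<lambda>m. ennreal (inverse (real (Suc m)))) \<longlonglongrightarrow> 0" by simp
    have "(\<lambda>m. limsup (\<lambda>n. stepanov_norm \<theta> p (A n) (\<lambda>x. f x - P m x))) \<longlonglongrightarrow> 0"
      by (rule tendsto_sandwich[OF _ _ tendsto_const lim]) (use P(2) in auto)
    then show "weyl_almost_periodic \<theta> p A f"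
      unfolding weyl_almost_periodic_def using P(1) by blast
  qed
qed

end
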